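(* Let $n\ge 1$. Regard $\mathrm{Pol}_n^-$ as a right ${}^{B}\Lambda_n^-$-module. There are $\mathbb{Z}$-algebra isomorphisms $${}^{B}\mathrm{NH}_n^-\xrightarrow{\ \cong\ }\mathrm{End}_{{}^{B}\Lambda_n^-}(\mathrm{Pol}_n^-)\cong\mathrm{Mat}_{q^{n^2}[2n]!!}({}^{B}\Lambda_n^-),$$ where the first map is given by the action of ${}^{B}\mathrm{NH}_n^-$ on its polynomial representation $\mathrm{Pol}_n^-$.
   Context: $\mathrm{Pol}_n^-$ is the unital $\mathbb{Z}$-algebra generated by $x_1,\dots,x_n$ subject to $x_ix_j+x_jx_i=0$ for all $i\ne j$. The spin type B nilHecke algebra ${}^{B}\mathrm{NH}_n^-$ is the unital $\mathbb{Z}$-algebra generated by $x_1,\dots,x_n$, $\partial_1^-,\dots,\partial_{n-1}^-$, $\partial_n^B$ subject to $x_ix_j+x_jx_i=0$ ($i\neq j$) and, for $1\le i\le n-1$ (whenever the indices make sense): $(\partial_i^-)^2=0$; $\partial_i^-\partial_{i+1}^-\partial_i^-=\partial_{i+1}^-\partial_i^-\partial_{i+1}^-$; $\partial_i^-\partial_j^-+\partial_j^-\partial_i^-=0$ for $|i-j|>1$; $x_i\partial_i^-+\partial_i^-x_{i+1}=1$; $\partial_i^-x_i+x_{i+1}\partial_i^-=1$; $\partial_i^-x_j+x_j\partial_i^-=0$ for $j\ne i,i+1$; and $(\partial_n^B)^2=0$; $\partial_n^B\partial_{n-1}^-\partial_n^B\partial_{n-1}^-=-\partial_{n-1}^-\partial_n^B\partial_{n-1}^-\partial_n^B$;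 $\partial_n^B\partial_i^-+\partial_i^-\partial_n^B=0$ for $1\le i\le n-2$; $\partial_n^Bx_n+x_n\partial_n^B=1$; $\partial_n^Bx_i+x_i\partial_n^B=0$ for $1\le i\le n-1$. It is $\mathbb{Z}$-graded by $|x_i|=2$, $|\partial_i^-|=|\partial_n^B|=-2$. It acts on $\mathrm{Pol}_n^-$ as follows. The $x_i$ act by left multiplication. For $1\le i\le n-1$ let $s_i$ be the algebra endomorphism of $\mathrm{Pol}_n^-$ with $s_i(x_i)=-x_{i+1}$, $s_i(x_{i+1})=-x_i$, $s_i(x_j)=-x_j$ for $j\ne i,i+1$, and let $s_n^B$ be the algebra endomorphism with $s_n^B(x_j)=-x_j$ for all $j$. Then $\partial_i^-$ and $\partial_n^B$ act as the $\mathbb{Z}$-linear (odd Demazure) operators that kill $1$ and satisfy: $\partial_i^-(x_j)=1$ if $j\in\{i,i+1\}$ and $0$ otherwise; $\partial_n^B(x_j)=1$ if $j=n$ and $0$ otherwise; $\partial_i^-(fg)=\partial_i^-(f)g+s_i(f)\partial_i^-(g)$, $\partial_n^B(fg)=\partial_n^B(f)g+s_n^B(f)\partial_n^B(g)$. The ring of spin type B symmetric polynomials is ${}^{B}\Lambda_n^-=\bigcap_{i=1}^{n-1}\ker(\partial_i^-)\cap\ker(\partial_n^B)\subset\mathrm{Pol}_n^-$. The left action of ${}^{B}\mathrm{NH}_n^-$ commutes with right multiplication by ${}^{B}\Lambda_n^-$. Notation: $[m]=\frac{q^m-q^{-m}}{q-q^{-1}}$, $[2n]!!=[2n][2n-2]\cdots[2]$.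 For $f(q)=\sum_{i=1}^N q^{d_i}$, $\mathrm{Mat}_{f(q)}(R)$ denotes the algebra $\mathrm{Mat}_N(R)$ of $N\times N$ matrices over the graded ring $R$, graded as the endomorphism algebra of a free graded $R$-module with basis in degrees $d_1,\dots,d_N$. Here $N=2^nn!$. *)

theory Defs
  imports
    "HOL-Library.Poly_Mapping"
    "HOL-Computational_Algebra.Formal_Laurent_Series"
    "HOL-Algebra.QuotRing"
begin

section \<open>Presented \<open>\<int>\<close>-algebras\<close>

text \<open>Words form the free monoid, so \<open>'a list \<Rightarrow>\<^sub>0 int\<close> with the convolution product of
  \<^theory>\<open>HOL-Library.Poly_Mapping\<close> is the free unital \<open>\<int>\<close>-algebra on \<open>'a\<close>.\<close>

instantiation list :: (type) monoid_add
begin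

definition zero_list :: "'a list" where "zero_list = []"

definition plus_list :: "'a list \<Rightarrow> 'a list \<Rightarrow> 'a list" where "plus_list = (@)"

instance
  by standard (simp_all add: zero_list_def plus_list_def)

end

type_synonym 'a free_alg = "'a list \<Rightarrow>\<^sub>0 int"

definition gen :: "'a \<Rightarrow> 'a free_alg" where
  "gen a = Poly_Mapping.single [a] 1"

definition free_algebra :: "'a set \<Rightarrow> 'a free_alg ring" where
  "free_algebra A = \<lparr>carrier = {f. Poly_Mapping.keys f \<subseteq> lists A},
     mult = (*), one = 1, zero = 0, add = (+)\<rparr>"

definition presented_algebra :: "'a set \<Rightarrow> 'a free_alg set \<Rightarrow> 'a free_alg set ring" where
  "presented_algebra A rel = free_algebra A Quot (genideal (free_algebra A) rel)"

definition presented_class :: "'a set \<Rightarrow> 'a free_alg set \<Rightarrow> 'a free_alg \<Rightarrow> 'a free_alg set" where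
  "presented_class A rel f = genideal (free_algebra A) rel +>\<^bsub>free_algebra A\<^esub> f"

text \<open>The degree \<open>d\<close> part when the generator \<open>a\<close> has degree \<open>w a\<close>: the image of the span of the
  words of total degree \<open>d\<close>.\<close>

definition presented_degree ::
    "'a set \<Rightarrow> 'a free_alg set \<Rightarrow> ('a \<Rightarrow> int) \<Rightarrow> int \<Rightarrow> 'a free_alg set set" where
  "presented_degree A rel w d = presented_class A rel `
     {f \<in> carrier (free_algebra A). \<forall>u \<in> Poly_Mapping.keys f. sum_list (map w u) = d}"


section \<open>Graded rings, endomorphisms and matrices\<close>

text \<open>A grading is given by the family of its homogeneous parts, indexed by \<open>int\<close>.\<close>

definition graded_ring_iso ::
    "('a, 'r) ring_scheme \<Rightarrow> (int \<Rightarrow> 'a set) \<Rightarrow> ('b, 's) ring_scheme \<Rightarrow> (int \<Rightarrow> 'b set) \<Rightarrow> ('a \<Rightarrow> 'b) set"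
  where "graded_ring_iso R G S H = {h \<in> ring_iso R S. \<forall>d. h ` G d = H d}"

definition additive_End :: "('a, 'r) ring_scheme \<Rightarrow> ('a \<Rightarrow> 'a) ring" where
  "additive_End P = \<lparr>carrier = extensional (carrier P) \<inter> hom (add_monoid P) (add_monoid P),
     mult = compose (carrier P), one = (\<lambda>a \<in> carrier P. a),
     zero = (\<lambda>a \<in> carrier P. \<zero>\<^bsub>P\<^esub>), add = (\<lambda>f g. \<lambda>a \<in> carrier P. f a \<oplus>\<^bsub>P\<^esub> g a)\<rparr>"

text \<open>Endomorphisms of \<open>P\<close> as a right module over its subring \<open>L\<close>.\<close>

definition right_End :: "('a, 'r) ring_scheme \<Rightarrow> 'a set \<Rightarrow> ('a \<Rightarrow> 'a) ring" where
  "right_End P L = (additive_End P)\<lparr>carrier :=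
     {f \<in> carrier (additive_End P).
        \<forall>a \<in> carrier P. \<forall>l \<in> L. f (a \<otimes>\<^bsub>P\<^esub> l) = f a \<otimes>\<^bsub>P\<^esub> l}\<rparr>"

definition right_End_degree ::
    "('a, 'r) ring_scheme \<Rightarrow> 'a set \<Rightarrow> (int \<Rightarrow> 'a set) \<Rightarrow> int \<Rightarrow> ('a \<Rightarrow> 'a) set" where
  "right_End_degree P L G d = {f \<in> carrier (right_End P L). \<forall>k. f ` G k \<subseteq> G (k + d)}"

definition mat_ring :: "nat \<Rightarrow> ('a, 'r) ring_scheme \<Rightarrow> (nat \<Rightarrow> nat \<Rightarrow> 'a) ring" where
  "mat_ring N R = \<lparr>carrier = {..<N} \<rightarrow>\<^sub>E {..<N} \<rightarrow>\<^sub>E carrier R,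
     mult = (\<lambda>A B. \<lambda>i \<in> {..<N}. \<lambda>j \<in> {..<N}. \<Oplus>\<^bsub>R\<^esub>k \<in> {..<N}. A i k \<otimes>\<^bsub>R\<^esub> B k j),
     one = (\<lambda>i \<in> {..<N}. \<lambda>j \<in> {..<N}. if i = j then \<one>\<^bsub>R\<^esub> else \<zero>\<^bsub>R\<^esub>),
     zero = (\<lambda>i \<in> {..<N}. \<lambda>j \<in> {..<N}. \<zero>\<^bsub>R\<^esub>),
     add = (\<lambda>A B. \<lambda>i \<in> {..<N}. \<lambda>j \<in> {..<N}. A i j \<oplus>\<^bsub>R\<^esub> B i j)\<rparr>"

text \<open>\<open>Mat\<^bsub>f(q)\<^esub>(R)\<close> for \<open>f = \<Sum>\<^sub>i q\<^bsup>d\<^sub>i\<^esup>\<close>, where \<open>q\<close> is the variable of the Laurent series.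
  The multiset of the exponents \<open>d\<^sub>i\<close> is determined by \<open>f\<close>, and they are listed in increasing
  order. A matrix \<open>M\<close> is the endomorphism \<open>v\<^sub>j \<mapsto> \<Sum>\<^sub>i v\<^sub>i M\<^sub>i\<^sub>j\<close> of the free right module with
  basis elements \<open>v\<^sub>j\<close> in degrees \<open>d\<^sub>j\<close>; it has degree \<open>e\<close> iff
  \<open>d\<^sub>i + \<bar>M\<^sub>i\<^sub>j\<bar> = d\<^sub>j + e\<close> for all \<open>i, j\<close>.\<close>

definition exponents :: "rat fls \<Rightarrow> int list" where
  "exponents f = (THE ds. sorted ds \<and> (\<Sum>d \<leftarrow> ds. fls_X powi d) = f)"

definition Mat :: "rat fls \<Rightarrow> ('a, 'r) ring_scheme \<Rightarrow> (nat \<Rightarrow> nat \<Rightarrow> 'a) ring" where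
  "Mat f R = mat_ring (length (exponents f)) R"

definition Mat_degree ::
    "rat fls \<Rightarrow> ('a, 'r) ring_scheme \<Rightarrow> (int \<Rightarrow> 'a set) \<Rightarrow> int \<Rightarrow> (nat \<Rightarrow> nat \<Rightarrow> 'a) set" where
  "Mat_degree f R G e = {M \<in> carrier (Mat f R).
     \<forall>i < length (exponents f). \<forall>j < length (exponents f).
       M i j \<in> G (e + exponents f ! j - exponents f ! i)}"

definition qint :: "nat \<Rightarrow> rat fls" where
  "qint m = (fls_X powi int m - fls_X powi - int m) / (fls_X - inverse fls_X)"

text \<open>\<open>[2n]!! = [2n][2n-2]\<cdots>[2]\<close>\<close>

definition even_qdfact :: "nat \<Rightarrow> rat fls" where
  "even_qdfact n = (\<Prod>i = 1..n. qint (2 * i))"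


section \<open>Skew polynomials and odd Demazure operators\<close>

definition pol_relations :: "nat \<Rightarrow> nat free_alg set" where
  "pol_relations n = {gen i * gen j + gen j * gen i | i j. i \<in> {1..n} \<and> j \<in> {1..n} \<and> i \<noteq> j}"

type_synonym pol = "nat free_alg set"

definition Pol :: "nat \<Rightarrow> pol ring" where
  "Pol n = presented_algebra {1..n} (pol_relations n)"

definition pol_x :: "nat \<Rightarrow> nat \<Rightarrow> pol" where
  "pol_x n i = presented_class {1..n} (pol_relations n) (gen i)"

definition Pol_degree :: "nat \<Rightarrow> int \<Rightarrow> pol set" where
  "Pol_degree n = presented_degree {1..n} (pol_relations n) (\<lambda>i. 2)"

text \<open>The following two operators are unique, if they exist, because the \<open>x\<^sub>j\<close> generate \<open>Pol n\<close> and
  their values outside the carrier are fixed by extensionality. They exist for the generator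
  images used below, since these respect the defining relations of \<open>Pol n\<close>.\<close>

definition pol_endo :: "nat \<Rightarrow> (nat \<Rightarrow> pol) \<Rightarrow> pol \<Rightarrow> pol" where
  "pol_endo n g = (THE s. s \<in> extensional (carrier (Pol n)) \<and> s \<in> ring_hom (Pol n) (Pol n) \<and>
     (\<forall>j \<in> {1..n}. s (pol_x n j) = g j))"

definition twisted_derivation :: "nat \<Rightarrow> (pol \<Rightarrow> pol) \<Rightarrow> (nat \<Rightarrow> pol) \<Rightarrow> pol \<Rightarrow> pol" where
  "twisted_derivation n s c = (THE D. D \<in> carrier (additive_End (Pol n)) \<and>
     D \<one>\<^bsub>Pol n\<^esub> = \<zero>\<^bsub>Pol n\<^esub> \<and>
     (\<forall>j \<in> {1..n}. D (pol_x n j) = c j) \<and>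
     (\<forall>f \<in> carrier (Pol n). \<forall>g \<in> carrier (Pol n).
        D (f \<otimes>\<^bsub>Pol n\<^esub> g) = D f \<otimes>\<^bsub>Pol n\<^esub> g \<oplus>\<^bsub>Pol n\<^esub> s f \<otimes>\<^bsub>Pol n\<^esub> D g))"

definition s_refl :: "nat \<Rightarrow> nat \<Rightarrow> pol \<Rightarrow> pol" where
  "s_refl n i = pol_endo n (\<lambda>j. \<ominus>\<^bsub>Pol n\<^esub> pol_x n (if j = i then i + 1 else if j = i + 1 then i else j))"

definition s_reflB :: "nat \<Rightarrow> pol \<Rightarrow> pol" where
  "s_reflB n = pol_endo n (\<lambda>j. \<ominus>\<^bsub>Pol n\<^esub> pol_x n j)"

definition demazure :: "nat \<Rightarrow> nat \<Rightarrow> pol \<Rightarrow> pol" where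
  "demazure n i = twisted_derivation n (s_refl n i)
     (\<lambda>j. if j \<in> {i, i + 1} then \<one>\<^bsub>Pol n\<^esub> else \<zero>\<^bsub>Pol n\<^esub>)"

definition demazureB :: "nat \<Rightarrow> pol \<Rightarrow> pol" where
  "demazureB n = twisted_derivation n (s_reflB n)
     (\<lambda>j. if j = n then \<one>\<^bsub>Pol n\<^esub> else \<zero>\<^bsub>Pol n\<^esub>)"

definition sym_pols :: "nat \<Rightarrow> pol set" where
  "sym_pols n = (\<Inter>i \<in> {1..<n}. a_kernel (Pol n) (Pol n) (demazure n i)) \<inter>
     a_kernel (Pol n) (Pol n) (demazureB n)"

definition SymPol :: "nat \<Rightarrow> pol ring" where
  "SymPol n = (Pol n)\<lparr>carrier := sym_pols n\<rparr>"

definition SymPol_degree :: "nat \<Rightarrow> int \<Rightarrow> pol set" where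
  "SymPol_degree n d = sym_pols n \<inter> Pol_degree n d"


section \<open>The spin type B nilHecke algebra and its polynomial representation\<close>

text \<open>\<open>GenD i\<close> is \<open>\<partial>\<^sub>i\<^sup>-\<close> and \<open>GenB\<close> is \<open>\<partial>\<^sub>n\<^sup>B\<close>.\<close>

datatype nh_gen = GenX nat | GenD nat | GenB

abbreviation fx :: "nat \<Rightarrow> nh_gen free_alg" where "fx i \<equiv> gen (GenX i)"
abbreviation fd :: "nat \<Rightarrow> nh_gen free_alg" where "fd i \<equiv> gen (GenD i)"
abbreviation fb :: "nh_gen free_alg" where "fb \<equiv> gen GenB"

definition nh_gens :: "nat \<Rightarrow> nh_gen set" where
  "nh_gens n = GenX ` {1..n} \<union> GenD ` {1..<n} \<union> {GenB}"

definition nh_relations :: "nat \<Rightarrow> nh_gen free_alg set" where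
  "nh_relations n =
     {fx i * fx j + fx j * fx i | i j. i \<in> {1..n} \<and> j \<in> {1..n} \<and> i \<noteq> j} \<union>
     {fd i ^ 2 | i. i \<in> {1..<n}} \<union>
     {fd i * fd (i + 1) * fd i - fd (i + 1) * fd i * fd (i + 1) | i.
        i \<in> {1..<n} \<and> i + 1 \<in> {1..<n}} \<union>
     {fd i * fd j + fd j * fd i | i j.
        i \<in> {1..<n} \<and> j \<in> {1..<n} \<and> (i + 1 < j \<or> j + 1 < i)} \<union>
     {fx i * fd i + fd i * fx (i + 1) - 1 | i. i \<in> {1..<n}} \<union>
     {fd i * fx i + fx (i + 1) * fd i - 1 | i. i \<in> {1..<n}} \<union>
     {fd i * fx j + fx j * fd i | i j. i \<in> {1..<n} \<and> j \<in> {1..n} \<and> j \<noteq> i \<and> j \<noteq> i + 1} \<union>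
     {fb ^ 2} \<union>
     {fb * fd i * fb * fd i + fd i * fb * fd i * fb | i. i \<in> {1..<n} \<and> i = n - 1} \<union>
     {fb * fd i + fd i * fb | i. i \<in> {1..<n} \<and> i \<noteq> n - 1} \<union>
     {fb * fx n + fx n * fb - 1} \<union>
     {fb * fx i + fx i * fb | i. i \<in> {1..<n}}"

type_synonym nh = "nh_gen free_alg set"

definition NH :: "nat \<Rightarrow> nh ring" where
  "NH n = presented_algebra (nh_gens n) (nh_relations n)"

definition nh_class :: "nat \<Rightarrow> nh_gen free_alg \<Rightarrow> nh" where
  "nh_class n = presented_class (nh_gens n) (nh_relations n)"

fun nh_gen_degree :: "nh_gen \<Rightarrow> int" where
  "nh_gen_degree (GenX i) = 2"
| "nh_gen_degree (GenD i) = - 2"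
| "nh_gen_degree GenB = - 2"

definition NH_degree :: "nat \<Rightarrow> int \<Rightarrow> nh set" where
  "NH_degree n = presented_degree (nh_gens n) (nh_relations n) nh_gen_degree"

definition polynomial_rep :: "nat \<Rightarrow> (nh \<Rightarrow> pol \<Rightarrow> pol) \<Rightarrow> bool" where
  "polynomial_rep n \<phi> \<longleftrightarrow>
     \<phi> \<in> ring_hom (NH n) (additive_End (Pol n)) \<and>
     (\<forall>i \<in> {1..n}. \<phi> (nh_class n (fx i)) = (\<lambda>f \<in> carrier (Pol n). pol_x n i \<otimes>\<^bsub>Pol n\<^esub> f)) \<and>
     (\<forall>i \<in> {1..<n}. \<phi> (nh_class n (fd i)) = demazure n i) \<and>
     \<phi> (nh_class n fb) = demazureB n"

end

theory Submission
  imports Defs "HOL-Algebra.Subrings"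
begin

text \<open>Write \<open>d\<^sub>i\<close> for \<open>\<partial>\<^sub>i\<^sup>-\<close> when \<open>i < n\<close>, \<open>d\<^sub>n\<close> for \<open>\<partial>\<^sub>n\<^sup>B\<close>, and \<open>y\<^sub>i = x\<^sub>i\<^sup>2\<close>; the \<open>y\<^sub>i\<close> are central.
  Consider the box monomials \<open>x\<^sub>1\<^bsup>a(1)\<^esup> \<cdots> x\<^sub>n\<^bsup>a(n)\<^esup>\<close> with \<open>a(m) < 2 (n - m + 1)\<close>, and, with the same
  \<open>2\<^sup>n n!\<close> indices, the words \<open>W\<^sub>a\<close> that are concatenated from suffixes of lengths
  \<open>a(1), \<dots>, a(n)\<close> of the palindromes \<open>d\<^sub>m \<cdots> d\<^sub>n \<cdots> d\<^sub>m\<close>, \<open>m = 1, \<dots>, n\<close>. They are reduced words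
  for the elements of the Weyl group of type B. Everything rests on three facts.

  First, the square matrix with entries \<open>W\<^sub>a(x\<^sup>b)\<close> is triangular for the lexicographic order
  that compares last exponents first, with diagonal entries \<open>1\<close> or \<open>-1\<close>
  (\<open>pairing_triangular\<close>). Second, every element of the nilHecke algebra is a sum of terms
  \<open>p W\<^sub>a\<close> with \<open>p\<close> a polynomial in the \<open>x\<^sub>i\<close> (\<open>nh_ordered_span\<close>): the relations move the
  \<open>x\<^sub>i\<close> to the left, and up to sign the \<open>d\<^sub>i\<close> satisfy the relations of the nilCoxeter monoid, in
  which each word vanishes or equals some \<open>W\<^sub>a\<close> (\<open>word_normal_form\<close>). Third, the box monomials
  generate the polynomials as a right module over the symmetric ones (\<open>spol_in_sym_span\<close>),
  because the elementary symmetric polynomials in the \<open>y\<^sub>i\<close> are symmetric and \<open>x\<^sub>1\<close> is a root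
  of \<open>\<Prod>\<^sub>i (t\<^sup>2 - y\<^sub>i)\<close>.

  If \<open>\<Sum>\<^sub>a p\<^sub>a W\<^sub>a\<close> acts as zero, then evaluation at the box monomials gives a triangular system
  whose only solution is \<open>p = 0\<close>, so the action is faithful (\<open>act_faithful\<close>). Given an
  endomorphism, the same system can be solved for an element that agrees with it on the
  box monomials, hence everywhere by linearity over the symmetric polynomials (\<open>act_dense\<close>).
  Applying the \<open>W\<^sub>a\<close>, which are linear over the symmetric polynomials, to a relation between
  the box monomials shows that these are a basis (\<open>sym_spol_coordinates_closed\<close>), which
  gives the matrix algebra. Triangular systems preserve degrees, so all of this is graded, and
  the generating function of the degrees of the box monomials is \<open>q\<^bsup>n\<^sup>2\<^esup>[2n]!!\<close> (\<open>graded_rank\<close>).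

  The computations take place in a type of skew polynomials in countably many variables and
  in the ring of its additive endomorphisms; \<open>Pol n\<close> is identified with a subring of
  that type by the map \<open>val\<close>.\<close>

section \<open>Evaluation of noncommutative polynomials\<close>

definition alg_hom :: "('a \<Rightarrow> 'r::ring_1) \<Rightarrow> 'a free_alg \<Rightarrow> 'r" where
  "alg_hom g f = (\<Sum>w \<in> Poly_Mapping.keys f. of_int (Poly_Mapping.lookup f w) * prod_list (map g w))"

lemma alg_hom_superset:
  assumes "finite S" "Poly_Mapping.keys f \<subseteq> S"
  shows "alg_hom g f = (\<Sum>w \<in> S. of_int (Poly_Mapping.lookup f w) * prod_list (map g w))"
  unfolding alg_hom_def
  by (rule sum.mono_neutral_left) (use assms in \<open>auto simp: in_keys_iff\<close>)

lemma alg_hom_add: "alg_hom g (f + f') = alg_hom g f + alg_hom g f'"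
proof -
  let ?S = "Poly_Mapping.keys f \<union> Poly_Mapping.keys f'"
  have "Poly_Mapping.keys (f + f') \<subseteq> ?S" by (rule keys_add)
  then show ?thesis
    by (simp add: alg_hom_superset[of ?S] lookup_add distrib_right sum.distrib)
qed

lemma alg_hom_zero [simp]: "alg_hom g 0 = 0"
  by (simp add: alg_hom_def)

lemma alg_hom_uminus: "alg_hom g (- f) = - alg_hom g f"
  using alg_hom_add[of g f "- f"] by (simp add: eq_neg_iff_add_eq_0 add.commute)

lemma alg_hom_diff: "alg_hom g (f - f') = alg_hom g f - alg_hom g f'"
  using alg_hom_add[of g f "- f'"] by (simp add: alg_hom_uminus)

lemma alg_hom_single: "alg_hom g (Poly_Mapping.single w 1) = prod_list (map g w)"
  by (simp add: alg_hom_def)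

lemma alg_hom_gen [simp]: "alg_hom g (gen a) = g a"
  by (simp add: gen_def alg_hom_single)

lemma alg_hom_one [simp]: "alg_hom g 1 = 1"
  using alg_hom_single[of g "[]"] by (simp add: single_one[symmetric] zero_list_def del: single_one)

lemma free_alg_induct [consumes 1, case_names zero single diff]:
  fixes f :: "'a free_alg"
  assumes "Poly_Mapping.keys f \<subseteq> S" "P 0"
    "\<And>w. w \<in> S \<Longrightarrow> P (Poly_Mapping.single w 1)"
    "\<And>f g. P f \<Longrightarrow> P g \<Longrightarrow> P (f - g)"
  shows "P f"
  using assms by (rule frag_induction)

lemma free_alg_induct_all [case_names zero single diff]:
  fixes f :: "'a free_alg"
  assumes "P 0" "\<And>w. P (Poly_Mapping.single w 1)" "\<And>f g. P f \<Longrightarrow> P g \<Longrightarrow> P (f - g)"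
  shows "P f"
  using subset_UNIV assms by (rule frag_induction)

lemma single_mult_single: "Poly_Mapping.single u (1::int) * Poly_Mapping.single v 1 = Poly_Mapping.single (u @ v) 1"
  by (simp add: mult_single plus_list_def)

lemma alg_hom_mult: "alg_hom g (f * f') = alg_hom g f * alg_hom g f'"
proof -
  have 1: "alg_hom g (Poly_Mapping.single u 1 * f') = prod_list (map g u) * alg_hom g f'" for u
    by (induction f' rule: free_alg_induct_all)
      (simp_all add: single_mult_single alg_hom_single alg_hom_diff right_diff_distrib)
  show ?thesis
    by (induction f rule: free_alg_induct_all)
      (simp_all add: 1 alg_hom_single alg_hom_diff left_diff_distrib)
qed

lemma alg_hom_power: "alg_hom g (f ^ k) = alg_hom g f ^ k"
  by (induction k) (simp_all add: alg_hom_mult)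

lemma single_eq_prod_gen: "Poly_Mapping.single w (1::int) = prod_list (map gen w)"
proof (induction w)
  case Nil then show ?case using single_one[where ?'a = "'a list" and ?'b = int] by (simp add: zero_list_def)
next
  case (Cons a w)
  have "Poly_Mapping.single (a # w) (1::int) = gen a * Poly_Mapping.single w 1"
    by (simp add: gen_def single_mult_single)
  then show ?case using Cons by simp
qed

lemma keys_mult_lists:
  assumes "Poly_Mapping.keys f \<subseteq> lists A" "Poly_Mapping.keys g \<subseteq> lists A"
  shows "Poly_Mapping.keys (f * g) \<subseteq> lists A"
  using keys_mult[of f g] assms by (fastforce simp: plus_list_def)

text \<open>This identifies the quotient maps, the inclusions between free algebras and the action, which are all given by some other description, with evaluations at the images of the generators.\<close>

lemma hom_eq_alg_hom:
  fixes h :: "'a free_alg \<Rightarrow> 'r::ring_1"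
  assumes "Poly_Mapping.keys f \<subseteq> lists A" "\<And>f g. h (f - g) = h f - h g" "h 1 = 1"
    "\<And>f g. h (f * g) = h f * h g" "\<And>a. a \<in> A \<Longrightarrow> h (gen a) = g a"
  shows "h f = alg_hom g f"
proof -
  have 1: "h (Poly_Mapping.single w 1) = prod_list (map g w)" if "w \<in> lists A" for w
    using that unfolding single_eq_prod_gen
    by (induction w) (auto simp: assms)
  have "h 0 = 0" using assms(2)[of 0 0] by simp
  with assms(1) show ?thesis
    by (induction f rule: free_alg_induct) (simp_all add: assms(2) alg_hom_diff 1 alg_hom_single)
qed


section \<open>Ideals and presentations\<close>

text \<open>The ideals of \<open>free_algebra A\<close> live on a subset of a type. Two-sided ideals of the whole type are easier to compute with; \<open>genideal_free_algebra\<close> relates the two.\<close>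

inductive_set two_sided :: "'r::ring_1 set \<Rightarrow> 'r set" for R where
  zero: "0 \<in> two_sided R"
| step: "r \<in> R \<Longrightarrow> u \<in> two_sided R \<Longrightarrow> a * r * b + u \<in> two_sided R"

lemma two_sided_base: "r \<in> R \<Longrightarrow> r \<in> two_sided R"
  using two_sided.step[OF _ two_sided.zero, of r R 1 1] by simp

lemma two_sided_add: "u \<in> two_sided R \<Longrightarrow> v \<in> two_sided R \<Longrightarrow> u + v \<in> two_sided R"
  by (induction rule: two_sided.induct) (auto simp: add.assoc intro: two_sided.intros)

lemma two_sided_left: "u \<in> two_sided R \<Longrightarrow> c * u \<in> two_sided R"
proof (induction rule: two_sided.induct)
  case (step r u a b)
  then show ?case using two_sided.step[of r R "c * u" "c * a" b] by (simp add: algebra_simps)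
qed (auto intro: two_sided.intros)

lemma two_sided_right: "u \<in> two_sided R \<Longrightarrow> u * c \<in> two_sided R"
proof (induction rule: two_sided.induct)
  case (step r u a b)
  then show ?case using two_sided.step[of r R "u * c" a "b * c"] by (simp add: algebra_simps)
qed (auto intro: two_sided.intros)

lemma two_sided_uminus: "u \<in> two_sided R \<Longrightarrow> - u \<in> two_sided R"
  using two_sided_left[of u R "- 1"] by simp

lemma two_sided_diff: "u \<in> two_sided R \<Longrightarrow> v \<in> two_sided R \<Longrightarrow> u - v \<in> two_sided R"
  using two_sided_add[OF _ two_sided_uminus, of u R v] by simp

lemma two_sided_sum: "(\<And>a. a \<in> A \<Longrightarrow> f a \<in> two_sided R) \<Longrightarrow> sum f A \<in> two_sided R"
  by (induction A rule: infinite_finite_induct) (auto intro: two_sided_add two_sided.zero)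

lemma alg_hom_two_sided:
  assumes "u \<in> two_sided R" "\<And>r. r \<in> R \<Longrightarrow> alg_hom g r = 0"
  shows "alg_hom g u = 0"
  using assms(1) by induction (simp_all add: alg_hom_add alg_hom_mult assms(2))

lemma alg_hom_two_sided_image:
  assumes "u \<in> two_sided R" "\<And>r. r \<in> R \<Longrightarrow> alg_hom g r \<in> two_sided S"
  shows "alg_hom g u \<in> two_sided S"
  using assms(1)
proof induction
  case (step r u a b)
  then show ?case
    using assms(2)[OF step(1)]
    by (simp add: alg_hom_add alg_hom_mult two_sided_add two_sided_left two_sided_right)
qed (simp add: two_sided.zero)

lemma free_algebra_simps [simp]:
  "carrier (free_algebra A) = {f. Poly_Mapping.keys f \<subseteq> lists A}"
  "mult (free_algebra A) = (*)" "one (free_algebra A) = 1"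
  "zero (free_algebra A) = 0" "add (free_algebra A) = (+)"
  by (simp_all add: free_algebra_def)

lemma Nil_in_lists_zero [simp]: "(0 :: 'a list) \<in> lists A"
  by (simp add: zero_list_def)

lemma keys_one_lists [simp]: "Poly_Mapping.keys (1 :: 'a free_alg) \<subseteq> lists A"
  by (simp add: zero_list_def)

lemma keys_gen: "a \<in> A \<Longrightarrow> Poly_Mapping.keys (gen a) \<subseteq> lists A"
  by (simp add: gen_def)

lemma keys_add_lists: "Poly_Mapping.keys f \<subseteq> L \<Longrightarrow> Poly_Mapping.keys g \<subseteq> L \<Longrightarrow> Poly_Mapping.keys (f + g) \<subseteq> L"
  using keys_add[of f g] by blast

lemma keys_diff_lists:
  fixes f g :: "'a free_alg"
  shows "Poly_Mapping.keys f \<subseteq> L \<Longrightarrow> Poly_Mapping.keys g \<subseteq> L \<Longrightarrow> Poly_Mapping.keys (f - g) \<subseteq> L"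
  using keys_diff[of f g] by blast

lemma ring_free_algebra: "ring (free_algebra A)"
proof (rule ringI)
  show "abelian_group (free_algebra A)"
  proof (rule abelian_groupI)
    fix x assume "x \<in> carrier (free_algebra A)"
    then show "\<exists>y\<in>carrier (free_algebra A). y \<oplus>\<^bsub>free_algebra A\<^esub> x = \<zero>\<^bsub>free_algebra A\<^esub>"
      by (intro bexI[of _ "- x"]) simp_all
  qed (auto simp: add.assoc add.commute dest: subsetD[OF keys_add])
  show "monoid (free_algebra A)"
    by (rule monoidI) (simp_all add: mult.assoc keys_mult_lists)
qed (simp_all add: algebra_simps)

lemma a_minus_free_algebra:
  assumes "f \<in> carrier (free_algebra A)" "g \<in> carrier (free_algebra A)"
  shows "f \<ominus>\<^bsub>free_algebra A\<^esub> g = f - g"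
proof -
  interpret ring "free_algebra A" by (rule ring_free_algebra)
  have "\<ominus>\<^bsub>free_algebra A\<^esub> g = - g"
    by (rule minus_equality) (use assms in simp_all)
  then show ?thesis by (simp add: a_minus_def)
qed

lemma prod_list_map_in_lists:
  "w \<notin> lists A \<Longrightarrow> prod_list (map (\<lambda>a. if a \<in> A then g a else 0) w) = (0 :: 'r::ring_1)"
  by (induction w) auto

text \<open>Sending the generators outside \<open>A\<close> to \<open>0\<close> retracts the free algebra onto the free algebra
  on \<open>A\<close>. Hence an ideal generated by relations on a larger set of generators restricts to the
  expected ideal as soon as the retraction sends each relation to \<open>0\<close> or to one of the
  relations on \<open>A\<close>.\<close>

lemma genideal_free_algebra:
  assumes "R \<subseteq> R'" "\<And>r. r \<in> R \<Longrightarrow> Poly_Mapping.keys r \<subseteq> lists A"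
    and ret: "\<And>r. r \<in> R' \<Longrightarrow> alg_hom (\<lambda>a. if a \<in> A then gen a else 0) r \<in> insert 0 R"
  shows "genideal (free_algebra A) R = carrier (free_algebra A) \<inter> two_sided R'"
proof
  interpret ring "free_algebra A" by (rule ring_free_algebra)
  let ?r = "alg_hom (\<lambda>a. if a \<in> A then gen a else 0) :: 'a free_alg \<Rightarrow> 'a free_alg"
  have R: "R \<subseteq> carrier (free_algebra A)" using assms(2) by auto
  have "ideal (carrier (free_algebra A) \<inter> two_sided R') (free_algebra A)"
  proof (rule idealI[OF ring_free_algebra])
    show "subgroup (carrier (free_algebra A) \<inter> two_sided R') (add_monoid (free_algebra A))"
    proof (rule add.subgroupI)
      fix a assume a: "a \<in> carrier (free_algebra A) \<inter> two_sided R'"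
      then have "\<ominus>\<^bsub>free_algebra A\<^esub> a = - a" by (intro minus_equality) auto
      then show "\<ominus>\<^bsub>free_algebra A\<^esub> a \<in> carrier (free_algebra A) \<inter> two_sided R'"
        using a by (simp add: two_sided_uminus)
    next
      have "0 \<in> carrier (free_algebra A) \<inter> two_sided R'" by (simp add: two_sided.zero)
      then show "carrier (free_algebra A) \<inter> two_sided R' \<noteq> {}" by blast
    qed (auto simp: two_sided_add dest: subsetD[OF keys_add])
  qed (auto simp: two_sided_left two_sided_right dest: subsetD[OF keys_mult_lists, rotated 2])
  then show "genideal (free_algebra A) R \<subseteq> carrier (free_algebra A) \<inter> two_sided R'"
    by (rule genideal_minimal) (use assms in \<open>auto intro: two_sided_base\<close>)
  show "carrier (free_algebra A) \<inter> two_sided R' \<subseteq> genideal (free_algebra A) R"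
  proof
    fix u assume u: "u \<in> carrier (free_algebra A) \<inter> two_sided R'"
    have ret_in: "?r f \<in> carrier (free_algebra A)" for f
    proof (induction f rule: free_alg_induct_all)
      case (single w)
      show ?case
      proof (cases "w \<in> lists A")
        case True
        then have "?r (Poly_Mapping.single w 1) = prod_list (map gen w)"
          unfolding alg_hom_single by (intro arg_cong[of _ _ prod_list] map_cong) auto
        then show ?thesis using True by (simp flip: single_eq_prod_gen)
      next
        case False then show ?thesis by (simp add: alg_hom_single prod_list_map_in_lists)
      qed
    qed (auto simp: alg_hom_diff dest: subsetD[OF keys_diff])
    have fix_A: "?r f = f" if "f \<in> carrier (free_algebra A)" for f
    proof -
      have "id f = ?r f"
        by (rule hom_eq_alg_hom[where A = A]) (use that in auto)
      then show ?thesis by simp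
    qed
    interpret I: ideal "genideal (free_algebra A) R" "free_algebra A"
      by (rule genideal_ideal[OF R])
    have "?r u \<in> genideal (free_algebra A) R" if "u \<in> two_sided R'" for u
      using that
    proof induction
      case zero then show ?case using I.zero_closed by simp
    next
      case (step r u a b)
      have "?r r \<in> genideal (free_algebra A) R"
        using ret[OF step(1)] genideal_self[OF R] I.zero_closed by auto
      then have "?r a * ?r r * ?r b \<in> genideal (free_algebra A) R"
        using I.I_l_closed[of "?r r" "?r a"] I.I_r_closed[of _ "?r b"] ret_in by simp
      then show ?case
        using I.a_closed step(3) by (simp add: alg_hom_add alg_hom_mult)
    qed
    then have "?r u \<in> genideal (free_algebra A) R" using u by blast
    then show "u \<in> genideal (free_algebra A) R" using fix_A[of u] u by (metis IntD1)
  qed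
qed

section \<open>Rings of endomorphisms and of triangular matrices\<close>

text \<open>Operator identities become identities of a ring of class \<open>ring_1\<close>, to which ring normalization applies.\<close>

typedef (overloaded) 'a endo = "{h :: 'a::ab_group_add \<Rightarrow> 'a. \<forall>x y. h (x + y) = h x + h y}"
  morphisms app Endo by (rule exI[of _ id]) simp

setup_lifting type_definition_endo

instantiation endo :: (ab_group_add) ring
begin

lift_definition zero_endo :: "'a endo" is "\<lambda>x. 0" by simp
lift_definition plus_endo :: "'a endo \<Rightarrow> 'a endo \<Rightarrow> 'a endo" is "\<lambda>g h x. g x + h x"
  by (simp add: algebra_simps)
lift_definition minus_endo :: "'a endo \<Rightarrow> 'a endo \<Rightarrow> 'a endo" is "\<lambda>g h x. g x - h x"
  by (simp add: algebra_simps)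
lift_definition uminus_endo :: "'a endo \<Rightarrow> 'a endo" is "\<lambda>g x. - g x"
  by (simp add: algebra_simps)
lift_definition times_endo :: "'a endo \<Rightarrow> 'a endo \<Rightarrow> 'a endo" is "\<lambda>g h x. g (h x)"
  by simp

instance
  by standard (transfer, simp add: algebra_simps fun_eq_iff)+

end

lift_definition id_endo :: "'a::ab_group_add endo" is "\<lambda>x. x" by simp

instantiation endo :: ("{ab_group_add, zero_neq_one}") ring_1
begin

definition one_endo :: "'a endo" where "one_endo = id_endo"

instance
proof
  show "(0 :: 'a endo) \<noteq> 1"
    unfolding one_endo_def by transfer (metis zero_neq_one)
qed (simp_all add: one_endo_def, (transfer, simp)+)

end

lemma app_one [simp]: "app 1 x = x" by (simp add: one_endo_def id_endo.rep_eq)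

lemmas app_simps [simp] = zero_endo.rep_eq plus_endo.rep_eq minus_endo.rep_eq uminus_endo.rep_eq
  times_endo.rep_eq

lemma app_add: "app h (x + y) = app h x + app h y" using app[of h] by simp
lemma app_0 [simp]: "app h 0 = 0" using app_add[of h 0 0] by simp
lemma app_uminus: "app h (- x) = - app h x"
  using app_add[of h x "- x"] by (simp add: eq_neg_iff_add_eq_0 add.commute)
lemma app_diff: "app h (x - y) = app h x - app h y"
  using app_add[of h x "- y"] by (simp add: app_uminus)
lemma app_sum: "app h (sum f A) = (\<Sum>a \<in> A. app h (f a))"
  by (induction A rule: infinite_finite_induct) (simp_all add: app_add)

lift_definition left_mult :: "'r::ring \<Rightarrow> 'r endo" is "\<lambda>a x. a * x" by (simp add: distrib_left)

lemma app_left_mult [simp]: "app (left_mult a) x = a * x" by (simp add: left_mult.rep_eq)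

lemma endo_eqI: "(\<And>x. app g x = app h x) \<Longrightarrow> g = h"
  by (simp add: app_inject[symmetric] fun_eq_iff)

text \<open>Upper triangular \<open>2 \<times> 2\<close> matrices. A derivation \<open>D\<close> twisted by an endomorphism \<open>s\<close> is the
  off-diagonal entry of the homomorphism that sends \<open>f\<close> to the matrix with rows \<open>(s f, D f)\<close> and
  \<open>(0, f)\<close>. So it exists as soon as the matrices assigned to the generators satisfy the
  relations.\<close>

datatype 'r triang = Triang (ul: 'r) (ur: 'r) (lr: 'r)

instantiation triang :: (ring_1) ring_1
begin

definition "0 = Triang 0 0 0"
definition "1 = Triang 1 0 1"
definition "A + B = Triang (ul A + ul B) (ur A + ur B) (lr A + lr B)"
definition "A - B = Triang (ul A - ul B) (ur A - ur B) (lr A - lr B)"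
definition "- A = Triang (- ul A) (- ur A) (- lr A)"
definition "A * B = Triang (ul A * ul B) (ul A * ur B + ur A * lr B) (lr A * lr B)"

lemmas triang_defs = zero_triang_def one_triang_def plus_triang_def minus_triang_def
  uminus_triang_def times_triang_def

instance
  by standard (simp_all add: triang_defs algebra_simps)

end

section \<open>Skew polynomials as a type\<close>

text \<open>The variables are indexed by all natural numbers so that one type serves every \<open>n\<close>.\<close>

definition skew_relations :: "nat free_alg set" where
  "skew_relations = {gen i * gen j + gen j * gen i | i j. i \<noteq> j}"

definition skew_cong :: "nat free_alg \<Rightarrow> nat free_alg \<Rightarrow> bool" where
  "skew_cong f g \<longleftrightarrow> f - g \<in> two_sided skew_relations"

lemma skew_cong_equivp: "equivp skew_cong"
proof (rule equivpI)
  show "reflp skew_cong" by (simp add: reflp_def skew_cong_def two_sided.zero)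
  show "symp skew_cong"
    using two_sided_uminus by (fastforce simp: symp_def skew_cong_def)
  show "transp skew_cong"
    using two_sided_add by (fastforce simp: transp_def skew_cong_def)
qed

quotient_type spol = "nat free_alg" / skew_cong
  by (rule skew_cong_equivp)

lemma one_notin_skew: "1 \<notin> two_sided skew_relations"
proof
  assume "1 \<in> two_sided skew_relations"
  then have "alg_hom (\<lambda>_. 0 :: int) (1 :: nat free_alg) = 0"
    by (rule alg_hom_two_sided) (auto simp: skew_relations_def alg_hom_add alg_hom_mult)
  then show False by simp
qed

instantiation spol :: ring_1
begin

lift_definition zero_spol :: spol is 0 .
lift_definition one_spol :: spol is 1 .
lift_definition plus_spol :: "spol \<Rightarrow> spol \<Rightarrow> spol" is "(+)"
proof -
  fix a b c d :: "nat free_alg"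
  assume "skew_cong a b" "skew_cong c d"
  then have "(a - b) + (c - d) \<in> two_sided skew_relations"
    unfolding skew_cong_def by (rule two_sided_add)
  then show "skew_cong (a + c) (b + d)" by (simp add: skew_cong_def algebra_simps)
qed
lift_definition minus_spol :: "spol \<Rightarrow> spol \<Rightarrow> spol" is "(-)"
proof -
  fix a b c d :: "nat free_alg"
  assume "skew_cong a b" "skew_cong c d"
  then have "(a - b) - (c - d) \<in> two_sided skew_relations"
    unfolding skew_cong_def by (rule two_sided_diff)
  then show "skew_cong (a - c) (b - d)" by (simp add: skew_cong_def algebra_simps)
qed
lift_definition uminus_spol :: "spol \<Rightarrow> spol" is uminus
  unfolding skew_cong_def by (metis minus_diff_minus two_sided_uminus)
lift_definition times_spol :: "spol \<Rightarrow> spol \<Rightarrow> spol" is "(*)"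
proof -
  fix a b c d :: "nat free_alg"
  assume "skew_cong a b" "skew_cong c d"
  then have "a * (c - d) + (a - b) * d \<in> two_sided skew_relations"
    by (simp add: skew_cong_def two_sided_add two_sided_left two_sided_right)
  then show "skew_cong (a * c) (b * d)" by (simp add: skew_cong_def algebra_simps)
qed

instance
proof
  fix a b c :: spol
  have rep: "p = abs_spol (rep_spol p)" for p
    by (rule Quotient3_abs_rep[OF Quotient3_spol, symmetric])
  define f g h where "f = rep_spol a" and "g = rep_spol b" and "h = rep_spol c"
  then have [simp]: "a = abs_spol f" "b = abs_spol g" "c = abs_spol h"
    by (simp_all only: rep[symmetric])
  note [simp] = zero_spol.abs_eq one_spol.abs_eq plus_spol.abs_eq minus_spol.abs_eq
    uminus_spol.abs_eq times_spol.abs_eq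
  show "a + b + c = a + (b + c)" by (simp add: add.assoc)
  show "a + b = b + a" by (simp add: add.commute)
  show "0 + a = a" by simp
  show "- a + a = 0" by simp
  show "a - b = a + - b" by simp
  show "a * b * c = a * (b * c)" by (simp add: mult.assoc)
  show "1 * a = a" by simp
  show "a * 1 = a" by simp
  show "(a + b) * c = a * c + b * c" by (simp add: distrib_right)
  show "a * (b + c) = a * b + a * c" by (simp add: distrib_left)
  show "(0 :: spol) \<noteq> 1"
  proof
    assume "(0 :: spol) = 1"
    then have "0 - 1 \<in> two_sided skew_relations"
      by (simp only: zero_spol.abs_eq one_spol.abs_eq spol.abs_eq_iff skew_cong_def)
    from two_sided_uminus[OF this] show False
      using one_notin_skew by simp
  qed
qed

end

definition cls :: "nat free_alg \<Rightarrow> spol" where "cls = abs_spol"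

lemma cls_simps:
  "cls 0 = 0" "cls 1 = 1" "cls (f + g) = cls f + cls g" "cls (f - g) = cls f - cls g"
  "cls (- f) = - cls f" "cls (f * g) = cls f * cls g"
  by (simp_all add: cls_def zero_spol.abs_eq one_spol.abs_eq plus_spol.abs_eq minus_spol.abs_eq
      uminus_spol.abs_eq times_spol.abs_eq)

lemma cls_eq_iff: "cls f = cls g \<longleftrightarrow> f - g \<in> two_sided skew_relations"
  by (simp add: cls_def spol.abs_eq_iff skew_cong_def)

lemma cls_surj: "\<exists>f. p = cls f"
  unfolding cls_def by (rule exI[of _ "rep_spol p"], rule Quotient3_abs_rep[OF Quotient3_spol, symmetric])

definition sx :: "nat \<Rightarrow> spol" where "sx i = cls (gen i)"

lemma sx_anticommute: "i \<noteq> j \<Longrightarrow> sx i * sx j = - (sx j * sx i)"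
proof -
  assume "i \<noteq> j"
  then have "cls (gen i * gen j + gen j * gen i) = cls 0"
    unfolding cls_eq_iff by (auto simp: skew_relations_def intro!: two_sided_base)
  then show ?thesis by (simp add: cls_simps sx_def eq_neg_iff_add_eq_0)
qed

lemma cls_eq_alg_hom: "cls f = alg_hom sx f"
  by (rule hom_eq_alg_hom[where A = UNIV]) (simp_all add: cls_simps sx_def)

text \<open>Both the polynomials in given variables and their homogeneous parts are spans of sets of words.\<close>

definition word_span :: "nat list set \<Rightarrow> spol set" where
  "word_span L = cls ` {f. Poly_Mapping.keys f \<subseteq> L}"

lemma word_span_closed:
  "0 \<in> word_span L"
  "p \<in> word_span L \<Longrightarrow> q \<in> word_span L \<Longrightarrow> p + q \<in> word_span L"
  "p \<in> word_span L \<Longrightarrow> q \<in> word_span L \<Longrightarrow> p - q \<in> word_span L"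
  "p \<in> word_span L \<Longrightarrow> - p \<in> word_span L"
  "w \<in> L \<Longrightarrow> prod_list (map sx w) \<in> word_span L"
proof -
  show 0: "0 \<in> word_span L"
    unfolding word_span_def by (rule image_eqI[of _ _ 0]) (simp_all add: cls_simps)
  show diff: "p - q \<in> word_span L" if pq: "p \<in> word_span L" "q \<in> word_span L" for p q
  proof -
    obtain f g where "p = cls f" "q = cls g" "Poly_Mapping.keys f \<subseteq> L" "Poly_Mapping.keys g \<subseteq> L"
      using pq unfolding word_span_def by blast
    then show ?thesis unfolding word_span_def
      by (intro image_eqI[of _ _ "f - g"]) (simp_all add: cls_simps keys_diff_lists)
  qed
  show uminus: "- p \<in> word_span L" if "p \<in> word_span L" for p
    using diff[OF 0 that] by simp
  show "p + q \<in> word_span L" if "p \<in> word_span L" "q \<in> word_span L"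
    using diff[OF that(1) uminus[OF that(2)]] by simp
  show "prod_list (map sx w) \<in> word_span L" if "w \<in> L"
    unfolding word_span_def
    by (rule image_eqI[of _ _ "Poly_Mapping.single w 1"])
      (use that in \<open>simp_all add: cls_eq_alg_hom alg_hom_single\<close>)
qed

lemma word_span_sum: "(\<And>a. a \<in> A \<Longrightarrow> f a \<in> word_span L) \<Longrightarrow> sum f A \<in> word_span L"
  by (induction A rule: infinite_finite_induct) (auto intro: word_span_closed)

lemma word_span_induct [consumes 1, case_names zero word diff]:
  assumes "p \<in> word_span L" "P 0" "\<And>w. w \<in> L \<Longrightarrow> P (prod_list (map sx w))"
    "\<And>p q. P p \<Longrightarrow> P q \<Longrightarrow> P (p - q)"
  shows "P p"
proof -
  obtain f where f: "Poly_Mapping.keys f \<subseteq> L" "p = cls f"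
    using assms(1) by (auto simp: word_span_def)
  have "P (cls f)"
    using f(1)
    by (induction f rule: free_alg_induct)
      (simp_all add: assms cls_eq_alg_hom alg_hom_single alg_hom_diff)
  then show ?thesis using f by simp
qed

lemma word_span_mult:
  assumes "p \<in> word_span L" "q \<in> word_span M" "\<And>u v. u \<in> L \<Longrightarrow> v \<in> M \<Longrightarrow> u @ v \<in> K"
  shows "p * q \<in> word_span K"
  using assms(1)
proof (induction rule: word_span_induct)
  case (word u)
  show ?case using assms(2)
  proof (induction rule: word_span_induct)
    case (word v)
    then show ?case
      using word_span_closed(5)[OF assms(3)[OF \<open>u \<in> L\<close> word]] by simp
  qed (simp_all add: word_span_closed right_diff_distrib)
qed (simp_all add: word_span_closed left_diff_distrib)

definition spol_in :: "nat set \<Rightarrow> spol set" where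
  "spol_in A = word_span (lists A)"

definition spol_deg :: "nat set \<Rightarrow> int \<Rightarrow> spol set" where
  "spol_deg A d = word_span {u \<in> lists A. 2 * int (length u) = d}"

lemma spol_in_UNIV: "p \<in> spol_in UNIV"
  using cls_surj by (auto simp: spol_in_def word_span_def)

lemma spol_in_closed:
  "0 \<in> spol_in A" "1 \<in> spol_in A"
  "p \<in> spol_in A \<Longrightarrow> q \<in> spol_in A \<Longrightarrow> p + q \<in> spol_in A"
  "p \<in> spol_in A \<Longrightarrow> q \<in> spol_in A \<Longrightarrow> p - q \<in> spol_in A"
  "p \<in> spol_in A \<Longrightarrow> - p \<in> spol_in A"
  "p \<in> spol_in A \<Longrightarrow> q \<in> spol_in A \<Longrightarrow> p * q \<in> spol_in A"
  "i \<in> A \<Longrightarrow> sx i \<in> spol_in A"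
  using word_span_closed(5)[of "[]" "lists A"] word_span_closed(5)[of "[i]" "lists A"]
  by (auto simp: spol_in_def word_span_closed elim!: word_span_mult)

lemma spol_deg_closed:
  "0 \<in> spol_deg A d" "1 \<in> spol_deg A 0"
  "p \<in> spol_deg A d \<Longrightarrow> q \<in> spol_deg A d \<Longrightarrow> p + q \<in> spol_deg A d"
  "p \<in> spol_deg A d \<Longrightarrow> q \<in> spol_deg A d \<Longrightarrow> p - q \<in> spol_deg A d"
  "p \<in> spol_deg A d \<Longrightarrow> - p \<in> spol_deg A d"
  "p \<in> spol_deg A d \<Longrightarrow> q \<in> spol_deg A e \<Longrightarrow> p * q \<in> spol_deg A (d + e)"
  "i \<in> A \<Longrightarrow> sx i \<in> spol_deg A 2"
  using word_span_closed(5)[of "[]" "{u \<in> lists A. 2 * int (length u) = 0}"]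
    word_span_closed(5)[of "[i]" "{u \<in> lists A. 2 * int (length u) = 2}"]
  by (auto simp: spol_deg_def word_span_closed elim!: word_span_mult)

lemma spol_deg_subset: "spol_deg A d \<subseteq> spol_in A"
  unfolding spol_deg_def spol_in_def word_span_def by auto

lemma spol_in_induct [consumes 1, case_names one var diff]:
  assumes "p \<in> spol_in A" "P 1" "\<And>i p. i \<in> A \<Longrightarrow> p \<in> spol_in A \<Longrightarrow> P p \<Longrightarrow> P (sx i * p)"
    "\<And>p q. P p \<Longrightarrow> P q \<Longrightarrow> P (p - q)"
  shows "P p"
  using assms(1) unfolding spol_in_def
proof (induction rule: word_span_induct)
  case zero show ?case using assms(4)[OF assms(2,2)] by simp
next
  case (word w)
  then show ?case
    by induction (auto simp: assms(2) spol_in_def intro!: assms(3) word_span_closed(5))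
qed (rule assms(4))

lemmas spol_induct [case_names one var diff] =
  spol_in_induct[OF spol_in_UNIV, simplified]

section \<open>Odd Demazure operators\<close>

text \<open>The chosen representative is irrelevant when the images of the variables anticommute (\<open>spol_hom_cls\<close>).\<close>

definition spol_hom :: "(nat \<Rightarrow> 'r::ring_1) \<Rightarrow> spol \<Rightarrow> 'r" where
  "spol_hom g p = alg_hom g (SOME f. cls f = p)"

lemma spol_hom_cls:
  assumes "\<And>i j. i \<noteq> j \<Longrightarrow> g i * g j + g j * g i = 0"
  shows "spol_hom g (cls f) = alg_hom g f"
proof -
  let ?f = "SOME f'. cls f' = cls f"
  have "cls ?f = cls f" by (rule someI[of _ f]) simp
  then have "alg_hom g (?f - f) = 0"
    unfolding cls_eq_iff
    by (rule alg_hom_two_sided) (auto simp: skew_relations_def alg_hom_add alg_hom_mult assms)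
  then show ?thesis by (simp add: spol_hom_def alg_hom_diff)
qed

lemma spol_hom:
  assumes "\<And>i j. i \<noteq> j \<Longrightarrow> g i * g j + g j * g i = 0"
  shows "spol_hom g 1 = 1" "spol_hom g (sx i) = g i" "spol_hom g (p + q) = spol_hom g p + spol_hom g q"
    "spol_hom g (p * q) = spol_hom g p * spol_hom g q"
proof -
  obtain u v where "p = cls u" "q = cls v" using cls_surj by blast
  then show "spol_hom g 1 = 1" "spol_hom g (sx i) = g i"
    "spol_hom g (p + q) = spol_hom g p + spol_hom g q" "spol_hom g (p * q) = spol_hom g p * spol_hom g q"
    by (simp_all add: sx_def spol_hom_cls[OF assms] alg_hom_add alg_hom_mult flip: cls_simps)
qed

definition exch :: "nat \<Rightarrow> nat \<Rightarrow> nat \<Rightarrow> nat" where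
  "exch a b j = (if j = a then b else if j = b then a else j)"

lemma exch_simps [simp]:
  "exch a b a = b" "exch a b b = a" "j \<noteq> a \<Longrightarrow> j \<noteq> b \<Longrightarrow> exch a b j = j"
  by (simp_all add: exch_def)

definition dem_triang :: "nat \<Rightarrow> nat \<Rightarrow> spol \<Rightarrow> spol triang" where
  "dem_triang a b = spol_hom (\<lambda>j. Triang (- sx (exch a b j)) (of_bool (j = a \<or> j = b)) (sx j))"

lemma dem_triang:
  "dem_triang a b 1 = 1"
  "dem_triang a b (sx j) = Triang (- sx (exch a b j)) (of_bool (j = a \<or> j = b)) (sx j)"
  "dem_triang a b (p + q) = dem_triang a b p + dem_triang a b q"
  "dem_triang a b (p * q) = dem_triang a b p * dem_triang a b q"
proof -
  let ?g = "\<lambda>j. Triang (- sx (exch a b j)) (of_bool (j = a \<or> j = b)) (sx j)"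
  have inj: "exch a b i \<noteq> exch a b j" if "i \<noteq> j" for i j
    using that by (auto simp: exch_def)
  have "?g i * ?g j + ?g j * ?g i = 0" if "i \<noteq> j" for i j
    using that sx_anticommute[OF that] sx_anticommute[OF inj[OF that]]
    by (auto simp: triang_defs exch_def)
  note hom = spol_hom[where g = ?g, OF this]
  show "dem_triang a b 1 = 1"
    "dem_triang a b (sx j) = Triang (- sx (exch a b j)) (of_bool (j = a \<or> j = b)) (sx j)"
    "dem_triang a b (p + q) = dem_triang a b p + dem_triang a b q"
    "dem_triang a b (p * q) = dem_triang a b p * dem_triang a b q"
    unfolding dem_triang_def by (rule hom, assumption)+
qed

definition twist :: "nat \<Rightarrow> nat \<Rightarrow> spol \<Rightarrow> spol" where
  "twist a b p = ul (dem_triang a b p)"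

text \<open>The case \<open>a = i\<close>, \<open>b = i + 1\<close> is \<open>\<partial>\<^sub>i\<^sup>-\<close>, and the degenerate case \<open>a = b = n\<close> is \<open>\<partial>\<^sub>n\<^sup>B\<close>. This
  treats the generators of both kinds alike.\<close>

lift_definition dem :: "nat \<Rightarrow> nat \<Rightarrow> spol endo" is "\<lambda>a b p. ur (dem_triang a b p)"
  by (simp add: dem_triang triang_defs)

lemma twist:
  "twist a b 1 = 1" "twist a b (sx j) = - sx (exch a b j)"
  "twist a b (p + q) = twist a b p + twist a b q" "twist a b (p * q) = twist a b p * twist a b q"
  by (simp_all add: twist_def dem_triang triang_defs)

lemma twist_diff: "twist a b (p - q) = twist a b p - twist a b q"
  using twist(3)[of a b "p - q" q] by simp

lemma lr_dem_triang: "lr (dem_triang a b p) = p"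
proof (induction p rule: spol_induct)
  case (diff p q)
  then show ?case using dem_triang(3)[of a b "p - q" q] by (simp add: triang_defs algebra_simps)
qed (simp_all add: dem_triang triang_defs)

lemma dem_one [simp]: "app (dem a b) 1 = 0"
  by (simp add: dem.rep_eq dem_triang triang_defs)

lemma dem_mult: "app (dem a b) (p * q) = app (dem a b) p * q + twist a b p * app (dem a b) q"
  by (simp add: dem.rep_eq dem_triang triang_defs lr_dem_triang twist_def)

lemma dem_var: "app (dem a b) (sx j) = of_bool (j = a \<or> j = b)"
  by (simp add: dem.rep_eq dem_triang)

lemma dem_var_mult:
  "app (dem a b) (sx j * p) = of_bool (j = a \<or> j = b) * p - sx (exch a b j) * app (dem a b) p"
  by (simp add: dem_mult dem_var twist)

definition var_op :: "nat \<Rightarrow> spol endo" where "var_op j = left_mult (sx j)"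

lemma app_var_op [simp]: "app (var_op j) p = sx j * p" by (simp add: var_op_def)

lemma dem_var_op:
  "dem a b * var_op j = of_bool (j = a \<or> j = b) - var_op (exch a b j) * dem a b"
  by (rule endo_eqI) (simp add: dem_var_mult of_bool_def)

lemma dem_var_op_assoc:
  "dem a b * (var_op j * R) = of_bool (j = a \<or> j = b) * R - var_op (exch a b j) * (dem a b * R)"
  by (simp add: dem_var_op left_diff_distrib flip: mult.assoc)

text \<open>Since the variables generate, an operator that commutes with them up to sign and a
  permutation of the variables is determined by its value at \<open>1\<close>. This is how all relations
  between the Demazure operators are verified.\<close>

lemma skew_linear_endo_eq_0:
  assumes "app E 1 = 0" "\<And>j. \<exists>k. E * var_op j = var_op k * E \<or> E * var_op j = - (var_op k * E)"
  shows "E = 0"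
proof (rule endo_eqI)
  fix p show "app E p = app 0 p"
  proof (induction p rule: spol_induct)
    case (var i p)
    have "app E (sx i * p) = app (E * var_op i) p" by simp
    also obtain k where "E * var_op i = var_op k * E \<or> E * var_op i = - (var_op k * E)"
      using assms(2) by blast
    then have "app (E * var_op i) p = 0"
      using var by (elim disjE) (simp_all del: times_endo.rep_eq add: times_endo.rep_eq[of "var_op k"])
    finally show ?case by simp
  qed (use assms(1) in \<open>simp_all add: app_diff\<close>)
qed

lemma dem_square: "dem a b * dem a b = 0"
proof (rule skew_linear_endo_eq_0)
  fix j show "\<exists>k. dem a b * dem a b * var_op j = var_op k * (dem a b * dem a b) \<or>
       dem a b * dem a b * var_op j = - (var_op k * (dem a b * dem a b))"
    by (rule exI[of _ j])
      (auto simp: mult.assoc dem_var_op dem_var_op_assoc right_diff_distrib exch_def of_bool_def)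
qed simp

lemma dem_square_assoc: "dem a b * (dem a b * R) = 0"
  by (simp add: dem_square flip: mult.assoc)

text \<open>Rewriting with these equations moves the variables to the left of the Demazure operators.\<close>

lemmas dem_normalize = mult.assoc distrib_left distrib_right right_diff_distrib left_diff_distrib
  dem_var_op dem_var_op_assoc dem_square dem_square_assoc

lemma dem_anticommute:
  assumes "a \<noteq> c" "a \<noteq> d" "b \<noteq> c" "b \<noteq> d"
  shows "dem a b * dem c d + dem c d * dem a b = 0"
proof (rule skew_linear_endo_eq_0)
  fix j
  let ?E = "dem a b * dem c d + dem c d * dem a b"
  have "?E * var_op j = var_op (exch a b (exch c d j)) * ?E"
    using assms by (auto simp: dem_normalize exch_def of_bool_def)
  then show "\<exists>k. ?E * var_op j = var_op k * ?E \<or> ?E * var_op j = - (var_op k * ?E)" by blast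
qed simp

lemma dem_braid:
  assumes "a \<noteq> b" "b \<noteq> c" "a \<noteq> c"
  shows "dem a b * dem b c * dem a b - dem b c * dem a b * dem b c = 0"
proof (rule skew_linear_endo_eq_0)
  fix j
  let ?E = "dem a b * dem b c * dem a b - dem b c * dem a b * dem b c"
  have "?E * var_op j = - (var_op (exch a c j) * ?E)"
    using assms
    by (cases "j = a"; cases "j = b"; cases "j = c") (simp_all add: dem_normalize)
  then show "\<exists>k. ?E * var_op j = var_op k * ?E \<or> ?E * var_op j = - (var_op k * ?E)" by blast
qed simp

lemma dem_braid_B:
  assumes "a \<noteq> b"
  shows "dem b b * dem a b * dem b b * dem a b + dem a b * dem b b * dem a b * dem b b = 0"
proof (rule skew_linear_endo_eq_0)
  fix j
  let ?E = "dem b b * dem a b * dem b b * dem a b + dem a b * dem b b * dem a b * dem b b"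
  have "?E * var_op j = var_op j * ?E"
    using assms by (cases "j = a"; cases "j = b") (simp_all add: dem_normalize)
  then show "\<exists>k. ?E * var_op j = var_op k * ?E \<or> ?E * var_op j = - (var_op k * ?E)" by blast
qed simp

lemma dem_spol_in:
  assumes "p \<in> spol_in A" "a \<in> A" "b \<in> A"
  shows "app (dem a b) p \<in> spol_in A" "twist a b p \<in> spol_in A"
  using assms(1)
proof (induction p rule: spol_in_induct)
  case (var i p)
  moreover have "exch a b i \<in> A" using var assms by (auto simp: exch_def)
  ultimately show "app (dem a b) (sx i * p) \<in> spol_in A" "twist a b (sx i * p) \<in> spol_in A"
    by (auto simp: dem_var_mult twist intro!: spol_in_closed)
qed (auto simp: app_diff twist twist_diff intro!: spol_in_closed)

lemma dem_spol_deg: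
  assumes "p \<in> spol_deg A d" "a \<in> A" "b \<in> A"
  shows "app (dem a b) p \<in> spol_deg A (d - 2)"
  using assms(1) unfolding spol_deg_def
proof (induction p rule: word_span_induct)
  case (word w)
  then have "w \<in> lists A" and d: "d = 2 * int (length w)" by auto
  from this(1) have "app (dem a b) (prod_list (map sx w)) \<in> spol_deg A (2 * int (length w) - 2)"
  proof induction
    case (Cons i w)
    have "prod_list (map sx w) \<in> spol_deg A (2 * int (length w))"
      unfolding spol_deg_def by (rule word_span_closed) (use Cons in auto)
    moreover have "exch a b i \<in> A" using Cons assms by (auto simp: exch_def)
    then have "sx (exch a b i) * app (dem a b) (prod_list (map sx w)) \<in>
      spol_deg A (2 + (2 * int (length w) - 2))"
      using Cons by (intro spol_deg_closed)
    ultimately show ?case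
      by (auto simp: dem_var_mult intro!: spol_deg_closed)
  qed (auto simp: spol_deg_closed)
  then show ?case using d by (simp add: spol_deg_def)
qed (auto simp: app_diff word_span_closed)

section \<open>Elementary symmetric polynomials in the squares\<close>

lemma sx_square_central: "sx i ^ 2 * p = p * sx i ^ 2"
proof (induction p rule: spol_induct)
  case (var j p)
  have "sx i ^ 2 * sx j = sx j * sx i ^ 2"
  proof (cases "i = j")
    case False
    have "sx i * sx i * sx j = - (sx i * (sx j * sx i))"
      by (simp add: mult.assoc sx_anticommute[OF False])
    also have "\<dots> = sx j * sx i * sx i"
      by (simp add: sx_anticommute[OF False] flip: mult.assoc)
    finally show ?thesis by (simp add: power2_eq_square mult.assoc)
  qed (simp add: power2_eq_square mult.assoc)
  then have "sx i ^ 2 * (sx j * p) = sx j * (sx i ^ 2 * p)" by (simp flip: mult.assoc)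
  then show ?case using var by (simp add: mult.assoc)
qed (simp_all add: algebra_simps)

text \<open>The elementary symmetric polynomials in the squares of the listed variables. The recursion on the
  list splits off one variable, which is what the inductions on the number of variables
  need.\<close>

fun esym :: "nat list \<Rightarrow> nat \<Rightarrow> spol" where
  "esym [] k = of_bool (k = 0)"
| "esym (i # is) 0 = 1"
| "esym (i # is) (Suc k) = esym is (Suc k) + sx i ^ 2 * esym is k"

lemma esym_0 [simp]: "esym is 0 = 1" by (cases "is") simp_all

lemma esym_eq_0: "length is < k \<Longrightarrow> esym is k = 0"
proof (induction "is" arbitrary: k)
  case (Cons i "is") then show ?case by (cases k) simp_all
qed simp

lemma esym_central: "esym is k * p = p * esym is k"
proof (induction "is" k rule: esym.induct)
  case (3 i "is" k)
  have "sx i ^ 2 * esym is k * p = sx i ^ 2 * p * esym is k" using 3(2) by (simp add: mult.assoc)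
  also have "\<dots> = p * (sx i ^ 2 * esym is k)" by (simp add: sx_square_central mult.assoc)
  finally show ?case using 3 by (simp add: distrib_left distrib_right)
qed simp_all

lemma esym_left_commute: "p * (esym is k * q) = esym is k * (p * q)"
  by (simp flip: mult.assoc esym_central[of "is" k p])

text \<open>The recursion \<open>e\<^sub>k(y\<^sub>m, \<dots>) = e\<^sub>k(\<dots>) + y\<^sub>m e\<^bsub>k-1\<^esub>(\<dots>)\<close> can be solved for the polynomials without \<open>y\<^sub>m\<close>, by
  division of generating series by \<open>1 + y\<^sub>m t\<close>.\<close>

lemma esym_tail: "esym is k = (\<Sum>i\<le>k. (- (sx m ^ 2)) ^ i * esym (m # is) (k - i))"
proof (induction k)
  case (Suc k)
  have "esym is (Suc k) = esym (m # is) (Suc k) - sx m ^ 2 * esym is k" by simp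
  then show ?case by (simp add: Suc sum.atMost_Suc_shift sum_distrib_left sum_negf mult.assoc
      del: esym.simps sum.atMost_Suc)
qed simp

text \<open>The elementary symmetric polynomial of a degree above the number of variables vanishes, so
  \<open>esym_tail\<close> becomes an equation for \<open>y\<^sub>m\<close>: it is a root of \<open>\<Prod>\<^sub>i (t - y\<^sub>i)\<close>.\<close>

lemma sx_power_reduce:
  "\<exists>c. sx m ^ (2 * Suc (length is)) =
     (\<Sum>i \<le> length is. c i * (esym (m # is) (Suc (length is) - i) * sx m ^ (2 * i))) \<and>
     (\<forall>i. c i = 1 \<or> c i = - 1)"
proof -
  let ?L = "Suc (length is)"
  have sq: "(- (sx m ^ 2)) ^ i = (- 1) ^ i * sx m ^ (2 * i)" for i
    by (simp add: power_minus[of "sx m ^ 2"] power_mult)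
  have "0 = (\<Sum>i\<le>?L. (- (sx m ^ 2)) ^ i * esym (m # is) (?L - i))"
    using esym_tail[of "is" ?L m] by (simp add: esym_eq_0)
  also have "\<dots> = (\<Sum>i\<le>length is. (- (sx m ^ 2)) ^ i * esym (m # is) (?L - i)) + (- (sx m ^ 2)) ^ ?L"
    by (simp del: esym.simps)
  finally have "(- 1) ^ ?L * sx m ^ (2 * ?L) =
      - (\<Sum>i\<le>length is. (- 1) ^ i * sx m ^ (2 * i) * esym (m # is) (?L - i))"
    unfolding sq by (simp only: eq_neg_iff_add_eq_0 add.commute)
  then have "(- 1) ^ ?L * ((- 1) ^ ?L * sx m ^ (2 * ?L)) =
      (- 1) ^ ?L * - (\<Sum>i\<le>length is. (- 1) ^ i * sx m ^ (2 * i) * esym (m # is) (?L - i))"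
    by simp
  then have "sx m ^ (2 * ?L) =
      (\<Sum>i\<le>length is. (- ((- 1) ^ ?L * (- 1) ^ i)) * (sx m ^ (2 * i) * esym (m # is) (?L - i)))"
    by (simp add: sum_distrib_left mult.assoc sum_negf del: esym.simps power_Suc mult_Suc_right
        flip: mult.assoc power_add mult_2) 
  then show ?thesis
    by (intro exI[of _ "\<lambda>i. - ((- 1) ^ ?L * (- 1) ^ i)"])
      (simp add: esym_central del: esym.simps power_Suc flip: power_add,
       metis minus_one_power_iff minus_minus)
qed

text \<open>The generator \<open>d\<^sub>i\<close>; the minimum makes \<open>d\<^sub>n\<close> the operator \<open>dem n n\<close>.\<close>

definition dop :: "nat \<Rightarrow> nat \<Rightarrow> spol endo" where
  "dop n i = dem i (min (Suc i) n)"

definition linear_over :: "spol endo \<Rightarrow> spol \<Rightarrow> bool" where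
  "linear_over D c \<longleftrightarrow> (\<forall>p. app D (c * p) = c * app D p)"

lemma linear_over_closed:
  "linear_over D 0" "linear_over D 1"
  "linear_over D c \<Longrightarrow> linear_over D c' \<Longrightarrow> linear_over D (c + c')"
  "linear_over D c \<Longrightarrow> linear_over D c' \<Longrightarrow> linear_over D (c * c')"
  by (simp_all add: linear_over_def distrib_right app_add mult.assoc)

text \<open>The operator exchanges \<open>y\<^sub>a\<close> and \<open>y\<^sub>b\<close> with opposite correction terms \<open>x\<^sub>a - x\<^sub>b\<close> and \<open>x\<^sub>b - x\<^sub>a\<close>, and fixes
  the other squares. So it commutes with \<open>y\<^sub>a + y\<^sub>b\<close>, and, the squares being central, with
  \<open>y\<^sub>a y\<^sub>b\<close>.\<close>

lemma dem_sx_square: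
  "app (dem a b) (sx j ^ 2 * p) = of_bool (j = a \<or> j = b) * (sx j - sx (exch a b j)) * p
     + sx (exch a b j) ^ 2 * app (dem a b) p"
  by (simp add: power2_eq_square mult.assoc dem_var_mult algebra_simps)

lemma dem_linear_over_other: "j \<noteq> a \<Longrightarrow> j \<noteq> b \<Longrightarrow> linear_over (dem a b) (sx j ^ 2)"
  by (simp add: linear_over_def dem_sx_square)

lemma dem_linear_over_same: "linear_over (dem a a) (sx a ^ 2)"
  by (simp add: linear_over_def dem_sx_square)

lemma dem_linear_over_sum: "linear_over (dem a b) (sx a ^ 2 + sx b ^ 2)"
  by (simp add: linear_over_def dem_sx_square distrib_right app_add algebra_simps)

lemma dem_linear_over_prod: "linear_over (dem a b) (sx a ^ 2 * sx b ^ 2)"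
proof -
  have "sx b ^ 2 * ((sx a - sx b) * p) = (sx a - sx b) * (sx b ^ 2 * p)" for p
    by (metis mult.assoc sx_square_central)
  moreover have "sx b ^ 2 * (sx a ^ 2 * q) = sx a ^ 2 * (sx b ^ 2 * q)" for q
    by (metis mult.assoc sx_square_central)
  ultimately show ?thesis
    by (simp add: linear_over_def dem_sx_square mult.assoc algebra_simps)
qed

lemma esym_Cons_Cons:
  "esym (i # j # is) (Suc (Suc k)) =
     esym is (Suc (Suc k)) + (sx i ^ 2 + sx j ^ 2) * esym is (Suc k) + sx i ^ 2 * sx j ^ 2 * esym is k"
  "esym (i # j # is) (Suc 0) = esym is (Suc 0) + (sx i ^ 2 + sx j ^ 2)"
  by (simp_all add: algebra_simps)

lemma dem_linear_over_esym_disjoint: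
  assumes "a \<notin> set is" "b \<notin> set is"
  shows "linear_over (dem a b) (esym is k)"
  using assms
  by (induction "is" k rule: esym.induct)
    (auto intro!: linear_over_closed dem_linear_over_other)

lemma dem_linear_over_esym_pair:
  assumes "a \<notin> set is" "b \<notin> set is"
  shows "linear_over (dem a b) (esym (a # b # is) k)"
proof -
  consider "k = 0" | "k = Suc 0" | k' where "k = Suc (Suc k')" by (metis nat.exhaust)
  then show ?thesis
    by cases (auto simp: esym_Cons_Cons simp del: esym.simps(3) intro!: linear_over_closed(2)
      linear_over_closed(3,4) dem_linear_over_sum dem_linear_over_prod
      dem_linear_over_esym_disjoint assms)
qed

text \<open>\<open>d\<^sub>i\<close> touches only \<open>y\<^sub>i\<close> and \<open>y\<^bsub>i+1\<^esub>\<close>, and the elementary symmetric polynomials contain these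
  through their sum and product.\<close>

lemma dop_linear_over_esym:
  assumes "m \<le> i" "i \<le> n"
  shows "linear_over (dop n i) (esym [m..<Suc n] k)"
  using assms
proof (induction m arbitrary: k rule: inc_induct)
  case base
  show ?case
  proof (cases "i = n")
    case True
    then show ?thesis
      by (cases k) (auto simp: dop_def intro!: linear_over_closed dem_linear_over_same)
  next
    case False
    then have "[i..<Suc n] = i # Suc i # [Suc (Suc i)..<Suc n]"
      using assms by (simp add: upt_conv_Cons del: upt_Suc)
    moreover have "dop n i = dem i (Suc i)" using False assms by (simp add: dop_def)
    ultimately show ?thesis
      by (auto intro!: dem_linear_over_esym_pair simp del: upt_Suc)
  qed
next
  case (step m)
  then have "[m..<Suc n] = m # [Suc m..<Suc n]"
    by (simp add: upt_conv_Cons del: upt_Suc)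
  moreover have "linear_over (dop n i) (sx m ^ 2)"
    using step assms unfolding dop_def by (intro dem_linear_over_other) auto
  ultimately show ?case
    using step by (cases k) (auto intro!: linear_over_closed simp del: upt_Suc)
qed


section \<open>Words and monomials\<close>

definition word_op :: "nat \<Rightarrow> nat list \<Rightarrow> spol endo" where
  "word_op n w = prod_list (map (dop n) w)"

lemma word_op_simps [simp]:
  "word_op n [] = 1" "word_op n (i # w) = dop n i * word_op n w"
  "word_op n (u @ v) = word_op n u * word_op n v"
  by (simp_all add: word_op_def)

text \<open>The suffix of length \<open>j\<close> of the word \<open>d\<^sub>m \<cdots> d\<^bsub>n-1\<^esub> d\<^sub>n d\<^bsub>n-1\<^esub> \<cdots> d\<^sub>m\<close>, where \<open>l = n - m + 1\<close> is the
  rank, so that \<open>j < 2 l\<close>. These words represent the minimal coset representatives of the Weyl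
  group of rank \<open>l\<close> modulo that of rank \<open>l - 1\<close>. Peeling off the outer letters \<open>d\<^sub>m\<close>
  leaves a suffix of the palindrome of smaller rank.\<close>

fun tau :: "nat \<Rightarrow> nat \<Rightarrow> nat \<Rightarrow> nat list" where
  "tau 0 m j = []"
| "tau (Suc l) m j =
     (if j = 0 then [] else if j \<le> 2 * l then tau l (Suc m) (j - 1) @ [m]
      else m # (if l = 0 then [] else tau l (Suc m) (2 * l - 1) @ [m]))"

lemma tau_top: "tau (Suc l) m (2 * l + 1) = m # tau (Suc l) m (2 * l)"
  by simp

lemma set_tau: "set (tau l m j) \<subseteq> {m..<m + l}"
proof (induction l arbitrary: m j)
  case (Suc l)
  have "set (tau l (Suc m) i) \<subseteq> {m..<m + Suc l}" for i
    using Suc[of "Suc m" i] by fastforce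
  then show ?case by (auto simp: subset_iff)
qed simp

lemma length_tau: "j < 2 * l \<Longrightarrow> length (tau l m j) = j"
  by (induction l arbitrary: m j) auto

text \<open>\<open>2\<^sup>l l!\<close>, the order of the Weyl group of type B and rank \<open>l\<close>.\<close>

fun order_B :: "nat \<Rightarrow> nat" where
  "order_B 0 = 1"
| "order_B (Suc l) = 2 * Suc l * order_B l"

text \<open>The exponents of a box monomial, or the lengths of the factors of a word, are the digits of a
  number below \<open>order_B l\<close> in the mixed radix system with bases \<open>2l, 2(l-1), \<dots>, 2\<close>. The digit
  of the last variable is the most significant one, so the order of the numbers is the
  lexicographic order in which the pairing is triangular.\<close>

fun nf_word :: "nat \<Rightarrow> nat \<Rightarrow> nat \<Rightarrow> nat list" where
  "nf_word 0 m r = []"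
| "nf_word (Suc l) m r = tau (Suc l) m (r mod (2 * Suc l)) @ nf_word l (Suc m) (r div (2 * Suc l))"

fun box_mono :: "nat \<Rightarrow> nat \<Rightarrow> nat \<Rightarrow> spol" where
  "box_mono 0 m r = 1"
| "box_mono (Suc l) m r = sx m ^ (r mod (2 * Suc l)) * box_mono l (Suc m) (r div (2 * Suc l))"

fun digit_sum :: "nat \<Rightarrow> nat \<Rightarrow> nat" where
  "digit_sum 0 r = 0"
| "digit_sum (Suc l) r = r mod (2 * Suc l) + digit_sum l (r div (2 * Suc l))"

lemma set_nf_word: "set (nf_word l m r) \<subseteq> {m..<m + l}"
proof (induction l arbitrary: m r)
  case (Suc l)
  from Suc[of "Suc m" "r div (2 * Suc l)"] set_tau[of "Suc l" m "r mod (2 * Suc l)"]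
  show ?case by (auto simp del: tau.simps mult_Suc_right)
qed simp

lemma length_nf_word: "length (nf_word l m r) = digit_sum l r"
  by (induction l arbitrary: m r) (auto simp: length_tau simp del: tau.simps mult_Suc_right)

text \<open>Only the vanishing and invertibility of values matter below, so signs are carried along without
  being computed.\<close>

definition is_sign :: "spol \<Rightarrow> bool" where "is_sign c \<longleftrightarrow> c = 1 \<or> c = - 1"

lemma is_sign_closed: "is_sign 1" "is_sign (- 1)" "is_sign c \<Longrightarrow> is_sign (- c)" "is_sign c \<Longrightarrow> is_sign c' \<Longrightarrow> is_sign (c * c')"
  by (auto simp: is_sign_def)

lemma is_sign_commute: "is_sign c \<Longrightarrow> p * c = c * p"
  by (auto simp: is_sign_def)

lemma is_sign_left_commute: "is_sign c \<Longrightarrow> p * (c * q) = c * (p * q)"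
  by (auto simp: is_sign_def)

lemma is_sign_app: "is_sign c \<Longrightarrow> app D (c * p) = c * app D p"
  by (auto simp: is_sign_def app_uminus)

lemma dop_skew:
  assumes "k < i" "i \<le> n"
  shows "\<exists>c. is_sign c \<and> (\<forall>p. app (dop n i) (sx k ^ a * p) = c * (sx k ^ a * app (dop n i) p))"
proof (induction a)
  case 0 show ?case by (rule exI[of _ 1]) (simp add: is_sign_closed)
next
  case (Suc a)
  then obtain c where "is_sign c" "\<And>p. app (dop n i) (sx k ^ a * p) = c * (sx k ^ a * app (dop n i) p)"
    by blast
  moreover have "app (dop n i) (sx k * p) = - (sx k * app (dop n i) p)" for p
    using assms by (auto simp: dop_def dem_var_mult min_def)
  ultimately show ?case
    by (intro exI[of _ "- c"])
      (simp add: is_sign_closed mult.assoc is_sign_left_commute)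
qed

lemma word_op_skew:
  assumes "set w \<subseteq> {Suc k..n}"
  shows "\<exists>c. is_sign c \<and> (\<forall>p. app (word_op n w) (sx k ^ a * p) = c * (sx k ^ a * app (word_op n w) p))"
  using assms
proof (induction w)
  case Nil show ?case by (rule exI[of _ 1]) (simp add: is_sign_closed)
next
  case (Cons i w)
  then obtain c where "is_sign c" "\<And>p. app (word_op n w) (sx k ^ a * p) = c * (sx k ^ a * app (word_op n w) p)"
    by auto
  moreover have "k < i" "i \<le> n" using Cons(2) by auto
  then obtain c' where "is_sign c'" "\<And>p. app (dop n i) (sx k ^ a * p) = c' * (sx k ^ a * app (dop n i) p)"
    using dop_skew[of k i n a] by blast
  ultimately show ?case
    by (intro exI[of _ "c * c'"]) (simp add: is_sign_closed is_sign_app mult.assoc)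
qed

lemma sx_powers_commute: "i \<noteq> k \<Longrightarrow> \<exists>c. is_sign c \<and> sx i ^ a * sx k ^ b = c * (sx k ^ b * sx i ^ a)"
proof -
  assume ik: "i \<noteq> k"
  have 1: "sx i * sx k ^ b = (- 1) ^ b * (sx k ^ b * sx i)"
  proof (induction b)
    case (Suc b)
    have "sx i * sx k ^ Suc b = - (sx k * (sx i * sx k ^ b))"
      by (simp add: sx_anticommute[OF ik] flip: mult.assoc)
    also have "\<dots> = (- 1) ^ Suc b * (sx k ^ Suc b * sx i)"
      unfolding Suc by (cases "even b") (simp_all add: mult.assoc)
    finally show ?case .
  qed simp
  show ?thesis
  proof (induction a)
    case 0 show ?case by (rule exI[of _ 1]) (simp add: is_sign_closed)
  next
    case (Suc a)
    then obtain c where c: "is_sign c" "sx i ^ a * sx k ^ b = c * (sx k ^ b * sx i ^ a)" by blast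
    have "sx i ^ Suc a * sx k ^ b = c * (sx i * sx k ^ b * sx i ^ a)"
      using c by (simp add: mult.assoc is_sign_left_commute)
    also have "\<dots> = c * (- 1) ^ b * (sx k ^ b * sx i ^ Suc a)"
      unfolding 1 by (simp add: mult.assoc)
    finally show ?case
      by (intro exI[of _ "c * (- 1) ^ b"]) (cases "even b"; simp add: c is_sign_closed)
  qed
qed

lemma dem_power: "app (dem a b) (sx a ^ k) = (\<Sum>i<k. (- 1) ^ i * (sx b ^ i * sx a ^ (k - Suc i)))"
proof (induction k)
  case (Suc k)
  have "app (dem a b) (sx a ^ Suc k) = sx a ^ k - sx b * app (dem a b) (sx a ^ k)"
    by (simp add: dem_var_mult)
  also have "sx b * ((- 1) ^ i * p) = (- 1) ^ i * (sx b * p)" for i p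
    by (cases "even i") simp_all
  then have "sx a ^ k - sx b * app (dem a b) (sx a ^ k) = (\<Sum>i<Suc k. (- 1) ^ i * (sx b ^ i * sx a ^ (Suc k - Suc i)))"
    unfolding Suc
    by (simp add: sum.lessThan_Suc_shift sum_distrib_left sum_negf mult.assoc del: sum.lessThan_Suc)
  finally show ?case .
qed simp

section \<open>Triangularity\<close>

text \<open>The rightmost letter \<open>d\<^sub>m\<close> turns \<open>x\<^sub>m\<^sup>k\<close> into a sum of monomials \<open>x\<^sub>m\<^sup>i x\<^bsub>m+1\<^esub>\<^sup>j\<close> of degree \<open>k - 1\<close>, and
  the remaining letters pass the power of \<open>x\<^sub>m\<close> up to sign.\<close>

lemma tau_power_expand:
  assumes "0 < l" "1 \<le> j" "j \<le> 2 * l" "m + l = n"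
  shows "\<exists>c. (\<forall>i. is_sign (c i)) \<and> app (word_op n (tau (Suc l) m j)) (sx m ^ k) =
    (\<Sum>i<k. c i * (sx m ^ (k - Suc i) * app (word_op n (tau l (Suc m) (j - 1))) (sx (Suc m) ^ i)))"
proof -
  let ?T = "word_op n (tau l (Suc m) (j - 1))"
  have "set (tau l (Suc m) (j - 1)) \<subseteq> {Suc m..n}"
    using set_tau[of l "Suc m" "j - 1"] assms by auto
  then have skew: "\<exists>c. is_sign c \<and> (\<forall>p. app ?T (sx m ^ a * p) = c * (sx m ^ a * app ?T p))" for a
    by (rule word_op_skew)
  have summand: "\<exists>c. is_sign c \<and> app ?T ((- 1) ^ i * (sx (Suc m) ^ i * sx m ^ (k - Suc i))) =
      c * (sx m ^ (k - Suc i) * app ?T (sx (Suc m) ^ i))" for i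
  proof -
    obtain c where c: "is_sign c" "sx (Suc m) ^ i * sx m ^ (k - Suc i) = c * (sx m ^ (k - Suc i) * sx (Suc m) ^ i)"
      using sx_powers_commute[of "Suc m" m i "k - Suc i"] by auto
    obtain c' where c': "is_sign c'" "\<And>p. app ?T (sx m ^ (k - Suc i) * p) = c' * (sx m ^ (k - Suc i) * app ?T p)"
      using skew by blast
    have s: "is_sign ((- 1) ^ i)" by (cases "even i") (simp_all add: is_sign_closed)
    show ?thesis
      by (rule exI[of _ "(- 1) ^ i * (c * c')"])
        (simp add: c c' s is_sign_closed is_sign_app mult.assoc del: One_nat_def)
  qed
  then obtain c where c: "\<And>i. is_sign (c i)" "\<And>i. app ?T ((- 1) ^ i * (sx (Suc m) ^ i * sx m ^ (k - Suc i))) =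
      c i * (sx m ^ (k - Suc i) * app ?T (sx (Suc m) ^ i))"
    by metis
  have "dop n m = dem m (Suc m)" using assms by (simp add: dop_def)
  then have "app (word_op n (tau (Suc l) m j)) (sx m ^ k) =
      app ?T (\<Sum>i<k. (- 1) ^ i * (sx (Suc m) ^ i * sx m ^ (k - Suc i)))"
    using assms by (simp add: dem_power)
  then show ?thesis using c by (auto simp: app_sum)
qed

lemma word_op_linear_over:
  "(\<And>i. i \<in> set w \<Longrightarrow> linear_over (dop n i) c) \<Longrightarrow> linear_over (word_op n w) c"
  by (induction w) (auto simp: linear_over_def)

text \<open>By \<open>tau_power_expand\<close> the claim for the smaller rank leaves a single term, except for
  the longest word. There one further term could contribute, the value of the
  longest word of rank \<open>l - 1\<close> at \<open>x\<^bsub>m+1\<^esub>\<^bsup>2(l-1)\<^esup>\<close>. It vanishes, because that power is a combination of lower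
  even powers, where the word gives \<open>0\<close>, with coefficients over which the operators are linear.\<close>

lemma tau_power:
  assumes "m + l = Suc n" "j < 2 * l" "k \<le> j"
  shows "if k = j then is_sign (app (word_op n (tau l m j)) (sx m ^ k))
         else app (word_op n (tau l m j)) (sx m ^ k) = 0"
  using assms
proof (induction l arbitrary: m j k)
  case (Suc l)
  note One_nat_def [simp del]
  let ?T = "\<lambda>l m j. word_op n (tau l m j)"
  show ?case
  proof (cases "l = 0")
    case True
    then have "m = n" using Suc by simp
    have "j = 0 \<or> j = 1" using Suc True by auto
    with True \<open>m = n\<close> Suc show ?thesis
      by (auto simp: dop_def dem_var is_sign_closed split: if_splits)
        (use dem_one in \<open>simp_all add: One_nat_def le_Suc_eq\<close>)
  next
    case False
    then obtain l' where l': "l = Suc l'" by (cases l) auto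
    have n: "m + l = n" using Suc by simp
    have low: "if k = j then is_sign (app (?T (Suc l) m j) (sx m ^ k)) else app (?T (Suc l) m j) (sx m ^ k) = 0"
      if j: "1 \<le> j" "j \<le> 2 * l" "k \<le> j" for j k
    proof -
      obtain c where c: "\<And>i. is_sign (c i)" "app (?T (Suc l) m j) (sx m ^ k) =
        (\<Sum>i<k. c i * (sx m ^ (k - Suc i) * app (?T l (Suc m) (j - 1)) (sx (Suc m) ^ i)))"
        using tau_power_expand[OF _ j(1,2) n, of k] False by blast
      have IH: "if i = j - 1 then is_sign (app (?T l (Suc m) (j - 1)) (sx (Suc m) ^ i))
         else app (?T l (Suc m) (j - 1)) (sx (Suc m) ^ i) = 0" if "i \<le> j - 1" for i
        by (rule Suc.IH) (use n j that in auto)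
      show ?thesis
      proof (cases "k = j")
        case True
        have "app (?T (Suc l) m j) (sx m ^ k) =
            (\<Sum>i<k. if i = k - 1 then c i * (sx m ^ (k - Suc i) * app (?T l (Suc m) (j - 1)) (sx (Suc m) ^ i)) else 0)"
          unfolding c(2) by (rule sum.cong) (use IH True in \<open>auto split: if_splits\<close>)
        also have "\<dots> = c (k - 1) * app (?T l (Suc m) (j - 1)) (sx (Suc m) ^ (k - 1))"
          using j True by (simp add: sum.delta)
        also have "is_sign \<dots>" using c(1) IH[of "k - 1"] True by (auto intro!: is_sign_closed)
        finally show ?thesis using True by simp
      next
        case False
        have "app (?T (Suc l) m j) (sx m ^ k) = 0"
          unfolding c(2) by (rule sum.neutral) (use IH j False in \<open>auto split: if_splits\<close>)
        then show ?thesis using False by simp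
      qed
    qed
    consider "j = 0" | "1 \<le> j" "j \<le> 2 * l" | "j = 2 * l + 1" using Suc.prems by fastforce
    then show ?thesis
    proof cases
      case 1
      then show ?thesis using Suc.prems by (simp add: is_sign_closed)
    next
      case 2
      then show ?thesis using low Suc.prems by blast
    next
      case 3
      have top: "app (?T (Suc l) m j) p = app (dop n m) (app (?T (Suc l) m (2 * l)) p)" for p
        using tau_top[of l m] 3 by (simp del: tau.simps)
      have dm: "dop n m = dem m (Suc m)" using n False by (simp add: dop_def)
      have kill: "app (dop n m) c = 0" if "is_sign c" for c
        using that by (auto simp: is_sign_def dm app_uminus)
      consider "k < 2 * l" | "k = 2 * l" | "k = 2 * l + 1" using Suc.prems 3 by fastforce
      then show ?thesis
      proof cases
        case 1
        then show ?thesis using low[of "2 * l" k] 3 False unfolding top by auto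
      next
        case 2
        then show ?thesis using low[of "2 * l" k] 3 False kill unfolding top by auto
      next
        case k: 3
        \<comment> \<open>The power \<open>2l\<close> of the next variable reduces to smaller even powers, all below \<open>2l - 1\<close>.\<close>
        have "app (?T l (Suc m) (2 * l - 1)) (sx (Suc m) ^ (2 * l)) = 0"
        proof -
          let ?is = "[Suc (Suc m)..<Suc n]"
          have len: "Suc (length ?is) = l" using n l' by (auto simp del: upt_Suc)
          have "Suc m # ?is = [Suc m..<Suc n]"
            using n False by (simp add: upt_conv_Cons del: upt_Suc)
          then have lin: "linear_over (?T l (Suc m) (2 * l - 1)) (esym (Suc m # ?is) i)" for i
            using set_tau[of l "Suc m" "2 * l - 1"] n
            by (intro word_op_linear_over) (auto intro!: dop_linear_over_esym simp del: upt_Suc)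
          obtain c where c: "sx (Suc m) ^ (2 * l) =
              (\<Sum>i\<le>length ?is. c i * (esym (Suc m # ?is) (l - i) * sx (Suc m) ^ (2 * i)))"
            "\<And>i. is_sign (c i)"
            using sx_power_reduce[of "Suc m" ?is] unfolding len is_sign_def by blast
          have "app (?T l (Suc m) (2 * l - 1)) (sx (Suc m) ^ (2 * i)) = 0" if "i \<le> length ?is" for i
          proof -
            have i: "2 * i < 2 * l - 1" using that len by simp
            show ?thesis
              using Suc.IH[of "Suc m" "2 * l - 1" "2 * i"] i n by (auto split: if_splits)
          qed
          then show ?thesis
            unfolding c(1) app_sum using lin c(2)
            by (intro sum.neutral) (auto simp: is_sign_app linear_over_def)
        qed
        then have T0: "app (?T l (Suc m) (2 * l - 1)) (sx (Suc m) ^ i) = 0" if "i \<le> 2 * l" "i \<noteq> 2 * l - 1" for i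
          using Suc.IH[of "Suc m" "2 * l - 1" i] n that by (cases "i = 2 * l") (auto split: if_splits)
        have T1: "is_sign (app (?T l (Suc m) (2 * l - 1)) (sx (Suc m) ^ (2 * l - 1)))"
          using Suc.IH[of "Suc m" "2 * l - 1" "2 * l - 1"] n False by (auto split: if_splits)
        obtain c where c: "\<And>i. is_sign (c i)" "app (?T (Suc l) m (2 * l)) (sx m ^ k) =
          (\<Sum>i<k. c i * (sx m ^ (k - Suc i) * app (?T l (Suc m) (2 * l - 1)) (sx (Suc m) ^ i)))"
          using tau_power_expand[OF _ _ _ n, of "2 * l" k] False by auto
        have "app (?T (Suc l) m (2 * l)) (sx m ^ k) =
            (\<Sum>i<k. if i = 2 * l - 1 then c i * (sx m ^ (k - Suc i) * app (?T l (Suc m) (2 * l - 1)) (sx (Suc m) ^ i)) else 0)"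
          unfolding c(2) by (rule sum.cong) (use T0 k in auto)
        also have "\<dots> = c (2 * l - 1) * (sx m * app (?T l (Suc m) (2 * l - 1)) (sx (Suc m) ^ (2 * l - 1)))"
        proof -
          have "2 * l - 1 < k" "k - Suc (2 * l - 1) = 1" using k False by auto
          then show ?thesis by (simp add: sum.delta)
        qed
        finally have "app (?T (Suc l) m j) (sx m ^ k) =
            c (2 * l - 1) * app (?T l (Suc m) (2 * l - 1)) (sx (Suc m) ^ (2 * l - 1))"
          using T1 c(1) unfolding top
          by (simp add: is_sign_app is_sign_commute[OF T1] dm dem_var)
        then show ?thesis using c(1) T1 k 3 by (simp add: is_sign_closed)
      qed
    qed
  qed
qed simp

definition pairing :: "nat \<Rightarrow> nat \<Rightarrow> nat \<Rightarrow> nat \<Rightarrow> nat \<Rightarrow> spol" where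
  "pairing n l m r s = app (word_op n (nf_word l m r)) (box_mono l m s)"

text \<open>The word factors as \<open>tau\<close> times a word in \<open>d\<^bsub>m+1\<^esub>, \<dots>, d\<^sub>n\<close>, and the latter passes the power of \<open>x\<^sub>m\<close> up to
  sign. So the pairing of the higher digits decides first, and when it is a sign the
  lowest digits are compared by \<open>tau_power\<close>.\<close>

lemma pairing_triangular:
  assumes "m + l = Suc n" "r < order_B l" "s < order_B l"
  shows "s < r \<Longrightarrow> pairing n l m r s = 0" "s = r \<Longrightarrow> is_sign (pairing n l m r s)"
proof -
  have "(s < r \<longrightarrow> pairing n l m r s = 0) \<and> (s = r \<longrightarrow> is_sign (pairing n l m r s))"
    using assms
  proof (induction l arbitrary: m r s)
    case 0 then show ?case by (simp add: pairing_def is_sign_closed)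
  next
    case (Suc l)
    let ?b = "2 * Suc l"
    define j r' a s' where "j = r mod ?b" "r' = r div ?b" "a = s mod ?b" "s' = s div ?b"
    have bounds: "r' < order_B l" "s' < order_B l" "j < ?b" "a < ?b"
      using Suc.prems by (auto simp: j_r'_a_s'_def less_mult_imp_div_less mult.commute)
    have IH: "s' < r' \<Longrightarrow> pairing n l (Suc m) r' s' = 0" "s' = r' \<Longrightarrow> is_sign (pairing n l (Suc m) r' s')"
      using Suc.IH[of "Suc m" r' s'] Suc.prems bounds by auto
    have rs: "r = j + ?b * r'" "s = a + ?b * s'" unfolding j_r'_a_s'_def by (rule mod_mult_div_eq[symmetric])+
    have "set (nf_word l (Suc m) r') \<subseteq> {Suc m..n}"
      using set_nf_word[of l "Suc m" r'] Suc.prems by auto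
    then obtain c where c: "is_sign c" "app (word_op n (nf_word l (Suc m) r')) (sx m ^ a * box_mono l (Suc m) s') =
        c * (sx m ^ a * pairing n l (Suc m) r' s')"
      unfolding pairing_def using word_op_skew[of "nf_word l (Suc m) r'" m n a] by blast
    have eq: "pairing n (Suc l) m r s =
        c * app (word_op n (tau (Suc l) m j)) (sx m ^ a * pairing n l (Suc m) r' s')"
      using c by (simp add: pairing_def j_r'_a_s'_def is_sign_app del: tau.simps mult_Suc_right)
    have eq_diag: "pairing n (Suc l) m r s =
        c * (pairing n l (Suc m) r' s' * app (word_op n (tau (Suc l) m j)) (sx m ^ a))" if "s' = r'"
      unfolding eq is_sign_commute[OF IH(2)[OF that]] is_sign_app[OF IH(2)[OF that]] ..
    show ?case
    proof (intro conjI impI)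
      assume "s < r"
      then have "s' \<le> r'" unfolding j_r'_a_s'_def by (intro div_le_mono) simp
      moreover have "a < j" if "s' = r'"
        using \<open>s < r\<close> that unfolding rs by simp
      ultimately consider "s' < r'" | "s' = r'" "a < j" by linarith
      then show "pairing n (Suc l) m r s = 0"
      proof cases
        case 1
        then show ?thesis by (simp add: eq IH)
      next
        case 2
        then have "app (word_op n (tau (Suc l) m j)) (sx m ^ a) = 0"
          using tau_power[OF Suc.prems(1) bounds(3), of a] by (auto split: if_splits)
        then show ?thesis using eq_diag[OF 2(1)] by simp
      qed
    next
      assume "s = r"
      then have "s' = r'" "a = j" by (simp_all add: j_r'_a_s'_def)
      then have "is_sign (app (word_op n (tau (Suc l) m j)) (sx m ^ a))"
        using tau_power[OF Suc.prems(1) bounds(3), of a] by auto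
      then show "is_sign (pairing n (Suc l) m r s)"
        unfolding eq_diag[OF \<open>s' = r'\<close>] by (intro is_sign_closed c IH \<open>s' = r'\<close>)
    qed
  qed
  then show "s < r \<Longrightarrow> pairing n l m r s = 0" "s = r \<Longrightarrow> is_sign (pairing n l m r s)" by blast+
qed

text \<open>Triangular systems with diagonal entries \<open>1\<close> or \<open>-1\<close> over a noncommutative ring. The sets \<open>Q\<close>,
  here and in \<open>triangular_right_closed\<close>, record where the unknowns lie; they are instantiated by
  all polynomials in the given variables, by homogeneous parts, and by the zero ideal.\<close>

lemma triangular_solve:
  fixes c :: "nat \<Rightarrow> nat \<Rightarrow> spol"
  assumes "\<And>r s. r < N \<Longrightarrow> s < r \<Longrightarrow> c r s = 0" "\<And>r. r < N \<Longrightarrow> is_sign (c r r)"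
    "\<And>s. s < N \<Longrightarrow> t s \<in> Q s" "\<And>s p q. p \<in> Q s \<Longrightarrow> q \<in> Q s \<Longrightarrow> p - q \<in> Q s"
    "\<And>r s p. r < s \<Longrightarrow> s < N \<Longrightarrow> p \<in> Q r \<Longrightarrow> p * c r s \<in> Q s"
  shows "\<exists>p. (\<forall>r<N. p r \<in> Q r) \<and> (\<forall>s<N. (\<Sum>r<N. p r * c r s) = t s)"
  using assms
proof (induction N)
  case (Suc N)
  have "\<exists>p. (\<forall>r<N. p r \<in> Q r) \<and> (\<forall>s<N. (\<Sum>r<N. p r * c r s) = t s)"
    by (rule Suc.IH) (use Suc.prems in \<open>simp_all add: less_SucI\<close>)
  then obtain p where p: "\<forall>r<N. p r \<in> Q r" "\<forall>s<N. (\<Sum>r<N. p r * c r s) = t s"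
    by blast
  note prems = Suc.prems
  have Q0: "0 \<in> Q s" if "s < Suc N" for s
    using Suc.prems(4)[OF Suc.prems(3)[OF that] Suc.prems(3)[OF that]] by simp
  have Qneg: "- q \<in> Q s" if "q \<in> Q s" "s < Suc N" for q s
    using Suc.prems(4)[OF Q0[OF that(2)] that(1)] by simp
  have Qsum: "(\<Sum>r<k. p r * c r N) \<in> Q N" if "k \<le> N" for k
    using that
  proof (induction k)
    case (Suc k)
    then have "p k * c k N \<in> Q N" using p(1) by (intro prems(5)[of k N]) auto
    from prems(4)[OF _ Qneg[OF this]] Suc show ?case by auto
  qed (simp add: Q0)
  \<comment> \<open>The diagonal entry is its own inverse.\<close>
  define pN where "pN = (t N - (\<Sum>r<N. p r * c r N)) * c N N"
  have d: "c N N = 1 \<or> c N N = - 1" using Suc.prems(2)[of N] by (auto simp: is_sign_def)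
  have "t N - (\<Sum>r<N. p r * c r N) \<in> Q N"
    using Suc.prems(3,4) Qsum by auto
  then have "pN \<in> Q N" using d Qneg[of _ N] unfolding pN_def by fastforce
  moreover have "pN * c N N = t N - (\<Sum>r<N. p r * c r N)"
    using d by (auto simp: pN_def)
  moreover have "c N s = 0" if "s < N" for s using Suc.prems(1) that by blast
  ultimately show ?case using p
    by (intro exI[of _ "p(N := pN)"]) (auto simp: less_Suc_eq)
qed simp

lemma triangular_left_unique:
  fixes c :: "nat \<Rightarrow> nat \<Rightarrow> spol"
  assumes "\<And>r s. r < N \<Longrightarrow> s < r \<Longrightarrow> c r s = 0" "\<And>r. r < N \<Longrightarrow> is_sign (c r r)"
    "\<And>s. s < N \<Longrightarrow> (\<Sum>r<N. p r * c r s) = 0"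
  shows "r < N \<Longrightarrow> p r = 0"
proof (induction r rule: less_induct)
  case (less r)
  have "p i * c i r = (if i = r then p r * c r r else 0)" if "i < N" for i
    using less assms(1)[of i r] that by (cases i r rule: linorder_cases) auto
  then have "(\<Sum>i<N. p i * c i r) = (\<Sum>i<N. if i = r then p r * c r r else 0)"
    by (intro sum.cong) auto
  then have "p r * c r r = 0" using assms(3)[OF less.prems] less.prems by simp
  then show ?case using assms(2)[OF less.prems] by (auto simp: is_sign_def)
qed

lemma triangular_right_closed:
  fixes c :: "nat \<Rightarrow> nat \<Rightarrow> spol"
  assumes "\<And>r s. r < N \<Longrightarrow> s < r \<Longrightarrow> c r s = 0" "\<And>r. r < N \<Longrightarrow> is_sign (c r r)"
    "\<And>r. r < N \<Longrightarrow> (\<Sum>s<N. c r s * l s) \<in> Q r" "\<And>r. r < N \<Longrightarrow> 0 \<in> Q r"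
    "\<And>s p q. p \<in> Q s \<Longrightarrow> q \<in> Q s \<Longrightarrow> p - q \<in> Q s"
    "\<And>r s p. r < s \<Longrightarrow> s < N \<Longrightarrow> p \<in> Q s \<Longrightarrow> c r s * p \<in> Q r"
  shows "r < N \<Longrightarrow> l r \<in> Q r"
proof (induction "N - r" arbitrary: r rule: less_induct)
  case less
  have neg: "- q \<in> Q r" if "q \<in> Q r" for q
    using assms(5)[OF assms(4)[OF less.prems] that] by simp
  have sum: "sum f A \<in> Q r" if "\<And>i. i \<in> A \<Longrightarrow> f i \<in> Q r" for f and A :: "nat set"
    using that
  proof (induction A rule: infinite_finite_induct)
    case (insert x F)
    then show ?case using assms(5)[OF _ neg, of "f x" "sum f F"] by simp
  qed (use assms(4)[OF less.prems] in auto)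
  have "c r s * l s \<in> Q r" if "s \<in> {..<N} - {r}" for s
  proof (cases "s < r")
    case True
    then show ?thesis using assms(1)[OF less.prems True] assms(4)[OF less.prems] by simp
  next
    case False
    then have "l s \<in> Q s" using less that by auto
    then show ?thesis using assms(6)[of r s] False that by auto
  qed
  then have "(\<Sum>s\<in>{..<N} - {r}. c r s * l s) \<in> Q r" by (rule sum)
  moreover have "(\<Sum>s<N. c r s * l s) = c r r * l r + (\<Sum>s\<in>{..<N} - {r}. c r s * l s)"
    using less.prems by (intro sum.remove) auto
  ultimately have "c r r * l r \<in> Q r"
    using assms(5)[OF assms(3)[OF less.prems]] by (metis add_diff_cancel_right')
  then show ?case using assms(2)[OF less.prems] neg[of "- l r"] by (auto simp: is_sign_def)
qed

section \<open>Skew polynomials as a free module over the symmetric ones\<close>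

text \<open>The span of the box monomials over the ring generated by the elementary symmetric polynomials in
  the squares of the same variables.\<close>

inductive_set sym_span :: "nat \<Rightarrow> nat \<Rightarrow> spol set" for l m where
  box_mono: "r < order_B l \<Longrightarrow> box_mono l m r \<in> sym_span l m"
| diff: "p \<in> sym_span l m \<Longrightarrow> q \<in> sym_span l m \<Longrightarrow> p - q \<in> sym_span l m"
| sym: "p \<in> sym_span l m \<Longrightarrow> esym [m..<m + l] k * p \<in> sym_span l m"

lemma order_B_pos: "0 < order_B l" by (induction l) auto

lemma box_mono_0: "box_mono l m 0 = 1" by (induction l arbitrary: m) auto

lemma sym_span_one: "1 \<in> sym_span l m"
  using sym_span.box_mono[OF order_B_pos, of l m] by (simp add: box_mono_0)

lemma sym_span_zero: "0 \<in> sym_span l m"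
  using sym_span.diff[OF sym_span_one sym_span_one] by simp

lemma sym_span_uminus: "p \<in> sym_span l m \<Longrightarrow> - p \<in> sym_span l m"
  using sym_span.diff[OF sym_span_zero] by simp

lemma sym_span_add: "p \<in> sym_span l m \<Longrightarrow> q \<in> sym_span l m \<Longrightarrow> p + q \<in> sym_span l m"
  using sym_span.diff[OF _ sym_span_uminus, of p l m q] by simp

lemma sym_span_sum: "(\<And>i. i \<in> A \<Longrightarrow> f i \<in> sym_span l m) \<Longrightarrow> sum f A \<in> sym_span l m"
  by (induction A rule: infinite_finite_induct) (auto intro: sym_span_zero sym_span_add)

lemma sym_span_is_sign: "is_sign c \<Longrightarrow> p \<in> sym_span l m \<Longrightarrow> c * p \<in> sym_span l m"
  by (auto simp: is_sign_def sym_span_uminus)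

lemma box_mono_Suc:
  "a < 2 * Suc l \<Longrightarrow> box_mono (Suc l) m (a + 2 * Suc l * r) = sx m ^ a * box_mono l (Suc m) r"
  by (simp del: mult_Suc_right)

lemma order_B_Suc_bound: "a < 2 * Suc l \<Longrightarrow> r < order_B l \<Longrightarrow> a + 2 * Suc l * r < order_B (Suc l)"
proof -
  assume "a < 2 * Suc l" "r < order_B l"
  then have "a + 2 * Suc l * r < 2 * Suc l * Suc r" by simp
  also have "\<dots> \<le> 2 * Suc l * order_B l" using \<open>r < order_B l\<close> by (intro mult_le_mono2) simp
  finally show ?thesis by simp
qed

lemma sym_span_monomial:
  "a < 2 * Suc l \<Longrightarrow> r < order_B l \<Longrightarrow> sx m ^ a * box_mono l (Suc m) r \<in> sym_span (Suc l) m"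
  using sym_span.box_mono[OF order_B_Suc_bound, of a l r m] by (simp only: box_mono_Suc)

text \<open>The only box monomials that leave the box are those with \<open>x\<^sub>m\<close> in its highest power; they are reduced by the equation for \<open>x\<^sub>m\<close>.\<close>

lemma sym_span_first_var:
  assumes "p \<in> sym_span (Suc l) m"
  shows "sx m * p \<in> sym_span (Suc l) m"
  using assms
proof induction
  case (box_mono r)
  let ?L = "2 * Suc l"
  define a r' where "a = r mod ?L" "r' = r div ?L"
  then have a: "a < ?L" "r' < order_B l" "box_mono (Suc l) m r = sx m ^ a * box_mono l (Suc m) r'"
    using box_mono by (auto simp: less_mult_imp_div_less mult.commute)
  show ?case
  proof (cases "Suc a < ?L")
    case True
    from sym_span_monomial[OF True a(2)] show ?thesis unfolding a(3) by (simp add: mult.assoc)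
  next
    case False
    let ?is = "[Suc m..<m + Suc l]"
    have lst: "m # ?is = [m..<m + Suc l]" "Suc (length ?is) = Suc l"
      by (simp_all add: upt_conv_Cons del: upt_Suc)
    obtain c where c: "sx m ^ ?L =
        (\<Sum>i \<le> length ?is. c i * (esym (m # ?is) (Suc (length ?is) - i) * sx m ^ (2 * i)))" "\<And>i. is_sign (c i)"
      using sx_power_reduce[of m ?is] unfolding lst(2) is_sign_def by blast
    have "sx m * box_mono (Suc l) m r = sx m ^ ?L * box_mono l (Suc m) r'"
    proof -
      have "?L = Suc a" using False a(1) by linarith
      then show ?thesis unfolding a(3) by (simp only: power_Suc mult.assoc)
    qed
    also have "\<dots> = (\<Sum>i \<le> length ?is. c i * (esym (m # ?is) (Suc (length ?is) - i) *
        (sx m ^ (2 * i) * box_mono l (Suc m) r')))"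
      unfolding c(1) by (simp add: sum_distrib_right mult.assoc del: esym.simps upt_Suc)
    also have "\<dots> \<in> sym_span (Suc l) m"
      unfolding lst(1)
      by (intro sym_span_sum sym_span_is_sign c sym_span.sym sym_span_monomial a) (use lst(2) in auto)
    finally show ?thesis .
  qed
next
  case (sym p k)
  then show ?case by (simp only: esym_left_commute sym_span.sym)
qed (simp_all add: right_diff_distrib sym_span.diff)

lemma sym_span_first_power:
  "p \<in> sym_span (Suc l) m \<Longrightarrow> sx m ^ a * p \<in> sym_span (Suc l) m"
  by (induction a) (simp_all add: mult.assoc sym_span_first_var)

text \<open>Removing a variable from an elementary symmetric polynomial costs only powers of that variable, and the span is closed under those.\<close>

lemma sym_span_Suc:
  assumes "p \<in> sym_span l (Suc m)"
  shows "p \<in> sym_span (Suc l) m"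
  using assms
proof induction
  case (box_mono r)
  then show ?case using sym_span_monomial[of 0 l r m] by simp
next
  case (sym p k)
  have eq: "m # [Suc m..<Suc m + l] = [m..<m + Suc l]" by (simp add: upt_conv_Cons del: upt_Suc)
  have "(- (sx m ^ 2)) ^ i = (- 1) ^ i * sx m ^ (2 * i)" for i
    by (simp add: power_minus[of "sx m ^ 2"] power_mult)
  then have "esym [Suc m..<Suc m + l] k * p =
      (\<Sum>i\<le>k. (- 1) ^ i * (sx m ^ (2 * i) * (esym [m..<m + Suc l] (k - i) * p)))"
    unfolding esym_tail[of "[Suc m..<Suc m + l]" k m] eq by (simp add: sum_distrib_right mult.assoc)
  also have "\<dots> \<in> sym_span (Suc l) m"
  proof (rule sym_span_sum, rule sym_span_is_sign)
    show "is_sign ((- 1) ^ i)" for i by (cases "even i") (simp_all add: is_sign_closed)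
  qed (intro sym_span_first_power sym_span.sym sym)
  finally show ?case .
qed (rule sym_span.diff)

lemma spol_deg_mono: "A \<subseteq> B \<Longrightarrow> spol_deg A d \<subseteq> spol_deg B d"
  unfolding spol_deg_def word_span_def by (intro image_mono Collect_mono impI) (auto 0 4)

lemma spol_deg_power: "p \<in> spol_deg A d \<Longrightarrow> p ^ k \<in> spol_deg A (int k * d)"
proof (induction k)
  case (Suc k)
  then show ?case using spol_deg_closed(6)[of p A d "p ^ k" "int k * d"] by (simp add: algebra_simps)
qed (simp add: spol_deg_closed)

lemma box_mono_deg: "box_mono l m r \<in> spol_deg {m..<m + l} (2 * int (digit_sum l r))"
proof (induction l arbitrary: m r)
  case (Suc l)
  let ?a = "r mod (2 * Suc l)" and ?r = "r div (2 * Suc l)"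
  have "box_mono l (Suc m) ?r \<in> spol_deg {m..<m + Suc l} (2 * int (digit_sum l ?r))"
    using Suc[of "Suc m" ?r] by (rule subsetD[OF spol_deg_mono, rotated]) auto
  moreover have "sx m ^ ?a \<in> spol_deg {m..<m + Suc l} (int ?a * 2)"
    by (intro spol_deg_power spol_deg_closed) auto
  ultimately have "sx m ^ ?a * box_mono l (Suc m) ?r \<in>
      spol_deg {m..<m + Suc l} (int ?a * 2 + 2 * int (digit_sum l ?r))"
    by (intro spol_deg_closed)
  then show ?case by (simp add: algebra_simps del: mult_Suc_right)
qed (simp add: spol_deg_closed)

text \<open>A variable other than the first passes the power of \<open>x\<^sub>m\<close> up to sign and then meets a box
  monomial in fewer variables, to which the induction hypothesis applies.\<close>

theorem spol_in_sym_span: "p \<in> spol_in {m..<m + l} \<Longrightarrow> p \<in> sym_span l m"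
proof (induction l arbitrary: m p)
  case 0
  then show ?case
    by (induction rule: spol_in_induct) (auto simp: sym_span_one intro: sym_span.diff)
next
  case (Suc l)
  have step: "sx i * p \<in> sym_span (Suc l) m" if p: "p \<in> sym_span (Suc l) m" and i: "i \<in> {Suc m..<m + Suc l}" for i p
    using p
  proof induction
    case (box_mono r)
    define a r' where "a = r mod (2 * Suc l)" "r' = r div (2 * Suc l)"
    then have r': "box_mono (Suc l) m r = sx m ^ a * box_mono l (Suc m) r'" by simp
    obtain c where c: "is_sign c" "sx i * sx m ^ a = c * (sx m ^ a * sx i)"
      using sx_powers_commute[of i m 1 a] i by auto
    have "box_mono l (Suc m) r' \<in> spol_in {Suc m..<Suc m + l}"
      using box_mono_deg spol_deg_subset by blast
    then have "sx i * box_mono l (Suc m) r' \<in> spol_in {Suc m..<Suc m + l}"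
      using i by (intro spol_in_closed) auto
    then have "sx i * box_mono l (Suc m) r' \<in> sym_span (Suc l) m"
      by (intro sym_span_Suc Suc.IH)
    then have "c * (sx m ^ a * (sx i * box_mono l (Suc m) r')) \<in> sym_span (Suc l) m"
      by (rule sym_span_is_sign[OF c(1) sym_span_first_power])
    then show ?case
      unfolding r' by (simp add: c(2) flip: mult.assoc)
  next
    case (sym p k)
    then show ?case by (simp only: esym_left_commute sym_span.sym)
  qed (simp_all add: right_diff_distrib sym_span.diff)
  show ?case
    using Suc.prems
  proof (induction rule: spol_in_induct)
    case (var i p)
    then show ?case using sym_span_first_var step by (cases "i = m") auto
  qed (simp_all add: sym_span_one sym_span.diff)
qed

definition sym_spol :: "nat \<Rightarrow> spol set" where
  "sym_spol n = {p \<in> spol_in {1..n}. \<forall>i \<in> {1..n}. app (dop n i) p = 0}"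

lemma sym_spol_subset: "sym_spol n \<subseteq> spol_in {1..n}" by (auto simp: sym_spol_def)

lemma dop_mult_sym_spol: "i \<in> {1..n} \<Longrightarrow> q \<in> sym_spol n \<Longrightarrow> app (dop n i) (p * q) = app (dop n i) p * q"
  by (simp add: sym_spol_def dop_def dem_mult)

lemma sym_spol_closed:
  "0 \<in> sym_spol n" "1 \<in> sym_spol n" "p \<in> sym_spol n \<Longrightarrow> q \<in> sym_spol n \<Longrightarrow> p - q \<in> sym_spol n"
  "p \<in> sym_spol n \<Longrightarrow> q \<in> sym_spol n \<Longrightarrow> p + q \<in> sym_spol n" "p \<in> sym_spol n \<Longrightarrow> - p \<in> sym_spol n"
  "p \<in> sym_spol n \<Longrightarrow> q \<in> sym_spol n \<Longrightarrow> p * q \<in> sym_spol n"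
proof -
  show "0 \<in> sym_spol n" by (simp add: sym_spol_def spol_in_closed)
  show "1 \<in> sym_spol n" by (simp add: sym_spol_def spol_in_closed dop_def)
  assume p: "p \<in> sym_spol n"
  then show "- p \<in> sym_spol n" by (simp add: sym_spol_def spol_in_closed app_uminus)
  assume q: "q \<in> sym_spol n"
  show "p - q \<in> sym_spol n" "p + q \<in> sym_spol n"
    using p q by (simp_all add: sym_spol_def spol_in_closed app_diff app_add)
  show "p * q \<in> sym_spol n"
    using p q dop_mult_sym_spol[OF _ q, of _ p] by (simp add: sym_spol_def spol_in_closed)
qed

lemma sym_spol_sum: "(\<And>a. a \<in> A \<Longrightarrow> f a \<in> sym_spol n) \<Longrightarrow> sum f A \<in> sym_spol n"
  by (induction A rule: infinite_finite_induct) (auto intro: sym_spol_closed)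

lemma word_op_mult_sym_spol:
  "set w \<subseteq> {1..n} \<Longrightarrow> q \<in> sym_spol n \<Longrightarrow> app (word_op n w) (p * q) = app (word_op n w) p * q"
  by (induction w) (auto simp: dop_mult_sym_spol)

lemma esym_spol_in: "set is \<subseteq> A \<Longrightarrow> esym is k \<in> spol_in A"
  by (induction "is" k rule: esym.induct) (auto simp: power2_eq_square intro!: spol_in_closed)

lemma esym_sym_spol: "esym [1..<1 + n] k \<in> sym_spol n"
proof -
  have "app (dop n i) (esym [1..<Suc n] k) = 0" if "i \<in> {1..n}" for i
  proof -
    have "linear_over (dop n i) (esym [1..<Suc n] k)"
      by (rule dop_linear_over_esym) (use that in auto)
    from this[unfolded linear_over_def, rule_format, of 1] show ?thesis
      by (simp add: dop_def del: upt_Suc)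
  qed
  moreover have "esym [1..<Suc n] k \<in> spol_in {1..n}" by (rule esym_spol_in) auto
  ultimately show ?thesis by (simp add: sym_spol_def del: upt_Suc)
qed

lemma sym_spol_coordinates_exist:
  assumes "p \<in> spol_in {1..n}"
  shows "\<exists>c. (\<forall>r. c r \<in> sym_spol n) \<and> p = (\<Sum>r<order_B n. box_mono n 1 r * c r)"
proof -
  have "p \<in> sym_span n 1"
    by (rule spol_in_sym_span) (use assms in \<open>simp add: atLeastLessThanSuc_atLeastAtMost\<close>)
  then show ?thesis
  proof induction
    case (box_mono r)
    then show ?case
      by (intro exI[of _ "\<lambda>s. of_bool (s = r)"])
        (auto simp: sym_spol_closed of_bool_def if_distrib cong: if_cong)
  next
    case (diff p q)
    then obtain c d where "\<forall>r. c r \<in> sym_spol n" "p = (\<Sum>r<order_B n. box_mono n 1 r * c r)"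
      "\<forall>r. d r \<in> sym_spol n" "q = (\<Sum>r<order_B n. box_mono n 1 r * d r)" by blast
    then show ?case
      by (intro exI[of _ "\<lambda>r. c r - d r"]) (auto simp: sym_spol_closed right_diff_distrib sum_subtractf)
  next
    case (sym p k)
    then obtain c where "\<forall>r. c r \<in> sym_spol n" "p = (\<Sum>r<order_B n. box_mono n 1 r * c r)" by blast
    then show ?case
      by (intro exI[of _ "\<lambda>r. esym [1..<1 + n] k * c r"])
        (auto simp: sum_distrib_left esym_left_commute simp del: upt_Suc
          intro!: sym_spol_closed(6) esym_sym_spol[simplified])
  qed
qed

lemma box_mono_1_deg: "box_mono n 1 r \<in> spol_deg {1..n} (2 * int (digit_sum n r))"
  using box_mono_deg[of n 1 r] by (simp add: atLeastLessThanSuc_atLeastAtMost)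

lemma box_mono_1_spol_in: "box_mono n 1 r \<in> spol_in {1..n}"
  using box_mono_1_deg spol_deg_subset by blast

lemma dop_closed:
  assumes "i \<in> {1..n}"
  shows "p \<in> spol_in {1..n} \<Longrightarrow> app (dop n i) p \<in> spol_in {1..n}"
    "p \<in> spol_deg {1..n} d \<Longrightarrow> app (dop n i) p \<in> spol_deg {1..n} (d - 2)"
  using assms unfolding dop_def by (auto intro!: dem_spol_in dem_spol_deg)

lemma word_op_closed:
  assumes "set w \<subseteq> {1..n}"
  shows "p \<in> spol_in {1..n} \<Longrightarrow> app (word_op n w) p \<in> spol_in {1..n}"
    "p \<in> spol_deg {1..n} d \<Longrightarrow> app (word_op n w) p \<in> spol_deg {1..n} (d - 2 * int (length w))"
proof -
  show "app (word_op n w) p \<in> spol_in {1..n}" if "p \<in> spol_in {1..n}"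
    using assms that by (induction w) (auto intro!: dop_closed(1)[simplified])
  show "app (word_op n w) p \<in> spol_deg {1..n} (d - 2 * int (length w))" if "p \<in> spol_deg {1..n} d"
    using assms
  proof (induction w)
    case (Cons i w)
    then have "app (dop n i) (app (word_op n w) p) \<in> spol_deg {1..n} (d - 2 * int (length w) - 2)"
      by (intro dop_closed) auto
    then show ?case by (simp add: algebra_simps)
  qed (use that in simp)
qed

lemma set_nf_word_1: "set (nf_word n 1 r) \<subseteq> {1..n}"
  using set_nf_word[of n 1 r] by auto

lemma pairing_deg:
  "pairing n n 1 r s \<in> spol_deg {1..n} (2 * int (digit_sum n s) - 2 * int (digit_sum n r))"
  using word_op_closed(2)[OF set_nf_word_1 box_mono_1_deg] by (simp add: pairing_def length_nf_word)

lemma pairing_spol_in: "pairing n n 1 r s \<in> spol_in {1..n}"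
  using pairing_deg spol_deg_subset by blast

text \<open>The words are linear over the symmetric polynomials, so applying all of them to \<open>p\<close> gives a
  triangular system for the coordinates. It shows that they are unique, and homogeneous when
  \<open>p\<close> is.\<close>

lemma sym_spol_coordinates_closed:
  assumes c: "\<And>r. r < order_B n \<Longrightarrow> c r \<in> sym_spol n" and p: "p = (\<Sum>r<order_B n. box_mono n 1 r * c r)"
    and r: "r < order_B n"
  shows "p \<in> spol_deg {1..n} d \<Longrightarrow> c r \<in> spol_deg {1..n} (d - 2 * int (digit_sum n r))"
    "p = 0 \<Longrightarrow> c r = 0"
proof -
  have tri: "s < r \<Longrightarrow> pairing n n 1 r s = 0" "is_sign (pairing n n 1 r r)" if "r < order_B n" for r s
    using pairing_triangular[of 1 n n r s] pairing_triangular[of 1 n n r r] that by auto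
  have sys: "(\<Sum>s<order_B n. pairing n n 1 r s * c s) = app (word_op n (nf_word n 1 r)) p" for r
    unfolding p app_sum pairing_def using c by (simp add: word_op_mult_sym_spol[OF set_nf_word_1] del: One_nat_def)
  show "c r \<in> spol_deg {1..n} (d - 2 * int (digit_sum n r))" if "p \<in> spol_deg {1..n} d"
  proof (rule triangular_right_closed[where N = "order_B n" and c = "pairing n n 1" and
        Q = "\<lambda>r. spol_deg {1..n} (d - 2 * int (digit_sum n r))", OF tri])
    fix r s q assume "q \<in> spol_deg {1..n} (d - 2 * int (digit_sum n s))"
    from spol_deg_closed(6)[OF pairing_deg[of n r s] this]
    show "pairing n n 1 r s * q \<in> spol_deg {1..n} (d - 2 * int (digit_sum n r))"
      by (simp add: algebra_simps)
  next
    fix r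
    show "(\<Sum>s<order_B n. pairing n n 1 r s * c s) \<in> spol_deg {1..n} (d - 2 * int (digit_sum n r))"
      unfolding sys using word_op_closed(2)[OF set_nf_word_1 that, of r] by (simp add: length_nf_word)
  qed (use r in \<open>auto intro: spol_deg_closed simp del: One_nat_def\<close>)
  show "c r = 0" if p0: "p = 0"
  proof -
    have "c r \<in> {0}"
      by (rule triangular_right_closed[where N = "order_B n" and c = "pairing n n 1" and
        Q = "\<lambda>r. {0}", OF tri]) (use r p0 sys in \<open>auto simp del: One_nat_def\<close>)
    then show ?thesis by simp
  qed
qed

definition coord :: "nat \<Rightarrow> spol \<Rightarrow> nat \<Rightarrow> spol" where
  "coord n p = (SOME c. (\<forall>r. c r \<in> sym_spol n) \<and> p = (\<Sum>r<order_B n. box_mono n 1 r * c r))"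

lemma coord:
  assumes "p \<in> spol_in {1..n}"
  shows "coord n p r \<in> sym_spol n" "p = (\<Sum>r<order_B n. box_mono n 1 r * coord n p r)"
  using someI_ex[OF sym_spol_coordinates_exist[OF assms]] unfolding coord_def by blast+

lemma coord_unique:
  assumes "\<And>r. r < order_B n \<Longrightarrow> c r \<in> sym_spol n" "r < order_B n"
  shows "coord n (\<Sum>r<order_B n. box_mono n 1 r * c r) r = c r"
proof -
  let ?p = "\<Sum>r<order_B n. box_mono n 1 r * c r"
  have "?p \<in> spol_in {1..n}"
    using assms(1) sym_spol_subset[of n] box_mono_1_spol_in
    by (auto simp: spol_in_def intro!: word_span_sum) (metis spol_in_def spol_in_closed(6) lessThan_iff subsetD)
  note p = coord[OF this]
  have "coord n ?p r - c r = 0"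
  proof (rule sym_spol_coordinates_closed(2)[where c = "\<lambda>r. coord n ?p r - c r" and p = 0])
    show "0 = (\<Sum>r<order_B n. box_mono n 1 r * (coord n ?p r - c r))"
      using p(2) by (simp add: right_diff_distrib sum_subtractf)
  qed (use p assms sym_spol_closed in \<open>auto simp del: One_nat_def\<close>)
  then show ?thesis by simp
qed

lemma coord_deg:
  assumes "p \<in> spol_deg {1..n} d" "r < order_B n"
  shows "coord n p r \<in> spol_deg {1..n} (d - 2 * int (digit_sum n r))"
proof -
  have p: "p \<in> spol_in {1..n}" using assms(1) spol_deg_subset by blast
  show ?thesis
    by (rule sym_spol_coordinates_closed(1)[OF _ coord(2)[OF p] assms(2,1)]) (rule coord(1)[OF p])
qed

section \<open>Normal forms of words in the Demazure generators\<close>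

text \<open>The relations between the \<open>d\<^sub>i\<close> with all signs dropped, except that the squares vanish, which
  \<open>wzero\<close> accounts for. Working with words rather than with
  elements of the algebra makes the search for normal forms purely combinatorial.\<close>

inductive weq :: "nat \<Rightarrow> nat list \<Rightarrow> nat list \<Rightarrow> bool" for n where
  refl: "weq n u u"
| sym: "weq n u v \<Longrightarrow> weq n v u"
| trans: "weq n u v \<Longrightarrow> weq n v w \<Longrightarrow> weq n u w"
| ctx: "weq n u v \<Longrightarrow> weq n (a @ u @ b) (a @ v @ b)"
| far: "1 \<le> i \<Longrightarrow> Suc i < j \<Longrightarrow> j \<le> n \<Longrightarrow> weq n [i, j] [j, i]"
| braid: "1 \<le> i \<Longrightarrow> Suc i < n \<Longrightarrow> weq n [i, Suc i, i] [Suc i, i, Suc i]"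
| braidB: "1 \<le> i \<Longrightarrow> Suc i = n \<Longrightarrow> weq n [n, i, n, i] [i, n, i, n]"

declare weq.trans [trans]

definition wzero :: "nat \<Rightarrow> nat list \<Rightarrow> bool" where
  "wzero n u \<longleftrightarrow> (\<exists>a i b. i \<in> {1..n} \<and> weq n u (a @ [i, i] @ b))"

lemma weq_append: "weq n u v \<Longrightarrow> weq n u' v' \<Longrightarrow> weq n (u @ u') (v @ v')"
  using weq.trans[of n "u @ u'" "v @ u'" "v @ v'"] weq.ctx[of n u v "[]" u'] weq.ctx[of n u' v' v "[]"]
  by simp

lemma weq_Cons: "weq n u v \<Longrightarrow> weq n (i # u) (i # v)"
  using weq_append[OF weq.refl[of n "[i]"]] by simp

lemma wzero_weq: "weq n u v \<Longrightarrow> wzero n v \<Longrightarrow> wzero n u"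
  unfolding wzero_def using weq.trans by blast

lemma wzero_ctx: "wzero n u \<Longrightarrow> wzero n (a @ u @ b)"
proof -
  assume "wzero n u"
  then obtain a' i b' where "i \<in> {1..n}" "weq n u (a' @ [i, i] @ b')" by (auto simp: wzero_def)
  then have "weq n (a @ u @ b) ((a @ a') @ [i, i] @ (b' @ b))"
    using weq.ctx[of n u "a' @ [i, i] @ b'" a b] by simp
  with \<open>i \<in> {1..n}\<close> show ?thesis unfolding wzero_def by blast
qed

lemma wzero_square: "i \<in> {1..n} \<Longrightarrow> wzero n (i # i # u)"
  unfolding wzero_def using weq.refl[of n "[] @ [i, i] @ u"] by (metis append_Cons append_Nil)

lemma weq_pass: "1 \<le> i \<Longrightarrow> set w \<subseteq> {Suc (Suc i)..n} \<Longrightarrow> weq n (i # w) (w @ [i])"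
proof (induction w)
  case (Cons j w)
  have "weq n ([i, j] @ w) ([j, i] @ w)"
    using Cons.prems by (intro weq_append weq.far weq.refl) auto
  moreover have "weq n (j # i # w) (j # w @ [i])" using Cons by (intro weq_Cons) auto
  ultimately show ?case by (auto intro: weq.trans)
qed (simp add: weq.refl)

text \<open>The word vanishes or becomes one of the words \<open>tau\<close> after letters of index above \<open>m\<close> are split off
  on its right: the analogue of a left coset of the parabolic subgroup.\<close>

definition absorbs :: "nat \<Rightarrow> nat \<Rightarrow> nat \<Rightarrow> nat list \<Rightarrow> bool" where
  "absorbs n l m u \<longleftrightarrow> wzero n u \<or>
     (\<exists>j<2 * l. \<exists>e. set e \<subseteq> {Suc m..n} \<and> weq n u (tau l m j @ e))"

lemma absorbs_weq: "weq n u v \<Longrightarrow> absorbs n l m v \<Longrightarrow> absorbs n l m u"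
  unfolding absorbs_def using weq.trans wzero_weq by blast

lemma absorbs_wzero: "wzero n u \<Longrightarrow> absorbs n l m u"
  by (simp add: absorbs_def)

lemma absorbsI: "j < 2 * l \<Longrightarrow> set e \<subseteq> {Suc m..n} \<Longrightarrow> weq n u (tau l m j @ e) \<Longrightarrow> absorbs n l m u"
  by (auto simp: absorbs_def)

lemma absorbs_append:
  assumes "absorbs n l m u" "set e \<subseteq> {Suc m..n}"
  shows "absorbs n l m (u @ e)"
  using assms(1) unfolding absorbs_def
proof (elim disjE exE conjE)
  assume "wzero n u"
  then show "wzero n (u @ e) \<or> (\<exists>j<2 * l. \<exists>e'. set e' \<subseteq> {Suc m..n} \<and> weq n (u @ e) (tau l m j @ e'))"
    using wzero_ctx[of n u "[]" e] by simp
next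
  fix j e' assume "j < 2 * l" "set e' \<subseteq> {Suc m..n}" "weq n u (tau l m j @ e')"
  then show "wzero n (u @ e) \<or> (\<exists>j<2 * l. \<exists>e'. set e' \<subseteq> {Suc m..n} \<and> weq n (u @ e) (tau l m j @ e'))"
    using assms(2) weq_append[OF _ weq.refl, of n u "tau l m j @ e'" e]
    by (intro disjI2 exI[of _ j] conjI exI[of _ "e' @ e"]) auto
qed

lemma tau_0: "tau l m 0 = []" by (cases l) simp_all

lemma set_tau': "m + l = Suc n \<Longrightarrow> set (tau l m j) \<subseteq> {m..n}"
  using set_tau[of l m j] by auto

text \<open>Multiplication by \<open>d\<^sub>m\<close> lengthens the word if it is empty or one letter short of the longest, gives a
  square if it is a single letter or the longest word, and otherwise meets \<open>d\<^bsub>m+1\<^esub> d\<^sub>m\<close> after passing the other letters, so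
  that the braid relation applies.\<close>

lemma absorbs_same:
  assumes "1 \<le> m" "m + l = n" "j < 2 * Suc l"
  shows "absorbs n (Suc l) m (m # tau (Suc l) m j)"
proof -
  have m: "m \<in> {1..n}" using assms by auto
  \<comment> \<open>What happens depends on whether the inner word of smaller rank is absent, empty, longest,
    or in between.\<close>
  consider "j = 0" | "l = 0" "j = 1" | "l > 0" "j = 1" | "l > 0" "j = 2 * l" | "j = 2 * l + 1"
    | "2 \<le> j" "j < 2 * l"
    using assms(3) by fastforce
  then show ?thesis
  proof cases
    case 1
    then have "m # tau (Suc l) m j = tau (Suc l) m 1 @ []" by (simp add: tau_0)
    then show ?thesis by (intro absorbsI[of 1 _ "[]"]) (simp_all add: weq.refl)
  next
    case 2 then show ?thesis by (intro absorbs_wzero) (simp add: wzero_square[OF m])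
  next
    case 3 then show ?thesis by (intro absorbs_wzero) (simp add: wzero_square[OF m] tau_0)
  next
    case 4
    then show ?thesis
      using tau_top[of l m] by (intro absorbsI[of "2 * l + 1" _ "[]"]) (simp_all add: weq.refl)
  next
    case 5 then show ?thesis by (intro absorbs_wzero) (simp add: wzero_square[OF m])
  next
    case 6
    then obtain l' where l': "l = Suc l'" by (cases l) auto
    let ?T = "tau l' (Suc (Suc m)) (j - 2)"
    have tau: "tau (Suc l) m j = ?T @ [Suc m, m]"
      using 6 l' by (simp add: numeral_2_eq_2)
    have T: "set ?T \<subseteq> {Suc (Suc m)..n}" by (rule set_tau') (use assms l' in simp)
    have "weq n (m # tau (Suc l) m j) (?T @ [m] @ [Suc m, m])"
      using weq_append[OF weq_pass[OF assms(1) T] weq.refl[of n "[Suc m, m]"]] unfolding tau by simp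
    also  have "weq n (?T @ [m] @ [Suc m, m]) (?T @ [Suc m, m, Suc m])"
      using weq_append[OF weq.refl[of n ?T] weq.braid[of m n]] assms 6 l' by simp
    finally  have "weq n (m # tau (Suc l) m j) (tau (Suc l) m j @ [Suc m])"
      unfolding tau by simp
    then show ?thesis by (rule absorbsI[rotated 2]) (use assms 6 in auto)
  qed
qed

text \<open>For \<open>i > m\<close> the inner word is that of smaller rank, and appending \<open>d\<^sub>m\<close> preserves the normal form.
  The longest word begins with \<open>d\<^sub>m\<close>. Letters above \<open>m + 1\<close> pass it, while \<open>d\<^bsub>m+1\<^esub>\<close> travels through the
  palindrome by two braid relations, or by the relation of length four when \<open>m + 1 = n\<close>.\<close>

lemma absorbs_tau:
  assumes "1 \<le> m" "m + l = Suc n" "j < 2 * l" "i \<in> {m..n}"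
  shows "absorbs n l m (i # tau l m j)"
  using assms
proof (induction l arbitrary: m i j)
  case (Suc l)
  show ?case
  proof (cases "i = m")
    case True
    then show ?thesis using absorbs_same[of m l n j] Suc.prems by simp
  next
    case False
    then have i: "i \<in> {Suc m..n}" and l: "0 < l" using Suc.prems by auto
    have lift: "absorbs n (Suc l) m (u @ [m])" if u: "absorbs n l (Suc m) u" for u
      using u unfolding absorbs_def
    proof (elim disjE exE conjE)
      assume "wzero n u"
      then show "wzero n (u @ [m]) \<or>
        (\<exists>j<2 * Suc l. \<exists>e. set e \<subseteq> {Suc m..n} \<and> weq n (u @ [m]) (tau (Suc l) m j @ e))"
        using wzero_ctx[of n u "[]" "[m]"] by simp
    next
      fix j e assume *: "j < 2 * l" "set e \<subseteq> {Suc (Suc m)..n}" "weq n u (tau l (Suc m) j @ e)"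
      have "weq n (u @ [m]) ((tau l (Suc m) j @ e) @ [m])"
        by (intro weq_append *(3) weq.refl)
      also  have "weq n ((tau l (Suc m) j @ e) @ [m]) (tau l (Suc m) j @ (m # e))"
        using weq_append[OF weq.refl weq.sym[OF weq_pass[OF Suc.prems(1) *(2)]], of "tau l (Suc m) j"]
        by simp
      finally  have "weq n (u @ [m]) (tau (Suc l) m (Suc j) @ e)"
        using * by simp
      then show "wzero n (u @ [m]) \<or>
        (\<exists>j<2 * Suc l. \<exists>e. set e \<subseteq> {Suc m..n} \<and> weq n (u @ [m]) (tau (Suc l) m j @ e))"
        using * by (intro disjI2 exI[of _ "Suc j"] conjI exI[of _ e]) auto
    qed
    consider "j = 0" | "1 \<le> j" "j \<le> 2 * l" | "j = 2 * l + 1" "i \<noteq> Suc m" | "j = 2 * l + 1" "i = Suc m"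
      using Suc.prems by fastforce
    then show ?thesis
    proof cases
      case 1
      then show ?thesis using i by (intro absorbsI[of 0 _ "[i]"]) (auto simp: tau_0 weq.refl)
    next
      case 2
      have "absorbs n (Suc l) m ((i # tau l (Suc m) (j - 1)) @ [m])"
        by (intro lift Suc.IH) (use Suc.prems 2 i in auto)
      then show ?thesis using 2 by simp
    next
      case 3
      have tau: "tau (Suc l) m j = m # tau l (Suc m) (2 * l - 1) @ [m]" using 3 l by simp
      have "weq n (i # tau (Suc l) m j) (m # i # tau l (Suc m) (2 * l - 1) @ [m])"
        using weq_append[OF weq.sym[OF weq.far[of m i n]] weq.refl] Suc.prems 3 i unfolding tau by simp
      moreover have "absorbs n (Suc l) m ((i # tau l (Suc m) (2 * l - 1)) @ [m])"
        by (intro lift Suc.IH) (use Suc.prems l i in auto)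
      then have "absorbs n (Suc l) m (m # (i # tau l (Suc m) (2 * l - 1)) @ [m])"
        unfolding absorbs_def[of _ _ _ "(i # tau l (Suc m) (2 * l - 1)) @ [m]"]
      proof (elim disjE exE conjE)
        assume "wzero n ((i # tau l (Suc m) (2 * l - 1)) @ [m])"
        from wzero_ctx[OF this, of "[m]" "[]"] show ?thesis by (intro absorbs_wzero) simp
      next
        fix j' e
        assume *: "j' < 2 * Suc l" "set e \<subseteq> {Suc m..n}"
          "weq n ((i # tau l (Suc m) (2 * l - 1)) @ [m]) (tau (Suc l) m j' @ e)"
        have "absorbs n (Suc l) m ((m # tau (Suc l) m j') @ e)"
          using * Suc.prems by (intro absorbs_append absorbs_same) auto
        then show ?thesis using weq_Cons[OF *(3), of m] by (auto intro: absorbs_weq)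
      qed
      ultimately show ?thesis by (auto intro: absorbs_weq)
    next
      case 4
      obtain l' where l': "l = Suc l'" using l by (cases l) auto
      have "weq n (i # tau (Suc l) m j) (tau (Suc l) m j @ [Suc m])"
      proof (cases "l' = 0")
        case True
        then have "tau (Suc l) m j = [m, Suc m, m]" "n = Suc m" using 4 l' Suc.prems by auto
        then show ?thesis using weq.braidB[of m n] Suc.prems 4 by simp
      next
        case False
        let ?T = "tau l' (Suc (Suc m)) (2 * l' - 1)"
        have tau: "tau (Suc l) m j = [m, Suc m] @ ?T @ [Suc m, m]" using 4 l' False by simp
        have T: "set ?T \<subseteq> {Suc (Suc m)..n}" by (rule set_tau') (use Suc.prems l' in simp)
        have br: "weq n [m, Suc m, m] [Suc m, m, Suc m]"
          by (rule weq.braid) (use Suc.prems l' False in auto)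
        have "weq n ([Suc m, m, Suc m] @ ?T @ [Suc m, m]) ([m, Suc m, m] @ ?T @ [Suc m, m])"
          by (intro weq_append weq.refl weq.sym[OF br])
        also  have "weq n ([m, Suc m, m] @ ?T @ [Suc m, m]) ([m, Suc m] @ ?T @ [m, Suc m, m])"
          using weq_append[OF weq.refl[of n "[m, Suc m]"]
              weq_append[OF weq_pass[OF Suc.prems(1) T] weq.refl[of n "[Suc m, m]"]]] by simp
        also  have "weq n ([m, Suc m] @ ?T @ [m, Suc m, m]) ([m, Suc m] @ ?T @ [Suc m, m, Suc m])"
          by (intro weq_append weq.refl br)
        finally  show ?thesis unfolding tau 4(2) by simp
      qed
      then show ?thesis by (rule absorbsI[rotated 2]) (use Suc.prems i 4 in auto)
    qed
  qed
qed simp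

lemma nf_word_closed_list:
  assumes "\<And>i r. i \<in> A \<Longrightarrow> r < N \<Longrightarrow> wzero n (i # f r) \<or> (\<exists>r'<N. weq n (i # f r) (f r'))"
    and "set e \<subseteq> A" "r < N"
  shows "wzero n (e @ f r) \<or> (\<exists>r'<N. weq n (e @ f r) (f r'))"
  using assms(2)
proof (induction e)
  case Nil then show ?case using assms(3) weq.refl by auto
next
  case (Cons i e)
  then consider "wzero n (e @ f r)" | r' where "r' < N" "weq n (e @ f r) (f r')" by auto
  then show ?case
  proof cases
    case 1
    from wzero_ctx[OF this, of "[i]" "[]"] show ?thesis by simp
  next
    case 2
    have "weq n (i # e @ f r) (i # f r')" by (rule weq_Cons[OF 2(2)])
    moreover have "wzero n (i # f r') \<or> (\<exists>r''<N. weq n (i # f r') (f r''))"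
      using assms(1) 2 Cons.prems by auto
    ultimately show ?thesis using wzero_weq weq.trans by (metis append_Cons)
  qed
qed

lemma nf_word_closed:
  assumes "1 \<le> m" "m + l = Suc n" "r < order_B l" "i \<in> {m..n}"
  shows "wzero n (i # nf_word l m r) \<or> (\<exists>r'<order_B l. weq n (i # nf_word l m r) (nf_word l m r'))"
  using assms
proof (induction l arbitrary: m r i)
  case (Suc l)
  let ?b = "2 * Suc l"
  define j r' where "j = r mod ?b" "r' = r div ?b"
  then have jr: "j < ?b" "r' < order_B l" "nf_word (Suc l) m r = tau (Suc l) m j @ nf_word l (Suc m) r'"
    using Suc.prems by (auto simp: less_mult_imp_div_less mult.commute)
  have "absorbs n (Suc l) m (i # tau (Suc l) m j)"
    by (rule absorbs_tau) (use Suc.prems jr in auto)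
  then show ?case
    unfolding absorbs_def jr(3)
  proof (elim disjE exE conjE)
    assume "wzero n (i # tau (Suc l) m j)"
    from wzero_ctx[OF this, of "[]" "nf_word l (Suc m) r'"] show
      "wzero n (i # tau (Suc l) m j @ nf_word l (Suc m) r') \<or>
       (\<exists>r''<order_B (Suc l). weq n (i # tau (Suc l) m j @ nf_word l (Suc m) r') (nf_word (Suc l) m r''))"
      by simp
  next
    fix k e
    assume *: "k < 2 * Suc l" "set e \<subseteq> {Suc m..n}" "weq n (i # tau (Suc l) m j) (tau (Suc l) m k @ e)"
    have eq: "weq n (i # tau (Suc l) m j @ nf_word l (Suc m) r') (tau (Suc l) m k @ e @ nf_word l (Suc m) r')"
      using weq_append[OF *(3) weq.refl[of n "nf_word l (Suc m) r'"]] by simp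
    have "wzero n (e @ nf_word l (Suc m) r') \<or> (\<exists>r''<order_B l. weq n (e @ nf_word l (Suc m) r') (nf_word l (Suc m) r''))"
      by (rule nf_word_closed_list[where A = "{Suc m..n}"]) (use Suc jr * in auto)
    then show "wzero n (i # tau (Suc l) m j @ nf_word l (Suc m) r') \<or>
       (\<exists>r''<order_B (Suc l). weq n (i # tau (Suc l) m j @ nf_word l (Suc m) r') (nf_word (Suc l) m r''))"
    proof (elim disjE exE conjE)
      assume "wzero n (e @ nf_word l (Suc m) r')"
      from wzero_ctx[OF this, of "tau (Suc l) m k" "[]"] wzero_weq[OF eq] show ?thesis by simp
    next
      fix r'' assume r'': "r'' < order_B l" "weq n (e @ nf_word l (Suc m) r') (nf_word l (Suc m) r'')"
      have "nf_word (Suc l) m (k + ?b * r'') = tau (Suc l) m k @ nf_word l (Suc m) r''"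
        using *(1) by (simp del: mult_Suc_right tau.simps)
      moreover have "weq n (tau (Suc l) m k @ e @ nf_word l (Suc m) r') (tau (Suc l) m k @ nf_word l (Suc m) r'')"
        by (intro weq_append weq.refl r'')
      ultimately have "weq n (i # tau (Suc l) m j @ nf_word l (Suc m) r') (nf_word (Suc l) m (k + ?b * r''))"
        using weq.trans[OF eq] by simp
      moreover have "k + ?b * r'' < order_B (Suc l)" by (rule order_B_Suc_bound[OF *(1) r''(1)])
      ultimately show ?thesis by blast
    qed
  qed
qed simp

lemma nf_word_0: "nf_word l m 0 = []"
  by (induction l arbitrary: m) (simp_all add: tau_0 del: tau.simps)

text \<open>The normal forms contain the empty word and are closed under left multiplication by letters.\<close>

theorem word_normal_form:
  assumes "set e \<subseteq> {1..n}"
  shows "wzero n e \<or> (\<exists>r<order_B n. weq n e (nf_word n 1 r))"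
  using nf_word_closed_list[where A = "{1..n}" and N = "order_B n" and f = "nf_word n 1" and r = 0 and e = e and n = n]
    nf_word_closed[of 1 n n] assms order_B_pos[of n] by (auto simp: nf_word_0)

section \<open>The nilHecke algebra is spanned by normally ordered words\<close>

definition fdn :: "nat \<Rightarrow> nat \<Rightarrow> nh_gen free_alg" where
  "fdn n i = (if i = n then fb else fd i)"

definition fword :: "nat \<Rightarrow> nat list \<Rightarrow> nh_gen free_alg" where
  "fword n w = prod_list (map (fdn n) w)"

definition fpol :: "nat free_alg \<Rightarrow> nh_gen free_alg" where
  "fpol = alg_hom fx"

abbreviation nh_ideal :: "nat \<Rightarrow> nh_gen free_alg set" where
  "nh_ideal n \<equiv> two_sided (nh_relations n)"

text \<open>Signs are ignored as in \<open>weq\<close>; the span of the normal forms does not see them.\<close>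

definition eq_upto_sign :: "nat \<Rightarrow> nh_gen free_alg \<Rightarrow> nh_gen free_alg \<Rightarrow> bool" where
  "eq_upto_sign n u v \<longleftrightarrow> u - v \<in> nh_ideal n \<or> u + v \<in> nh_ideal n"

lemma fword_simps [simp]:
  "fword n [] = 1" "fword n (i # w) = fdn n i * fword n w" "fword n (u @ v) = fword n u * fword n v"
  by (simp_all add: fword_def)

lemma eq_upto_sign_trans:
  assumes "eq_upto_sign n u v" "eq_upto_sign n v w"
  shows "eq_upto_sign n u w"
proof -
  have "(u - v) + (v - w) = u - w" "(u - v) + (v + w) = u + w" "(u + v) - (v - w) = u + w"
    "(u + v) - (v + w) = u - w" by simp_all
  then show ?thesis
    using assms two_sided_add[of "u - v" "nh_relations n"] two_sided_diff[of "u + v" "nh_relations n"]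
    unfolding eq_upto_sign_def by metis
qed

lemma eq_upto_sign_sym: "eq_upto_sign n u v \<Longrightarrow> eq_upto_sign n v u"
  unfolding eq_upto_sign_def using two_sided_uminus[of "u - v" "nh_relations n"]
  by (auto simp: add.commute)

lemma eq_upto_sign_mult: "eq_upto_sign n u v \<Longrightarrow> eq_upto_sign n (a * u * b) (a * v * b)"
proof -
  have "a * u * b - a * v * b = a * (u - v) * b" "a * u * b + a * v * b = a * (u + v) * b"
    by (simp_all add: algebra_simps)
  then show "eq_upto_sign n u v \<Longrightarrow> eq_upto_sign n (a * u * b) (a * v * b)"
    unfolding eq_upto_sign_def by (metis two_sided_left two_sided_right)
qed

lemma nh_relationsI:
  "i \<in> {1..<n} \<Longrightarrow> fd i * fd i \<in> nh_relations n"
  "i \<in> {1..<n} \<Longrightarrow> i + 1 \<in> {1..<n} \<Longrightarrow>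
    fd i * fd (i + 1) * fd i - fd (i + 1) * fd i * fd (i + 1) \<in> nh_relations n"
  "i \<in> {1..<n} \<Longrightarrow> j \<in> {1..<n} \<Longrightarrow> i + 1 < j \<Longrightarrow> fd i * fd j + fd j * fd i \<in> nh_relations n"
  "i \<in> {1..<n} \<Longrightarrow> fx i * fd i + fd i * fx (i + 1) - 1 \<in> nh_relations n"
  "i \<in> {1..<n} \<Longrightarrow> fd i * fx i + fx (i + 1) * fd i - 1 \<in> nh_relations n"
  "i \<in> {1..<n} \<Longrightarrow> j \<in> {1..n} \<Longrightarrow> j \<noteq> i \<Longrightarrow> j \<noteq> i + 1 \<Longrightarrow> fd i * fx j + fx j * fd i \<in> nh_relations n"
  "fb * fb \<in> nh_relations n"
  "i \<in> {1..<n} \<Longrightarrow> i = n - 1 \<Longrightarrow> fb * fd i * fb * fd i + fd i * fb * fd i * fb \<in> nh_relations n"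
  "i \<in> {1..<n} \<Longrightarrow> i \<noteq> n - 1 \<Longrightarrow> fb * fd i + fd i * fb \<in> nh_relations n"
  "fb * fx n + fx n * fb - 1 \<in> nh_relations n"
  "i \<in> {1..<n} \<Longrightarrow> fb * fx i + fx i * fb \<in> nh_relations n"
  unfolding nh_relations_def power2_eq_square by blast+

lemma eq_upto_sign_I:
  "u - v \<in> nh_relations n \<Longrightarrow> eq_upto_sign n u v"
  "u + v \<in> nh_relations n \<Longrightarrow> eq_upto_sign n u v"
  by (auto simp: eq_upto_sign_def intro: two_sided_base)

lemma fword_weq: "weq n u v \<Longrightarrow> eq_upto_sign n (fword n u) (fword n v)"
proof (induction rule: weq.induct)
  case (refl u) show ?case by (simp add: eq_upto_sign_def two_sided.zero)
next
  case (sym u v) then show ?case using eq_upto_sign_sym by blast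
next
  case (trans u v w) then show ?case using eq_upto_sign_trans by blast
next
  case (ctx u v a b)
  then show ?case
    using eq_upto_sign_mult[of n "fword n u" "fword n v" "fword n a" "fword n b"]
    by (simp add: mult.assoc)
next
  case (far i j)
  show ?case
  proof (cases "j = n")
    case True
    then have "fb * fd i + fd i * fb \<in> nh_relations n"
      using far by (intro nh_relationsI) auto
    then show ?thesis using True far
      by (intro eq_upto_sign_I(2)) (simp add: fdn_def add.commute)
  next
    case False
    then have "fd i * fd j + fd j * fd i \<in> nh_relations n"
      using far by (intro nh_relationsI) auto
    then show ?thesis using False far
      by (intro eq_upto_sign_I(2)) (simp add: fdn_def)
  qed
next
  case (braid i)
  then have "fd i * fd (i + 1) * fd i - fd (i + 1) * fd i * fd (i + 1) \<in> nh_relations n"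
    by (intro nh_relationsI) auto
  then show ?case using braid
    by (intro eq_upto_sign_I(1)) (simp add: fdn_def mult.assoc)
next
  case (braidB i)
  then have "fb * fd i * fb * fd i + fd i * fb * fd i * fb \<in> nh_relations n"
    by (intro nh_relationsI) auto
  then show ?case using braidB
    by (intro eq_upto_sign_I(2)) (auto simp: fdn_def mult.assoc)
qed

lemma fdn_square: "i \<in> {1..n} \<Longrightarrow> fdn n i * fdn n i \<in> nh_ideal n"
proof (rule two_sided_base)
  assume "i \<in> {1..n}"
  then show "fdn n i * fdn n i \<in> nh_relations n"
    by (cases "i = n") (auto simp: fdn_def intro!: nh_relationsI)
qed

lemma fword_wzero:
  assumes "wzero n u"
  shows "fword n u \<in> nh_ideal n"
proof -
  obtain a i b where i: "i \<in> {1..n}" "weq n u (a @ [i, i] @ b)" using assms by (auto simp: wzero_def)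
  have z: "fword n (a @ [i, i] @ b) \<in> nh_ideal n"
    using two_sided_left[OF two_sided_right[OF fdn_square[OF i(1)]], of "fword n a" "fword n b"]
    by (simp add: mult.assoc)
  have "fword n u - fword n (a @ [i, i] @ b) \<in> nh_ideal n \<or> fword n u + fword n (a @ [i, i] @ b) \<in> nh_ideal n"
    using fword_weq[OF i(2)] by (simp only: eq_upto_sign_def)
  then show ?thesis
    using two_sided_add[OF _ z, of "fword n u - fword n (a @ [i, i] @ b)"]
      two_sided_diff[OF _ z, of "fword n u + fword n (a @ [i, i] @ b)"] by auto
qed

lemma fdn_fx:
  assumes "i \<in> {1..n}" "j \<in> {1..n}"
  shows "fdn n i * fx j + fx (exch i (min (Suc i) n) j) * fdn n i
    - of_bool (j = i \<or> j = min (Suc i) n) \<in> nh_ideal n"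
proof (rule two_sided_base)
  consider "i = n" "j = n" | "i = n" "j < n" | "i < n" "j = i" | "i < n" "j = Suc i"
    | "i < n" "j \<noteq> i" "j \<noteq> Suc i"
    using assms by fastforce
  then show "fdn n i * fx j + fx (exch i (min (Suc i) n) j) * fdn n i
    - of_bool (j = i \<or> j = min (Suc i) n) \<in> nh_relations n"
  proof cases
    case 1
    then show ?thesis using nh_relationsI(10)[of n] by (simp add: fdn_def)
  next
    case 2
    then have "fb * fx j + fx j * fb \<in> nh_relations n"
      using assms by (intro nh_relationsI) auto
    then show ?thesis using 2 by (simp add: fdn_def min_def)
  next
    case 3
    then have "fd i * fx i + fx (i + 1) * fd i - 1 \<in> nh_relations n"
      using assms by (intro nh_relationsI) auto
    then show ?thesis using 3 by (simp add: fdn_def min_def)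
  next
    case 4
    then have "fx i * fd i + fd i * fx (i + 1) - 1 \<in> nh_relations n"
      using assms by (intro nh_relationsI) auto
    then show ?thesis using 4 by (simp add: fdn_def min_def add.commute)
  next
    case 5
    then have "fd i * fx j + fx j * fd i \<in> nh_relations n"
      using assms by (intro nh_relationsI) auto
    then show ?thesis using 5 by (simp add: fdn_def min_def)
  qed
qed

lemma fpol_simps:
  "fpol (gen j) = fx j" "fpol 1 = 1" "fpol 0 = 0" "fpol (p - q) = fpol p - fpol q"
  "fpol (p + q) = fpol p + fpol q" "fpol (p * q) = fpol p * fpol q" "fpol (- p) = - fpol p"
  by (simp_all add: fpol_def alg_hom_diff alg_hom_add alg_hom_mult alg_hom_uminus)

abbreviation free_pol :: "nat \<Rightarrow> nat free_alg set" where
  "free_pol n \<equiv> {f. Poly_Mapping.keys f \<subseteq> lists {1..n}}"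

lemma free_pol_closed:
  "0 \<in> free_pol n" "1 \<in> free_pol n"
  "p \<in> free_pol n \<Longrightarrow> q \<in> free_pol n \<Longrightarrow> p + q \<in> free_pol n"
  "p \<in> free_pol n \<Longrightarrow> q \<in> free_pol n \<Longrightarrow> p - q \<in> free_pol n"
  "p \<in> free_pol n \<Longrightarrow> q \<in> free_pol n \<Longrightarrow> p * q \<in> free_pol n"
  "p \<in> free_pol n \<Longrightarrow> - p \<in> free_pol n"
  "i \<in> {1..n} \<Longrightarrow> gen i \<in> free_pol n"
  using keys_add_lists[of p "lists {1..n}" q] keys_diff_lists[of p "lists {1..n}" q]
    keys_mult_lists[of p "{1..n}" q] keys_gen[of i "{1..n}"] keys_one_lists
  by simp_all

lemma free_pol_induct [consumes 1, case_names one var diff]: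
  assumes "p \<in> free_pol n" "P 1" "\<And>i p. i \<in> {1..n} \<Longrightarrow> p \<in> free_pol n \<Longrightarrow> P p \<Longrightarrow> P (gen i * p)"
    "\<And>p q. P p \<Longrightarrow> P q \<Longrightarrow> P (p - q)"
  shows "P p"
proof -
  have "P (prod_list (map gen w)) \<and> prod_list (map gen w) \<in> free_pol n" if "w \<in> lists {1..n}" for w
    using that
  proof induction
    case Nil
    show ?case using assms(2) free_pol_closed(2)[of n] by simp
  next
    case (Cons i w)
    then show ?case
      using assms(3)[of i "prod_list (map gen w)"]
        free_pol_closed(5)[OF free_pol_closed(7)[of i n], of "prod_list (map gen w)"] by simp
  qed
  note w = this
  have "Poly_Mapping.keys p \<subseteq> lists {1..n}" using assms(1) by simp
  then show ?thesis
  proof (induction p rule: free_alg_induct)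
    case zero
    show ?case using assms(4)[OF assms(2,2)] by simp
  qed (use w in \<open>simp_all add: assms(4) single_eq_prod_gen\<close>)
qed

text \<open>A Demazure generator passes a polynomial at the cost of a correction without that generator, by induction over the variables.\<close>

lemma fdn_fpol:
  assumes "i \<in> {1..n}" "p \<in> free_pol n"
  shows "\<exists>p' \<in> free_pol n. \<exists>p'' \<in> free_pol n.
    fdn n i * fpol p - (fpol p' + fpol p'' * fdn n i) \<in> nh_ideal n"
  using assms(2)
proof (induction rule: free_pol_induct)
  case one
  show ?case
    by (intro bexI[of _ 0] bexI[of _ 1]) (simp_all add: free_pol_closed fpol_simps two_sided.zero)
next
  case (var j p)
  then obtain p' p'' where p: "p' \<in> free_pol n" "p'' \<in> free_pol n"
    "fdn n i * fpol p - (fpol p' + fpol p'' * fdn n i) \<in> nh_ideal n" by blast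
  define k where "k = exch i (min (Suc i) n) j"
  define b :: bool where "b \<longleftrightarrow> j = i \<or> j = min (Suc i) n"
  have k: "k \<in> {1..n}" using assms(1) var(1) by (auto simp: k_def exch_def)
  \<comment> \<open>\<open>d\<^sub>i x\<^sub>j p = b p - x\<^sub>k d\<^sub>i p\<close>, and \<open>d\<^sub>i p\<close> is known by induction.\<close>
  have 1: "(fdn n i * fx j + fx k * fdn n i - of_bool b) * fpol p \<in> nh_ideal n"
    using fdn_fx[OF assms(1) var(1)] unfolding k_def b_def by (rule two_sided_right)
  have 2: "fx k * (fdn n i * fpol p - (fpol p' + fpol p'' * fdn n i)) \<in> nh_ideal n"
    using p(3) by (rule two_sided_left)
  have "fdn n i * fpol (gen j * p) -
      (fpol ((if b then p else 0) - gen k * p') + fpol (- (gen k * p'')) * fdn n i) \<in> nh_ideal n"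
    using two_sided_diff[OF 1 2] by (cases b) (simp_all add: fpol_simps algebra_simps)
  moreover have "(if b then p else 0) - gen k * p' \<in> free_pol n"
    by (intro free_pol_closed k p) (use var free_pol_closed(1) in auto)
  moreover have "- (gen k * p'') \<in> free_pol n" by (intro free_pol_closed k p)
  ultimately show ?case by blast
next
  case (diff p q)
  then obtain p' p'' q' q'' where *: "p' \<in> free_pol n" "p'' \<in> free_pol n"
    "fdn n i * fpol p - (fpol p' + fpol p'' * fdn n i) \<in> nh_ideal n"
    "q' \<in> free_pol n" "q'' \<in> free_pol n"
    "fdn n i * fpol q - (fpol q' + fpol q'' * fdn n i) \<in> nh_ideal n" by blast
  have "fdn n i * fpol (p - q) - (fpol (p' - q') + fpol (p'' - q'') * fdn n i) \<in> nh_ideal n"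
    using two_sided_diff[OF *(3,6)] by (simp add: fpol_simps algebra_simps)
  then show ?case
    by (rule bexI[OF bexI[OF _ free_pol_closed(4)[OF *(2,5)]] free_pol_closed(4)[OF *(1,4)]])
qed

definition ordered_span :: "nat \<Rightarrow> nh_gen free_alg set" where
  "ordered_span n = {u. \<exists>p. (\<forall>r. p r \<in> free_pol n) \<and>
     u - (\<Sum>r<order_B n. fpol (p r) * fword n (nf_word n 1 r)) \<in> nh_ideal n}"

lemma ordered_spanI:
  assumes "\<And>r. p r \<in> free_pol n"
    "u - (\<Sum>r<order_B n. fpol (p r) * fword n (nf_word n 1 r)) \<in> nh_ideal n"
  shows "u \<in> ordered_span n"
  unfolding ordered_span_def using assms by (intro CollectI exI[of _ p]) simp

lemma ordered_spanE:
  assumes "u \<in> ordered_span n"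
  obtains p where "\<And>r. p r \<in> free_pol n"
    "u - (\<Sum>r<order_B n. fpol (p r) * fword n (nf_word n 1 r)) \<in> nh_ideal n"
proof -
  from assms(1) obtain p where p: "\<forall>r. p r \<in> free_pol n"
    "u - (\<Sum>r<order_B n. fpol (p r) * fword n (nf_word n 1 r)) \<in> nh_ideal n"
    unfolding ordered_span_def by (elim CollectE exE conjE)
  show thesis by (rule that[of p]) (rule p(1)[rule_format], rule p(2))
qed

lemma ordered_span_diff:
  assumes "u \<in> ordered_span n" "v \<in> ordered_span n"
  shows "u - v \<in> ordered_span n"
proof -
  obtain p where p: "\<And>r. p r \<in> free_pol n"
    "u - (\<Sum>r<order_B n. fpol (p r) * fword n (nf_word n 1 r)) \<in> nh_ideal n"
    by (rule ordered_spanE[OF assms(1)]) (rule that)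
  obtain q where q: "\<And>r. q r \<in> free_pol n"
    "v - (\<Sum>r<order_B n. fpol (q r) * fword n (nf_word n 1 r)) \<in> nh_ideal n"
    by (rule ordered_spanE[OF assms(2)]) (rule that)
  have "u - v - (\<Sum>r<order_B n. fpol (p r - q r) * fword n (nf_word n 1 r)) \<in> nh_ideal n"
    using two_sided_diff[OF p(2) q(2)]
    by (simp add: fpol_simps left_diff_distrib sum_subtractf algebra_simps)
  then show ?thesis by (rule ordered_spanI[rotated]) (intro free_pol_closed(4) p(1) q(1))
qed

lemma ordered_span_ideal: "u \<in> nh_ideal n \<Longrightarrow> u \<in> ordered_span n"
  unfolding ordered_span_def
  by (intro CollectI exI[of _ "\<lambda>_. 0"]) (simp add: fpol_simps)

lemma ordered_span_add: "u \<in> ordered_span n \<Longrightarrow> v \<in> ordered_span n \<Longrightarrow> u + v \<in> ordered_span n"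
  using ordered_span_diff[OF _ ordered_span_diff[OF ordered_span_ideal[OF two_sided.zero]], of u n v]
  by simp

lemma ordered_span_cong: "v \<in> ordered_span n \<Longrightarrow> u - v \<in> nh_ideal n \<Longrightarrow> u \<in> ordered_span n"
  using ordered_span_add[OF ordered_span_ideal, of "u - v" n v] by simp

lemma ordered_span_sum: "(\<And>i. i \<in> A \<Longrightarrow> f i \<in> ordered_span n) \<Longrightarrow> sum f A \<in> ordered_span n"
  by (induction A rule: infinite_finite_induct)
    (auto intro: ordered_span_add ordered_span_ideal two_sided.zero)

lemma ordered_span_fpol:
  assumes "u \<in> ordered_span n" "q \<in> free_pol n"
  shows "fpol q * u \<in> ordered_span n"
proof -
  obtain p where *: "\<And>r. p r \<in> free_pol n"
    "u - (\<Sum>r<order_B n. fpol (p r) * fword n (nf_word n 1 r)) \<in> nh_ideal n"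
    by (rule ordered_spanE[OF assms(1)]) (rule that)
  have "fpol q * u - (\<Sum>r<order_B n. fpol (q * p r) * fword n (nf_word n 1 r)) \<in> nh_ideal n"
    using two_sided_left[OF *(2), of "fpol q"]
    by (simp add: fpol_simps right_diff_distrib sum_distrib_left mult.assoc)
  then show ?thesis by (rule ordered_spanI[rotated]) (intro free_pol_closed(5) assms(2) *(1))
qed

lemma ordered_span_basis: "r < order_B n \<Longrightarrow> fword n (nf_word n 1 r) \<in> ordered_span n"
  unfolding ordered_span_def
proof (intro CollectI exI[of _ "\<lambda>s. if s = r then 1 else 0"] conjI allI)
  assume "r < order_B n"
  then have "(\<Sum>s<order_B n. fpol (if s = r then 1 else 0) * fword n (nf_word n 1 s)) = fword n (nf_word n 1 r)"
    by (simp add: fpol_simps if_distrib[of fpol] if_distrib[of "\<lambda>x. x * _"] sum.delta cong: if_cong)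
  then show "fword n (nf_word n 1 r) - (\<Sum>s<order_B n. fpol (if s = r then 1 else 0) * fword n (nf_word n 1 s)) \<in> nh_ideal n"
    by (simp add: two_sided.zero)
qed (use free_pol_closed in auto)

lemma ordered_span_fword:
  assumes "set e \<subseteq> {1..n}"
  shows "fword n e \<in> ordered_span n"
  using word_normal_form[OF assms]
proof (elim disjE exE conjE)
  assume "wzero n e"
  then show ?thesis by (intro ordered_span_ideal fword_wzero)
next
  fix r assume r: "r < order_B n" "weq n e (nf_word n 1 r)"
  note b = ordered_span_basis[OF r(1)]
  from fword_weq[OF r(2)] show ?thesis
    unfolding eq_upto_sign_def
  proof
    assume "fword n e - fword n (nf_word n 1 r) \<in> nh_ideal n"
    with b show ?thesis by (rule ordered_span_cong)
  next
    assume "fword n e + fword n (nf_word n 1 r) \<in> nh_ideal n"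
    from ordered_span_diff[OF ordered_span_ideal[OF this] b] show ?thesis by simp
  qed
qed

lemma ordered_span_fdn:
  assumes "u \<in> ordered_span n" "i \<in> {1..n}"
  shows "fdn n i * u \<in> ordered_span n"
proof -
  obtain p where *: "\<And>r. p r \<in> free_pol n"
    "u - (\<Sum>r<order_B n. fpol (p r) * fword n (nf_word n 1 r)) \<in> nh_ideal n"
    by (rule ordered_spanE[OF assms(1)]) (rule that)
  have "fdn n i * (fpol (p r) * fword n (nf_word n 1 r)) \<in> ordered_span n" for r
  proof -
    obtain p' p'' where p: "p' \<in> free_pol n" "p'' \<in> free_pol n"
      "fdn n i * fpol (p r) - (fpol p' + fpol p'' * fdn n i) \<in> nh_ideal n"
      using fdn_fpol[OF assms(2) *(1)[of r]] by (elim bexE)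
    have "fpol p' * fword n (nf_word n 1 r) + fpol p'' * fword n (i # nf_word n 1 r) \<in> ordered_span n"
      using set_nf_word_1[of n r] assms(2)
      by (intro ordered_span_add ordered_span_fpol ordered_span_fword p) auto
    then show ?thesis
      by (rule ordered_span_cong)
        (use two_sided_right[OF p(3), of "fword n (nf_word n 1 r)"] in \<open>simp add: algebra_simps\<close>)
  qed
  then have "(\<Sum>r<order_B n. fdn n i * (fpol (p r) * fword n (nf_word n 1 r))) \<in> ordered_span n"
    by (rule ordered_span_sum)
  then show ?thesis
    by (rule ordered_span_cong)
      (use two_sided_left[OF *(2), of "fdn n i"] in \<open>simp add: right_diff_distrib sum_distrib_left\<close>)
qed

text \<open>The span contains the unit and is closed under left multiplication by all generators.\<close>

theorem nh_ordered_span: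
  assumes "Poly_Mapping.keys u \<subseteq> lists (nh_gens n)" "n \<ge> 1"
  shows "u \<in> ordered_span n"
proof -
  have w: "prod_list (map gen w) \<in> ordered_span n" if "w \<in> lists (nh_gens n)" for w
    using that
  proof induction
    case Nil
    show ?case using ordered_span_fword[of "[]" n] by simp
  next
    case (Cons g w)
    from Cons(1) consider i where "g = GenX i" "i \<in> {1..n}" | i where "g = GenD i" "i \<in> {1..<n}" | "g = GenB"
      by (auto simp: nh_gens_def)
    then show ?case
    proof cases
      case 1
      then show ?thesis using ordered_span_fpol[OF Cons.IH free_pol_closed(7)[of i n]]
        by (simp add: fpol_simps)
    next
      case 2
      then show ?thesis using ordered_span_fdn[OF Cons.IH, of i] by (simp add: fdn_def)
    next
      case 3
      then show ?thesis using ordered_span_fdn[OF Cons.IH, of n] assms(2) by (simp add: fdn_def)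
    qed
  qed
  show ?thesis
    using assms(1)
    by (induction u rule: free_alg_induct)
      (auto simp: single_eq_prod_gen intro: w ordered_span_diff ordered_span_ideal two_sided.zero)
qed


section \<open>The action on skew polynomials\<close>

fun gen_op :: "nat \<Rightarrow> nh_gen \<Rightarrow> spol endo" where
  "gen_op n (GenX i) = var_op i"
| "gen_op n (GenD i) = dem i (Suc i)"
| "gen_op n GenB = dem n n"

definition act :: "nat \<Rightarrow> nh_gen free_alg \<Rightarrow> spol endo" where
  "act n = alg_hom (gen_op n)"

lemma act_simps:
  "act n (u + v) = act n u + act n v" "act n (u - v) = act n u - act n v"
  "act n (u * v) = act n u * act n v" "act n 0 = 0" "act n 1 = 1" "act n (gen g) = gen_op n g"
  "act n (u ^ k) = act n u ^ k"
  by (simp_all add: act_def alg_hom_add alg_hom_diff alg_hom_mult alg_hom_power)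

lemma var_op_anticommute: "i \<noteq> j \<Longrightarrow> var_op i * var_op j + var_op j * var_op i = 0"
  by (rule endo_eqI) (simp add: sx_anticommute[of i j] flip: mult.assoc)

lemma act_relations:
  assumes "r \<in> nh_relations n" "n \<ge> 1"
  shows "act n r = 0"
proof -
  have far: "dem i (Suc i) * dem j (Suc j) + dem j (Suc j) * dem i (Suc i) = 0"
    if "i + 1 < j \<or> j + 1 < i" for i j
    using that by (intro dem_anticommute) auto
  have braid: "dem i (Suc i) * dem (Suc i) (Suc (Suc i)) * dem i (Suc i) -
      dem (Suc i) (Suc (Suc i)) * dem i (Suc i) * dem (Suc i) (Suc (Suc i)) = 0" for i
    by (rule dem_braid) auto
  have farB: "dem n n * dem i (Suc i) + dem i (Suc i) * dem n n = 0" if "Suc i < n" for i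
    using that by (intro dem_anticommute) auto
  have braidB: "dem n n * dem (n - Suc 0) n * dem n n * dem (n - Suc 0) n +
      dem (n - Suc 0) n * dem n n * dem (n - Suc 0) n * dem n n = 0"
    using dem_braid_B[of "n - Suc 0" n] assms(2) by simp
  show ?thesis
    using assms(1) unfolding nh_relations_def
    by (elim UnE; clarsimp simp: act_simps var_op_anticommute power2_eq_square dem_square
        dem_var_op far braid farB braidB)
qed

lemma act_ideal: "n \<ge> 1 \<Longrightarrow> u \<in> nh_ideal n \<Longrightarrow> act n u = 0"
  unfolding act_def by (erule alg_hom_two_sided) (use act_relations in \<open>auto simp: act_def\<close>)

lemma act_fdn: "i \<in> {1..n} \<Longrightarrow> act n (fdn n i) = dop n i"
  by (cases "i = n") (auto simp: act_simps fdn_def dop_def)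

lemma act_fword: "set w \<subseteq> {1..n} \<Longrightarrow> act n (fword n w) = word_op n w"
  by (induction w) (simp_all add: act_simps act_fdn)

lemma act_fpol: "app (act n (fpol f)) q = cls f * q"
proof -
  have "act n (fpol f) = alg_hom var_op f"
    by (rule hom_eq_alg_hom[where A = UNIV]) (simp_all add: act_simps fpol_simps)
  moreover have "left_mult (cls f) = alg_hom var_op f"
    by (rule hom_eq_alg_hom[where A = UNIV])
      (auto simp: cls_simps var_op_def sx_def algebra_simps intro!: endo_eqI)
  ultimately show ?thesis by (metis app_left_mult)
qed

text \<open>Rewriting \<open>1\<close> to \<open>Suc 0\<close> would prevent facts about \<open>{1..n}\<close> from matching.\<close>

declare One_nat_def [simp del]

section \<open>Presented algebras through their free cover\<close>

lemma presented_ideal: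
  assumes "\<And>r. r \<in> R \<Longrightarrow> Poly_Mapping.keys r \<subseteq> lists A"
  shows "ideal (genideal (free_algebra A) R) (free_algebra A)"
  using ring.genideal_ideal[OF ring_free_algebra, of R A] assms by auto

text \<open>When all relations involve only the given generators, the retraction fixes them.\<close>

lemma genideal_eq_two_sided:
  assumes "\<And>r. r \<in> R \<Longrightarrow> Poly_Mapping.keys r \<subseteq> lists A"
  shows "genideal (free_algebra A) R = carrier (free_algebra A) \<inter> two_sided R"
proof (rule genideal_free_algebra)
  fix r assume "r \<in> R"
  have "id r = alg_hom (\<lambda>a. if a \<in> A then gen a else 0) r"
    by (rule hom_eq_alg_hom[where A = A]) (use assms \<open>r \<in> R\<close> in auto)
  then show "alg_hom (\<lambda>a. if a \<in> A then gen a else 0) r \<in> insert 0 R"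
    using \<open>r \<in> R\<close> by simp
qed (use assms in auto)

lemma presented_ring:
  assumes "\<And>r. r \<in> R \<Longrightarrow> Poly_Mapping.keys r \<subseteq> lists A"
  shows "ring (presented_algebra A R)"
  unfolding presented_algebra_def by (rule ideal.quotient_is_ring[OF presented_ideal[OF assms]])

lemma presented_class_hom:
  assumes "\<And>r. r \<in> R \<Longrightarrow> Poly_Mapping.keys r \<subseteq> lists A"
  shows "presented_class A R \<in> ring_hom (free_algebra A) (presented_algebra A R)"
  using ideal.rcos_ring_hom[OF presented_ideal[OF assms]]
  unfolding presented_algebra_def presented_class_def[abs_def] .

lemma presented_carrier:
  "carrier (presented_algebra A R) = presented_class A R ` carrier (free_algebra A)"
  unfolding presented_algebra_def presented_class_def[abs_def] FactRing_def A_RCOSETS_def' by auto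

lemma presented_class_eq_iff:
  assumes "\<And>r. r \<in> R \<Longrightarrow> Poly_Mapping.keys r \<subseteq> lists A"
    "f \<in> carrier (free_algebra A)" "g \<in> carrier (free_algebra A)"
  shows "presented_class A R f = presented_class A R g \<longleftrightarrow> f - g \<in> genideal (free_algebra A) R"
  using ring.quotient_eq_iff_same_a_r_cos[OF ring_free_algebra presented_ideal[OF assms(1)] assms(2,3)]
  unfolding presented_class_def by (simp add: a_minus_free_algebra[OF assms(2,3)])


section \<open>The polynomial ring and its operators inside the type of skew polynomials\<close>

lemma pol_relations_keys: "r \<in> pol_relations n \<Longrightarrow> Poly_Mapping.keys r \<subseteq> lists {1..n}"
  unfolding pol_relations_def
  by (elim CollectE exE conjE, hypsubst) (intro keys_add_lists keys_mult_lists keys_gen; assumption)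

text \<open>The retraction kills the relations that involve a variable of index outside \<open>{1..n}\<close>; so \<open>Pol n\<close> embeds into the skew polynomials in all variables.\<close>

lemma pol_ideal:
  "genideal (free_algebra {1..n}) (pol_relations n) = free_pol n \<inter> two_sided skew_relations"
  unfolding free_algebra_simps(1)[symmetric]
proof (rule genideal_free_algebra)
  show "pol_relations n \<subseteq> skew_relations" by (auto simp: pol_relations_def skew_relations_def)
  fix r assume "r \<in> skew_relations"
  then obtain i j where r: "r = gen i * gen j + gen j * gen i" "i \<noteq> j"
    by (auto simp: skew_relations_def)
  show "alg_hom (\<lambda>a. if a \<in> {1..n} then gen a else 0) r \<in> insert 0 (pol_relations n)"
    using r(2) unfolding r(1)
    by (cases "i \<in> {1..n} \<and> j \<in> {1..n}") (auto simp: alg_hom_add alg_hom_mult pol_relations_def)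
qed (rule pol_relations_keys)

definition pcls :: "nat \<Rightarrow> nat free_alg \<Rightarrow> pol" where
  "pcls n = presented_class {1..n} (pol_relations n)"

lemma pcls_eq_iff:
  assumes "f \<in> free_pol n" "g \<in> free_pol n"
  shows "pcls n f = pcls n g \<longleftrightarrow> cls f = cls g"
  using presented_class_eq_iff[of "pol_relations n" "{1..n}" f g, OF pol_relations_keys] assms
    keys_diff_lists[of f "lists {1..n}" g]
  unfolding pcls_def pol_ideal cls_eq_iff by simp

lemma carrier_Pol: "carrier (Pol n) = pcls n ` free_pol n"
  unfolding Pol_def pcls_def presented_carrier by simp

lemma ring_Pol: "ring (Pol n)"
  unfolding Pol_def by (rule presented_ring[OF pol_relations_keys])

definition val :: "nat \<Rightarrow> pol \<Rightarrow> spol" where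
  "val n a = cls (SOME f. f \<in> free_pol n \<and> pcls n f = a)"

lemma val_pcls: "f \<in> free_pol n \<Longrightarrow> val n (pcls n f) = cls f"
  unfolding val_def by (rule someI2[of _ f]) (use pcls_eq_iff in blast)+

lemma spol_in_eq: "spol_in {1..n} = cls ` free_pol n"
  by (simp add: spol_in_def word_span_def)

lemma bij_val: "bij_betw (val n) (carrier (Pol n)) (spol_in {1..n})"
proof (rule bij_betw_imageI)
  show "inj_on (val n) (carrier (Pol n))"
  proof (rule inj_onI)
    fix a b assume "a \<in> carrier (Pol n)" "b \<in> carrier (Pol n)" and eq: "val n a = val n b"
    then obtain f g where f: "f \<in> free_pol n" "a = pcls n f" and g: "g \<in> free_pol n" "b = pcls n g"
      unfolding carrier_Pol by (elim imageE)
    show "a = b"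
      using eq pcls_eq_iff[OF f(1) g(1)] by (simp only: f(2) g(2) val_pcls[OF f(1)] val_pcls[OF g(1)])
  qed
  show "val n ` carrier (Pol n) = spol_in {1..n}"
    unfolding carrier_Pol spol_in_eq image_image by (rule image_cong) (simp_all only: val_pcls)
qed

definition pol_of :: "nat \<Rightarrow> spol \<Rightarrow> pol" where
  "pol_of n = inv_into (carrier (Pol n)) (val n)"

lemma val_in: "a \<in> carrier (Pol n) \<Longrightarrow> val n a \<in> spol_in {1..n}"
  using bij_val bij_betwE by blast

lemma pol_of_in: "p \<in> spol_in {1..n} \<Longrightarrow> pol_of n p \<in> carrier (Pol n)"
  unfolding pol_of_def using bij_val[of n] by (metis bij_betw_def inv_into_into)

lemma pol_of_val [simp]: "a \<in> carrier (Pol n) \<Longrightarrow> pol_of n (val n a) = a"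
  unfolding pol_of_def using bij_betw_inv_into_left[OF bij_val] .

lemma val_pol_of [simp]: "p \<in> spol_in {1..n} \<Longrightarrow> val n (pol_of n p) = p"
  unfolding pol_of_def using bij_betw_inv_into_right[OF bij_val] .

lemma val_eqI: "a \<in> carrier (Pol n) \<Longrightarrow> b \<in> carrier (Pol n) \<Longrightarrow> val n a = val n b \<Longrightarrow> a = b"
  by (metis pol_of_val)

lemma val_hom:
  "val n \<one>\<^bsub>Pol n\<^esub> = 1" "val n \<zero>\<^bsub>Pol n\<^esub> = 0"
  "a \<in> carrier (Pol n) \<Longrightarrow> b \<in> carrier (Pol n) \<Longrightarrow> val n (a \<oplus>\<^bsub>Pol n\<^esub> b) = val n a + val n b"
  "a \<in> carrier (Pol n) \<Longrightarrow> b \<in> carrier (Pol n) \<Longrightarrow> val n (a \<otimes>\<^bsub>Pol n\<^esub> b) = val n a * val n b"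
  "a \<in> carrier (Pol n) \<Longrightarrow> val n (\<ominus>\<^bsub>Pol n\<^esub> a) = - val n a"
proof -
  interpret ring "Pol n" by (rule ring_Pol)
  have hom: "pcls n \<in> ring_hom (free_algebra {1..n}) (Pol n)"
    unfolding pcls_def Pol_def by (rule presented_class_hom[OF pol_relations_keys])
  show "val n \<one>\<^bsub>Pol n\<^esub> = 1"
    using ring_hom_one[OF hom] val_pcls[OF free_pol_closed(2)[of n]] by (simp add: cls_simps)
  have add: "val n (a \<oplus>\<^bsub>Pol n\<^esub> b) = val n a + val n b"
    if ab: "a \<in> carrier (Pol n)" "b \<in> carrier (Pol n)" for a b
  proof -
    obtain f g where f: "f \<in> free_pol n" "a = pcls n f" and g: "g \<in> free_pol n" "b = pcls n g"
      using ab unfolding carrier_Pol by (elim imageE)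
    then have "a \<oplus>\<^bsub>Pol n\<^esub> b = pcls n (f + g)"
      using ring_hom_add[OF hom, of f g] by simp
    then show ?thesis
      by (simp only: val_pcls[OF free_pol_closed(3)[OF f(1) g(1)]] cls_simps f(2) g(2)
          val_pcls[OF f(1)] val_pcls[OF g(1)])
  qed
  show mult: "val n (a \<otimes>\<^bsub>Pol n\<^esub> b) = val n a * val n b"
    if ab: "a \<in> carrier (Pol n)" "b \<in> carrier (Pol n)" for a b
  proof -
    obtain f g where f: "f \<in> free_pol n" "a = pcls n f" and g: "g \<in> free_pol n" "b = pcls n g"
      using ab unfolding carrier_Pol by (elim imageE)
    then have "a \<otimes>\<^bsub>Pol n\<^esub> b = pcls n (f * g)"
      using ring_hom_mult[OF hom, of f g] by simp
    then show ?thesis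
      by (simp only: val_pcls[OF free_pol_closed(5)[OF f(1) g(1)]] cls_simps f(2) g(2)
          val_pcls[OF f(1)] val_pcls[OF g(1)])
  qed
  show zero: "val n \<zero>\<^bsub>Pol n\<^esub> = 0"
    using add[of "\<zero>\<^bsub>Pol n\<^esub>" "\<zero>\<^bsub>Pol n\<^esub>"] by simp
  show "val n (a \<oplus>\<^bsub>Pol n\<^esub> b) = val n a + val n b"
    if "a \<in> carrier (Pol n)" "b \<in> carrier (Pol n)" using add that by blast
  show "val n (\<ominus>\<^bsub>Pol n\<^esub> a) = - val n a" if a: "a \<in> carrier (Pol n)"
    using add[of "\<ominus>\<^bsub>Pol n\<^esub> a" a] a zero l_neg[OF a] by (simp add: eq_neg_iff_add_eq_0)
qed

lemma pol_x: "i \<in> {1..n} \<Longrightarrow> pol_x n i \<in> carrier (Pol n)" "i \<in> {1..n} \<Longrightarrow> val n (pol_x n i) = sx i"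
proof -
  have "pol_x n i = pcls n (gen i)" by (simp add: pol_x_def pcls_def)
  moreover assume "i \<in> {1..n}"
  then have "gen i \<in> free_pol n" by (rule free_pol_closed)
  ultimately show "pol_x n i \<in> carrier (Pol n)" "val n (pol_x n i) = sx i"
    by (simp_all only: val_pcls sx_def carrier_Pol imageI)
qed

lemma val_degree: "val n ` Pol_degree n d = spol_deg {1..n} d"
proof -
  have len: "sum_list (map (\<lambda>i. 2) u) = 2 * int (length u)" for u :: "nat list"
    by (induction u) auto
  let ?W = "{u \<in> lists {1..n}. 2 * int (length u) = d}"
  have "{f \<in> carrier (free_algebra {1..n}). \<forall>u\<in>Poly_Mapping.keys f. sum_list (map (\<lambda>i. 2) u) = d} =
      {f. Poly_Mapping.keys f \<subseteq> ?W}"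
    unfolding len by auto
  then have "Pol_degree n d = pcls n ` {f. Poly_Mapping.keys f \<subseteq> ?W}"
    by (simp add: Pol_degree_def presented_degree_def pcls_def)
  moreover have "val n (pcls n f) = cls f" if "f \<in> {f. Poly_Mapping.keys f \<subseteq> ?W}" for f
    by (rule val_pcls) (use that in blast)
  ultimately show ?thesis unfolding spol_deg_def word_span_def
    by (simp only: image_image cong: image_cong)
qed

lemma Pol_degree_iff: "a \<in> Pol_degree n d \<longleftrightarrow> a \<in> carrier (Pol n) \<and> val n a \<in> spol_deg {1..n} d"
proof
  have sub: "Pol_degree n d \<subseteq> carrier (Pol n)"
    unfolding Pol_degree_def presented_degree_def Pol_def presented_carrier by blast
  show "a \<in> carrier (Pol n) \<and> val n a \<in> spol_deg {1..n} d" if "a \<in> Pol_degree n d"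
    using that sub val_degree[of n d] by blast
  assume a: "a \<in> carrier (Pol n) \<and> val n a \<in> spol_deg {1..n} d"
  then obtain b where b: "b \<in> Pol_degree n d" "val n a = val n b" using val_degree[of n d] by auto
  then have "a = b" using sub a by (intro val_eqI) auto
  then show "a \<in> Pol_degree n d" using b by simp
qed

definition lift_op :: "nat \<Rightarrow> (spol \<Rightarrow> spol) \<Rightarrow> pol \<Rightarrow> pol" where
  "lift_op n D = (\<lambda>a \<in> carrier (Pol n). pol_of n (D (val n a)))"

lemma lift_op:
  assumes "\<And>p. p \<in> spol_in {1..n} \<Longrightarrow> D p \<in> spol_in {1..n}" "a \<in> carrier (Pol n)"
  shows "lift_op n D a \<in> carrier (Pol n)" "val n (lift_op n D a) = D (val n a)"
  using assms by (simp_all add: lift_op_def val_in pol_of_in)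

lemma Pol_induct [consumes 1, case_names one var diff]:
  assumes "a \<in> carrier (Pol n)" "P \<one>\<^bsub>Pol n\<^esub>"
    "\<And>i a. i \<in> {1..n} \<Longrightarrow> a \<in> carrier (Pol n) \<Longrightarrow> P a \<Longrightarrow> P (pol_x n i \<otimes>\<^bsub>Pol n\<^esub> a)"
    "\<And>a b. a \<in> carrier (Pol n) \<Longrightarrow> b \<in> carrier (Pol n) \<Longrightarrow> P a \<Longrightarrow> P b \<Longrightarrow> P (a \<oplus>\<^bsub>Pol n\<^esub> \<ominus>\<^bsub>Pol n\<^esub> b)"
  shows "P a"
proof -
  interpret ring "Pol n" by (rule ring_Pol)
  have "p \<in> spol_in {1..n} \<and> P (pol_of n p)" if "p \<in> spol_in {1..n}" for p
    using that
  proof (induction rule: spol_in_induct)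
    case one
    have "pol_of n 1 = \<one>\<^bsub>Pol n\<^esub>" using pol_of_val[of "\<one>\<^bsub>Pol n\<^esub>" n] by (simp add: val_hom)
    then show ?case using assms(2) by (simp add: spol_in_closed)
  next
    case (var i p)
    then have p: "pol_of n p \<in> carrier (Pol n)" "P (pol_of n p)" by (simp_all add: pol_of_in)
    have "pol_x n i \<otimes>\<^bsub>Pol n\<^esub> pol_of n p = pol_of n (sx i * p)"
      using pol_of_val[OF m_closed[OF pol_x(1)[OF var(1)] p(1)]] var p
      by (simp add: val_hom pol_x del: pol_of_val)
    then show ?case using assms(3)[OF var(1) p] spol_in_closed(6,7) var by metis
  next
    case (diff p q)
    then have p: "pol_of n p \<in> carrier (Pol n)" "P (pol_of n p)"
      and q: "pol_of n q \<in> carrier (Pol n)" "P (pol_of n q)" by (simp_all add: pol_of_in)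
    have "pol_of n p \<oplus>\<^bsub>Pol n\<^esub> \<ominus>\<^bsub>Pol n\<^esub> pol_of n q = pol_of n (p - q)"
      using pol_of_val[OF a_closed[OF p(1) a_inv_closed[OF q(1)]]] diff p(1) q(1)
      by (simp add: val_hom del: pol_of_val)
    then show ?case using assms(4)[OF p(1) q(1) p(2) q(2)] spol_in_closed(4) diff by metis
  qed
  then show ?thesis using assms(1) by (metis pol_of_val val_in)
qed

lemma additive_End_simps [simp]:
  "mult (additive_End P) = compose (carrier P)" "one (additive_End P) = (\<lambda>a \<in> carrier P. a)"
  "zero (additive_End P) = (\<lambda>a \<in> carrier P. \<zero>\<^bsub>P\<^esub>)"
  "add (additive_End P) = (\<lambda>f g. \<lambda>a \<in> carrier P. f a \<oplus>\<^bsub>P\<^esub> g a)"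
  by (simp_all add: additive_End_def)

lemma additive_End_iff:
  "D \<in> carrier (additive_End (Pol n)) \<longleftrightarrow> D \<in> extensional (carrier (Pol n)) \<and>
    (\<forall>a \<in> carrier (Pol n). D a \<in> carrier (Pol n)) \<and>
    (\<forall>a \<in> carrier (Pol n). \<forall>b \<in> carrier (Pol n). D (a \<oplus>\<^bsub>Pol n\<^esub> b) = D a \<oplus>\<^bsub>Pol n\<^esub> D b)"
  by (auto simp: additive_End_def hom_def)

lemma additive_End_val:
  assumes "D \<in> carrier (additive_End (Pol n))"
  shows "a \<in> carrier (Pol n) \<Longrightarrow> D a \<in> carrier (Pol n)"
    "a \<in> carrier (Pol n) \<Longrightarrow> b \<in> carrier (Pol n) \<Longrightarrow> val n (D (a \<oplus>\<^bsub>Pol n\<^esub> b)) = val n (D a) + val n (D b)"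
    "a \<in> carrier (Pol n) \<Longrightarrow> val n (D (\<ominus>\<^bsub>Pol n\<^esub> a)) = - val n (D a)"
proof -
  interpret ring "Pol n" by (rule ring_Pol)
  show cl: "D a \<in> carrier (Pol n)" if "a \<in> carrier (Pol n)" for a
    using assms that by (simp add: additive_End_iff)
  show add: "val n (D (a \<oplus>\<^bsub>Pol n\<^esub> b)) = val n (D a) + val n (D b)"
    if "a \<in> carrier (Pol n)" "b \<in> carrier (Pol n)" for a b
    using assms that by (simp add: additive_End_iff val_hom)
  have "val n (D \<zero>\<^bsub>Pol n\<^esub>) = 0" using add[of "\<zero>\<^bsub>Pol n\<^esub>" "\<zero>\<^bsub>Pol n\<^esub>"] by simp
  then show "val n (D (\<ominus>\<^bsub>Pol n\<^esub> a)) = - val n (D a)" if "a \<in> carrier (Pol n)"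
    using add[of "\<ominus>\<^bsub>Pol n\<^esub> a" a] that by (simp add: l_neg eq_neg_iff_add_eq_0)
qed

lemma lift_op_additive:
  assumes "\<And>p. p \<in> spol_in {1..n} \<Longrightarrow> D p \<in> spol_in {1..n}"
    "\<And>p q. p \<in> spol_in {1..n} \<Longrightarrow> q \<in> spol_in {1..n} \<Longrightarrow> D (p + q) = D p + D q"
  shows "lift_op n D \<in> carrier (additive_End (Pol n))"
  unfolding additive_End_iff
proof (intro conjI ballI)
  interpret ring "Pol n" by (rule ring_Pol)
  show "lift_op n D \<in> extensional (carrier (Pol n))" by (simp add: lift_op_def)
  show "lift_op n D a \<in> carrier (Pol n)" if "a \<in> carrier (Pol n)" for a
    using lift_op(1)[OF assms(1) that] .
  fix a b assume a: "a \<in> carrier (Pol n)" and b: "b \<in> carrier (Pol n)"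
  show "lift_op n D (a \<oplus>\<^bsub>Pol n\<^esub> b) = lift_op n D a \<oplus>\<^bsub>Pol n\<^esub> lift_op n D b"
    using a b
    by (intro val_eqI[where n = n]) (simp_all add: lift_op[of n D, OF assms(1)] val_hom assms(2) val_in)
qed

lemma twist_spol_in:
  "p \<in> spol_in A \<Longrightarrow> a \<in> A \<Longrightarrow> b \<in> A \<Longrightarrow> twist a b p \<in> spol_in A"
  by (rule dem_spol_in)

text \<open>Uniqueness holds because the variables generate \<open>Pol n\<close>; existence because \<open>twist a b\<close> preserves the polynomials in the given variables.\<close>

lemma pol_endo_twist:
  assumes "a \<in> {1..n}" "b \<in> {1..n}"
  shows "pol_endo n (\<lambda>j. \<ominus>\<^bsub>Pol n\<^esub> pol_x n (exch a b j)) = lift_op n (twist a b)"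
  unfolding pol_endo_def
proof (rule the_equality)
  interpret ring "Pol n" by (rule ring_Pol)
  have exch: "exch a b j \<in> {1..n}" if "j \<in> {1..n}" for j
    using assms that by (auto simp: exch_def)
  note L = lift_op[of n "twist a b", OF twist_spol_in[OF _ assms]]
  have hom: "lift_op n (twist a b) \<in> ring_hom (Pol n) (Pol n)"
    by (rule ring_hom_memI; (intro val_eqI[where n = n])?; simp add: L val_hom twist)
  have vars: "lift_op n (twist a b) (pol_x n j) = \<ominus>\<^bsub>Pol n\<^esub> pol_x n (exch a b j)" if "j \<in> {1..n}" for j
    using that exch[OF that] by (intro val_eqI[where n = n]) (simp_all add: L val_hom twist pol_x)
  show "lift_op n (twist a b) \<in> extensional (carrier (Pol n)) \<and>
    lift_op n (twist a b) \<in> ring_hom (Pol n) (Pol n) \<and>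
    (\<forall>j\<in>{1..n}. lift_op n (twist a b) (pol_x n j) = \<ominus>\<^bsub>Pol n\<^esub> pol_x n (exch a b j))"
    using hom vars by (simp add: lift_op_def)
  fix s
  assume s: "s \<in> extensional (carrier (Pol n)) \<and> s \<in> ring_hom (Pol n) (Pol n) \<and>
    (\<forall>j\<in>{1..n}. s (pol_x n j) = \<ominus>\<^bsub>Pol n\<^esub> pol_x n (exch a b j))"
  interpret s: ring_hom_ring "Pol n" "Pol n" s
    by (rule ring_hom_ringI2[OF ring_Pol ring_Pol]) (use s in blast)
  interpret r: ring_hom_ring "Pol n" "Pol n" "lift_op n (twist a b)"
    by (rule ring_hom_ringI2[OF ring_Pol ring_Pol hom])
  show "s = lift_op n (twist a b)"
  proof (rule extensionalityI[where A = "carrier (Pol n)"])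
    fix f assume "f \<in> carrier (Pol n)"
    then show "s f = lift_op n (twist a b) f"
    proof (induction rule: Pol_induct)
      case (var i f)
      then show ?case using s vars by (simp add: pol_x)
    qed simp_all
  qed (use s in \<open>simp_all add: lift_op_def\<close>)
qed

lemma twisted_derivation_dem:
  assumes "a \<in> {1..n}" "b \<in> {1..n}"
    "\<And>j. j \<in> {1..n} \<Longrightarrow> c j = (if j = a \<or> j = b then \<one>\<^bsub>Pol n\<^esub> else \<zero>\<^bsub>Pol n\<^esub>)"
  shows "twisted_derivation n (lift_op n (twist a b)) c = lift_op n (app (dem a b))"
  unfolding twisted_derivation_def
proof (rule the_equality)
  interpret ring "Pol n" by (rule ring_Pol)
  let ?s = "lift_op n (twist a b)" and ?D = "lift_op n (app (dem a b))"
  note S = lift_op[of n "twist a b", OF twist_spol_in[OF _ assms(1,2)]]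
  note D = lift_op[of n "app (dem a b)", OF dem_spol_in(1)[OF _ assms(1,2)]]
  have D_one: "?D \<one>\<^bsub>Pol n\<^esub> = \<zero>\<^bsub>Pol n\<^esub>"
    by (intro val_eqI[where n = n]) (simp_all add: D val_hom)
  have vars: "?D (pol_x n j) = c j" if "j \<in> {1..n}" for j
    using that assms(3)[OF that] by (intro val_eqI[where n = n]) (simp_all add: D val_hom dem_var pol_x)
  have mult: "?D (f \<otimes>\<^bsub>Pol n\<^esub> g) = ?D f \<otimes>\<^bsub>Pol n\<^esub> g \<oplus>\<^bsub>Pol n\<^esub> ?s f \<otimes>\<^bsub>Pol n\<^esub> ?D g"
    if "f \<in> carrier (Pol n)" "g \<in> carrier (Pol n)" for f g
    using that by (intro val_eqI[where n = n]) (simp_all add: D S val_hom dem_mult)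
  show "?D \<in> carrier (additive_End (Pol n)) \<and> ?D \<one>\<^bsub>Pol n\<^esub> = \<zero>\<^bsub>Pol n\<^esub> \<and>
    (\<forall>j\<in>{1..n}. ?D (pol_x n j) = c j) \<and>
    (\<forall>f\<in>carrier (Pol n). \<forall>g\<in>carrier (Pol n).
       ?D (f \<otimes>\<^bsub>Pol n\<^esub> g) = ?D f \<otimes>\<^bsub>Pol n\<^esub> g \<oplus>\<^bsub>Pol n\<^esub> ?s f \<otimes>\<^bsub>Pol n\<^esub> ?D g)"
    using D_one vars mult
    by (intro conjI lift_op_additive dem_spol_in assms) (simp_all add: app_add)
  fix D
  assume A: "D \<in> carrier (additive_End (Pol n)) \<and> D \<one>\<^bsub>Pol n\<^esub> = \<zero>\<^bsub>Pol n\<^esub> \<and>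
    (\<forall>j\<in>{1..n}. D (pol_x n j) = c j) \<and>
    (\<forall>f\<in>carrier (Pol n). \<forall>g\<in>carrier (Pol n).
       D (f \<otimes>\<^bsub>Pol n\<^esub> g) = D f \<otimes>\<^bsub>Pol n\<^esub> g \<oplus>\<^bsub>Pol n\<^esub> ?s f \<otimes>\<^bsub>Pol n\<^esub> D g)"
  then have DA: "D \<in> carrier (additive_End (Pol n))" by blast
  have D'A: "?D \<in> carrier (additive_End (Pol n))"
    by (intro lift_op_additive dem_spol_in assms) (simp_all add: app_add)
  note V = additive_End_val[OF DA] additive_End_val[OF D'A]
  show "D = ?D"
  proof (rule extensionalityI[where A = "carrier (Pol n)"])
    fix f assume "f \<in> carrier (Pol n)"
    then show "D f = ?D f"
    proof (induction rule: Pol_induct)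
      case one
      then show ?case using A D_one by simp
    next
      case (var i f)
      then show ?case using A vars mult by (simp add: pol_x)
    next
      case (diff f g)
      then show ?case by (intro val_eqI[where n = n]) (simp_all add: V)
    qed
  qed (use DA D'A in \<open>simp_all add: additive_End_iff\<close>)
qed

lemma demazure_eq: "i \<in> {1..<n} \<Longrightarrow> demazure n i = lift_op n (app (dem i (Suc i)))"
proof -
  assume i: "i \<in> {1..<n}"
  have "(\<lambda>j. \<ominus>\<^bsub>Pol n\<^esub> pol_x n (if j = i then i + 1 else if j = i + 1 then i else j)) =
      (\<lambda>j. \<ominus>\<^bsub>Pol n\<^esub> pol_x n (exch i (Suc i) j))"
    unfolding exch_def Suc_eq_plus1 ..
  then have "s_refl n i = lift_op n (twist i (Suc i))"
    unfolding s_refl_def using pol_endo_twist[of i n "Suc i"] i by simp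
  then show ?thesis
    unfolding demazure_def using i by (simp add: One_nat_def, intro twisted_derivation_dem) auto
qed

lemma demazureB_eq: "n \<ge> 1 \<Longrightarrow> demazureB n = lift_op n (app (dem n n))"
proof -
  assume n: "n \<ge> 1"
  have "exch n n j = j" for j by (simp add: exch_def)
  then have "s_reflB n = lift_op n (twist n n)"
    unfolding s_reflB_def using pol_endo_twist[of n n n] n by simp
  then show ?thesis
    unfolding demazureB_def using n by (simp, intro twisted_derivation_dem) auto
qed

lemma sym_pols_iff:
  assumes "n \<ge> 1"
  shows "a \<in> sym_pols n \<longleftrightarrow> a \<in> carrier (Pol n) \<and> val n a \<in> sym_spol n"
proof -
  interpret ring "Pol n" by (rule ring_Pol)
  have ker: "lift_op n (app (dop n i)) a = \<zero>\<^bsub>Pol n\<^esub> \<longleftrightarrow> app (dop n i) (val n a) = 0"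
    if "i \<in> {1..n}" "a \<in> carrier (Pol n)" for i
  proof -
    have L: "lift_op n (app (dop n i)) a \<in> carrier (Pol n)"
      "val n (lift_op n (app (dop n i)) a) = app (dop n i) (val n a)"
      using lift_op[of n "app (dop n i)" a] dop_closed(1)[OF that(1)] that(2) by blast+
    show ?thesis
    proof
      assume "lift_op n (app (dop n i)) a = \<zero>\<^bsub>Pol n\<^esub>"
      then show "app (dop n i) (val n a) = 0" using L(2) by (simp add: val_hom)
    next
      assume "app (dop n i) (val n a) = 0"
      then show "lift_op n (app (dop n i)) a = \<zero>\<^bsub>Pol n\<^esub>"
        using L by (intro val_eqI[where n = n]) (simp_all add: val_hom)
    qed
  qed
  have d: "demazure n i = lift_op n (app (dop n i))" if "i \<in> {1..<n}" for i
    using that by (simp add: demazure_eq dop_def)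
  have dB: "demazureB n = lift_op n (app (dop n n))"
    using assms by (simp add: demazureB_eq dop_def)
  have split: "{1..n} = insert n {1..<n}" using assms by auto
  show ?thesis
  proof (cases "a \<in> carrier (Pol n)")
    case True
    have "a \<in> sym_pols n \<longleftrightarrow> (\<forall>i \<in> {1..<n}. lift_op n (app (dop n i)) a = \<zero>\<^bsub>Pol n\<^esub>) \<and>
        lift_op n (app (dop n n)) a = \<zero>\<^bsub>Pol n\<^esub>"
      unfolding sym_pols_def a_kernel_def' using True by (simp add: d dB)
    also have "\<dots> \<longleftrightarrow> (\<forall>i \<in> {1..n}. lift_op n (app (dop n i)) a = \<zero>\<^bsub>Pol n\<^esub>)"
      unfolding split by (simp add: conj_commute)
    also have "\<dots> \<longleftrightarrow> (\<forall>i \<in> {1..n}. app (dop n i) (val n a) = 0)"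
      using ker[OF _ True] by (rule ball_cong[OF HOL.refl])
    also have "\<dots> \<longleftrightarrow> a \<in> carrier (Pol n) \<and> val n a \<in> sym_spol n"
      using True val_in[OF True] by (simp add: sym_spol_def)
    finally show ?thesis .
  qed (simp add: sym_pols_def a_kernel_def')
qed

lemma pol_of_sym_spol: "n \<ge> 1 \<Longrightarrow> p \<in> sym_spol n \<Longrightarrow> pol_of n p \<in> sym_pols n"
  using sym_spol_subset[of n] by (auto simp: sym_pols_iff pol_of_in)

lemma right_End_iff:
  "h \<in> carrier (right_End P L) \<longleftrightarrow> h \<in> carrier (additive_End P) \<and>
     (\<forall>a \<in> carrier P. \<forall>l \<in> L. h (a \<otimes>\<^bsub>P\<^esub> l) = h a \<otimes>\<^bsub>P\<^esub> l)"
  by (simp add: right_End_def)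

lemma right_End_simps [simp]:
  "mult (right_End P L) = compose (carrier P)" "one (right_End P L) = (\<lambda>a \<in> carrier P. a)"
  "zero (right_End P L) = (\<lambda>a \<in> carrier P. \<zero>\<^bsub>P\<^esub>)"
  "add (right_End P L) = (\<lambda>f g. \<lambda>a \<in> carrier P. f a \<oplus>\<^bsub>P\<^esub> g a)"
  by (simp_all add: right_End_def)


section \<open>The polynomial representation is an isomorphism\<close>

abbreviation free_nh :: "nat \<Rightarrow> nh_gen free_alg set" where
  "free_nh n \<equiv> {u. Poly_Mapping.keys u \<subseteq> lists (nh_gens n)}"

lemma act_closed:
  assumes "u \<in> free_nh n" "n \<ge> 1"
  shows "p \<in> spol_in {1..n} \<Longrightarrow> app (act n u) p \<in> spol_in {1..n}"
    "l \<in> sym_spol n \<Longrightarrow> app (act n u) (p * l) = app (act n u) p * l"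
proof -
  have gen: "p \<in> spol_in {1..n} \<Longrightarrow> app (gen_op n g) p \<in> spol_in {1..n}"
    "l \<in> sym_spol n \<Longrightarrow> app (gen_op n g) (p * l) = app (gen_op n g) p * l"
    if "g \<in> nh_gens n" for g p
  proof -
    from that consider i where "g = GenX i" "i \<in> {1..n}" | i where "i \<in> {1..n}" "gen_op n g = dop n i"
      using assms(2) unfolding nh_gens_def dop_def by force
    note cases = this
    show "p \<in> spol_in {1..n} \<Longrightarrow> app (gen_op n g) p \<in> spol_in {1..n}"
      using cases by cases (simp_all add: spol_in_closed dop_closed)
    show "l \<in> sym_spol n \<Longrightarrow> app (gen_op n g) (p * l) = app (gen_op n g) p * l"
      using cases by cases (simp_all add: mult.assoc dop_mult_sym_spol)
  qed
  have word: "(p \<in> spol_in {1..n} \<longrightarrow> app (act n (Poly_Mapping.single w 1)) p \<in> spol_in {1..n}) \<and>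
    (l \<in> sym_spol n \<longrightarrow> app (act n (Poly_Mapping.single w 1)) (p * l) = app (act n (Poly_Mapping.single w 1)) p * l)"
    if "w \<in> lists (nh_gens n)" for w p
    using that unfolding act_def alg_hom_single
    by (induction w) (auto simp: gen)
  have "(p \<in> spol_in {1..n} \<longrightarrow> app (act n u) p \<in> spol_in {1..n}) \<and>
    (l \<in> sym_spol n \<longrightarrow> app (act n u) (p * l) = app (act n u) p * l)"
    using assms(1)[unfolded mem_Collect_eq]
    by (induction u rule: free_alg_induct)
      (use word in \<open>auto simp: act_simps spol_in_closed left_diff_distrib\<close>)
  then show "p \<in> spol_in {1..n} \<Longrightarrow> app (act n u) p \<in> spol_in {1..n}"
    "l \<in> sym_spol n \<Longrightarrow> app (act n u) (p * l) = app (act n u) p * l" by blast+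
qed

abbreviation nh_words :: "nat \<Rightarrow> int \<Rightarrow> nh_gen list set" where
  "nh_words n d \<equiv> {u \<in> lists (nh_gens n). sum_list (map nh_gen_degree u) = d}"

lemma act_degree:
  assumes "Poly_Mapping.keys u \<subseteq> nh_words n d" "n \<ge> 1" "p \<in> spol_deg {1..n} k"
  shows "app (act n u) p \<in> spol_deg {1..n} (k + d)"
proof -
  have gen: "app (gen_op n g) q \<in> spol_deg {1..n} (e + nh_gen_degree g)"
    if "g \<in> nh_gens n" "q \<in> spol_deg {1..n} e" for g q e
  proof -
    from that(1) consider i where "g = GenX i" "i \<in> {1..n}"
      | i where "i \<in> {1..n}" "gen_op n g = dop n i" "nh_gen_degree g = - 2"
      using assms(2) unfolding nh_gens_def dop_def by force
    then show ?thesis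
    proof cases
      case 1
      then show ?thesis using spol_deg_closed(6)[OF spol_deg_closed(7) that(2), of i]
        by (simp add: add.commute)
    next
      case 2
      then show ?thesis using dop_closed(2)[OF 2(1) that(2)] by simp
    qed
  qed
  have word: "app (act n (Poly_Mapping.single w 1)) p \<in> spol_deg {1..n} (k + sum_list (map nh_gen_degree w))"
    if "w \<in> lists (nh_gens n)" for w
    using that unfolding act_def alg_hom_single
  proof (induction w)
    case (Cons g w)
    from gen[OF Cons(1) Cons(3)] show ?case by (simp add: algebra_simps)
  qed (use assms in simp)
  show ?thesis
    using assms(1)
    by (induction u rule: free_alg_induct)
      (use word in \<open>auto simp: act_simps spol_deg_closed\<close>)
qed

lemma act_ordered:
  "app (act n (\<Sum>r<order_B n. fpol (f r) * fword n (nf_word n 1 r))) q =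
     (\<Sum>r<order_B n. cls (f r) * app (word_op n (nf_word n 1 r)) q)"
proof -
  have "app (act n (\<Sum>r<N. fpol (f r) * fword n (nf_word n 1 r))) q =
      (\<Sum>r<N. cls (f r) * app (word_op n (nf_word n 1 r)) q)" for N
    by (induction N) (simp_all add: act_simps act_fpol act_fword[OF set_nf_word_1])
  then show ?thesis .
qed

lemma pairing_tri:
  "r < order_B n \<Longrightarrow> s < r \<Longrightarrow> pairing n n 1 r s = 0" "r < order_B n \<Longrightarrow> is_sign (pairing n n 1 r r)"
  using pairing_triangular[of 1 n n r s] pairing_triangular[of 1 n n r r] by auto

text \<open>By \<open>nh_ordered_span\<close> the element is \<open>\<Sum>\<^sub>r p\<^sub>r W\<^sub>r\<close> modulo the relations. Its values at the box monomials form a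
  triangular system for the \<open>p\<^sub>r\<close>, whence all \<open>p\<^sub>r\<close> vanish.\<close>

theorem act_faithful:
  assumes "u \<in> free_nh n" "n \<ge> 1" "\<And>p. p \<in> spol_in {1..n} \<Longrightarrow> app (act n u) p = 0"
  shows "u \<in> nh_ideal n"
proof -
  have "u \<in> ordered_span n" using nh_ordered_span assms(1,2) by blast
  then obtain f where f: "\<And>r. f r \<in> free_pol n"
    "u - (\<Sum>r<order_B n. fpol (f r) * fword n (nf_word n 1 r)) \<in> nh_ideal n"
    by (rule ordered_spanE) (rule that)
  from act_ideal[OF assms(2) f(2)]
  have "app (act n u) p = (\<Sum>r<order_B n. cls (f r) * app (word_op n (nf_word n 1 r)) p)" for p
    by (simp add: act_simps flip: act_ordered)
  then have sys: "(\<Sum>r<order_B n. cls (f r) * pairing n n 1 r s) = 0" for s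
    using assms(3)[OF box_mono_1_spol_in, of s] by (simp add: pairing_def)
  have zero: "cls (f r) = 0" if "r < order_B n" for r
    by (rule triangular_left_unique[where N = "order_B n" and c = "pairing n n 1" and p = "\<lambda>r. cls (f r)"])
      (use pairing_tri sys that in auto)
  have "fpol (f r) \<in> nh_ideal n" if r: "r < order_B n" for r
  proof -
    have "f r - 0 \<in> two_sided skew_relations"
      using zero[OF r] cls_simps(1) unfolding cls_eq_iff[symmetric] by simp
    then have "f r \<in> genideal (free_algebra {1..n}) (pol_relations n)"
      unfolding pol_ideal using f(1)[of r] by (simp only: diff_0_right IntI)
    then have "f r \<in> two_sided (pol_relations n)"
      using genideal_eq_two_sided[of "pol_relations n" "{1..n}", OF pol_relations_keys] by simp
    then show ?thesis unfolding fpol_def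
      by (rule alg_hom_two_sided_image)
        (auto simp: pol_relations_def alg_hom_add alg_hom_mult nh_relations_def intro!: two_sided_base)
  qed
  then have "(\<Sum>r<order_B n. fpol (f r) * fword n (nf_word n 1 r)) \<in> nh_ideal n"
    by (intro two_sided_sum two_sided_right) simp
  from two_sided_add[OF f(2) this] show ?thesis by simp
qed

lemma fpol_keys:
  assumes "Poly_Mapping.keys f \<subseteq> {u \<in> lists {1..n}. 2 * int (length u) = d}"
  shows "Poly_Mapping.keys (fpol f) \<subseteq> nh_words n d"
  using assms
proof (induction f rule: free_alg_induct)
  case (single w)
  have deg: "sum_list (map nh_gen_degree (map GenX v)) = 2 * int (length v)" for v
    by (induction v) auto
  have "fpol (Poly_Mapping.single w 1) = prod_list (map gen (map GenX w))"
    by (simp add: fpol_def alg_hom_single comp_def)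
  also have "\<dots> = Poly_Mapping.single (map GenX w) 1" by (rule single_eq_prod_gen[symmetric])
  finally show ?case using single deg[of w] by (auto simp: nh_gens_def)
qed (simp_all add: fpol_simps keys_diff_lists)

lemma fword_keys:
  assumes "set w \<subseteq> {1..n}" "n \<ge> 1"
  shows "Poly_Mapping.keys (fword n w) \<subseteq> nh_words n (- 2 * int (length w))"
proof -
  define g where "g = (\<lambda>i. if i = n then GenB else GenD i)"
  have "fword n w = prod_list (map gen (map g w))"
    unfolding fword_def by (intro arg_cong[of _ _ prod_list]) (simp add: fdn_def g_def)
  also have "\<dots> = Poly_Mapping.single (map g w) 1" by (rule single_eq_prod_gen[symmetric])
  moreover have "g i \<in> nh_gens n" if "i \<in> {1..n}" for i
    using that by (cases "i = n") (auto simp: g_def nh_gens_def)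
  then have "map g w \<in> lists (nh_gens n)" using assms(1) by (auto simp: subset_iff)
  moreover have "sum_list (map nh_gen_degree (map g w)) = - 2 * int (length w)"
    by (induction w) (auto simp: g_def)
  ultimately show ?thesis by simp
qed

lemma keys_mult_words:
  assumes "Poly_Mapping.keys f \<subseteq> nh_words n d" "Poly_Mapping.keys g \<subseteq> nh_words n e"
  shows "Poly_Mapping.keys (f * g) \<subseteq> nh_words n (d + e)"
  using keys_mult[of f g] assms by (fastforce simp: plus_list_def)

lemma keys_sum_subset:
  fixes f :: "'b \<Rightarrow> 'a free_alg"
  assumes "\<And>i. i \<in> I \<Longrightarrow> Poly_Mapping.keys (f i) \<subseteq> L"
  shows "Poly_Mapping.keys (sum f I) \<subseteq> L"
  using keys_sum[of f I] assms by blast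

text \<open>The coefficients \<open>p\<^sub>r\<close> of the element are obtained by solving the triangular system.\<close>

theorem act_dense:
  assumes "n \<ge> 1" "\<And>s. s < order_B n \<Longrightarrow> t s \<in> spol_in {1..n}"
  shows "\<exists>u \<in> free_nh n. \<forall>s<order_B n. app (act n u) (box_mono n 1 s) = t s"
proof -
  obtain p where p: "\<And>r. r < order_B n \<Longrightarrow> p r \<in> spol_in {1..n}"
    "\<And>s. s < order_B n \<Longrightarrow> (\<Sum>r<order_B n. p r * pairing n n 1 r s) = t s"
    using triangular_solve[where N = "order_B n" and c = "pairing n n 1" and t = t and
        Q = "\<lambda>_. spol_in {1..n}"] pairing_tri assms(2) spol_in_closed(4)
        spol_in_closed(6)[OF _ pairing_spol_in] by blast
  have "\<exists>f. r < order_B n \<longrightarrow> f \<in> free_pol n \<and> p r = cls f" for r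
    using p(1)[of r] unfolding spol_in_eq by blast
  then obtain f where f: "\<And>r. r < order_B n \<Longrightarrow> f r \<in> free_pol n" "\<And>r. r < order_B n \<Longrightarrow> p r = cls (f r)"
    by metis
  let ?u = "\<Sum>r<order_B n. fpol (f r) * fword n (nf_word n 1 r)"
  have "fpol q \<in> free_nh n" if "q \<in> free_pol n" for q
    using that
  proof (induction rule: free_pol_induct)
    case (var i q)
    then show ?case
      using keys_mult_lists[OF keys_gen, of "GenX i" "nh_gens n" "fpol q"]
      by (simp add: fpol_simps nh_gens_def)
  qed (simp_all add: fpol_simps keys_diff_lists)
  moreover have "fword n (nf_word n 1 r) \<in> free_nh n" for r
    using fword_keys[OF set_nf_word_1 assms(1), of r] by blast
  ultimately have "?u \<in> free_nh n"
    using f(1) by (intro CollectI keys_sum_subset keys_mult_lists) auto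
  moreover have "app (act n ?u) (box_mono n 1 s) = t s" if "s < order_B n" for s
    using p(2)[OF that] unfolding act_ordered by (simp add: f(2) pairing_def)
  ultimately show ?thesis by blast
qed

theorem act_dense_graded:
  assumes "n \<ge> 1" "\<And>s. s < order_B n \<Longrightarrow> t s \<in> spol_deg {1..n} (d + 2 * int (digit_sum n s))"
  shows "\<exists>u. Poly_Mapping.keys u \<subseteq> nh_words n d \<and> (\<forall>s<order_B n. app (act n u) (box_mono n 1 s) = t s)"
proof -
  let ?Q = "\<lambda>r. spol_deg {1..n} (d + 2 * int (digit_sum n r))"
  have step: "q * pairing n n 1 r s \<in> ?Q s" if "q \<in> ?Q r" for q r s
    using spol_deg_closed(6)[OF that pairing_deg[of n r s]] by (simp add: algebra_simps)
  obtain p where p: "\<And>r. r < order_B n \<Longrightarrow> p r \<in> ?Q r"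
    "\<And>s. s < order_B n \<Longrightarrow> (\<Sum>r<order_B n. p r * pairing n n 1 r s) = t s"
    using triangular_solve[where N = "order_B n" and c = "pairing n n 1" and t = t and
        Q = ?Q] pairing_tri assms(2) spol_deg_closed(4) step by blast
  let ?W = "\<lambda>r. {f. Poly_Mapping.keys f \<subseteq>
    {u \<in> lists {1..n}. 2 * int (length u) = d + 2 * int (digit_sum n r)}}"
  have "\<forall>r. \<exists>f. r < order_B n \<longrightarrow> f \<in> ?W r \<and> p r = cls f"
    using p(1) unfolding spol_deg_def word_span_def by (blast elim: imageE)
  from choice[OF this] obtain f where "\<forall>r. r < order_B n \<longrightarrow> f r \<in> ?W r \<and> p r = cls (f r)" ..
  then have f: "\<And>r. r < order_B n \<Longrightarrow> f r \<in> ?W r" "\<And>r. r < order_B n \<Longrightarrow> p r = cls (f r)"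
    by (simp_all only: simp_thms)
  let ?u = "\<Sum>r<order_B n. fpol (f r) * fword n (nf_word n 1 r)"
  have "Poly_Mapping.keys (fpol (f r) * fword n (nf_word n 1 r)) \<subseteq> nh_words n d" if "r < order_B n" for r
    using keys_mult_words[OF fpol_keys[OF CollectD[OF f(1)[OF that]]] fword_keys[OF set_nf_word_1 assms(1)], of r]
    by (simp add: length_nf_word)
  then have "Poly_Mapping.keys ?u \<subseteq> nh_words n d" by (intro keys_sum_subset) auto
  moreover have "app (act n ?u) (box_mono n 1 s) = t s" if "s < order_B n" for s
    using p(2)[OF that] unfolding act_ordered by (simp add: f(2) pairing_def)
  ultimately show ?thesis by blast
qed

lemma free_nh_closed:
  "u \<in> free_nh n \<Longrightarrow> v \<in> free_nh n \<Longrightarrow> u + v \<in> free_nh n"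
  "u \<in> free_nh n \<Longrightarrow> v \<in> free_nh n \<Longrightarrow> u - v \<in> free_nh n"
  "u \<in> free_nh n \<Longrightarrow> v \<in> free_nh n \<Longrightarrow> u * v \<in> free_nh n"
  "1 \<in> free_nh n" "g \<in> nh_gens n \<Longrightarrow> gen g \<in> free_nh n"
  using keys_add_lists[of u "lists (nh_gens n)" v] keys_diff_lists[of u "lists (nh_gens n)" v]
    keys_mult_lists[of u "nh_gens n" v] keys_gen[of g "nh_gens n"] keys_one_lists
  by simp_all

lemma nh_relations_keys:
  assumes "r \<in> nh_relations n" "n \<ge> 1"
  shows "Poly_Mapping.keys r \<subseteq> lists (nh_gens n)"
proof -
  \<comment> \<open>an opaque name keeps the simplifier from unfolding the set of keys\<close>
  define F where "F = free_nh n"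
  note closed = free_nh_closed[where n = n, folded F_def]
  have "r \<in> F"
    using assms unfolding nh_relations_def power2_eq_square
    by (auto intro!: closed simp: nh_gens_def)
  then show ?thesis by (simp add: F_def)
qed

lemma nh_class_eq_iff:
  assumes "u \<in> free_nh n" "v \<in> free_nh n" "n \<ge> 1"
  shows "nh_class n u = nh_class n v \<longleftrightarrow> u - v \<in> nh_ideal n"
proof -
  have keys: "\<And>r. r \<in> nh_relations n \<Longrightarrow> Poly_Mapping.keys r \<subseteq> lists (nh_gens n)"
    using nh_relations_keys assms(3) by blast
  have "Poly_Mapping.keys (u - v) \<subseteq> lists (nh_gens n)"
    using assms by (intro keys_diff_lists) auto
  then show ?thesis
    using presented_class_eq_iff[OF keys, where f = u and g = v] assms
    by (simp add: nh_class_def genideal_eq_two_sided[OF keys])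
qed

lemma carrier_NH: "carrier (NH n) = nh_class n ` free_nh n"
  unfolding NH_def nh_class_def presented_carrier by simp

lemma nh_class_hom:
  assumes "n \<ge> 1"
  shows "nh_class n \<in> ring_hom (free_algebra (nh_gens n)) (NH n)"
  unfolding NH_def nh_class_def using nh_relations_keys assms by (intro presented_class_hom)

text \<open>A coset acts through any of its representatives (\<open>rep_class\<close>).\<close>

definition rep :: "nat \<Rightarrow> nh \<Rightarrow> pol \<Rightarrow> pol" where
  "rep n U = lift_op n (app (act n (SOME u. u \<in> free_nh n \<and> nh_class n u = U)))"

lemma rep_class:
  assumes "u \<in> free_nh n" "n \<ge> 1"
  shows "rep n (nh_class n u) = lift_op n (app (act n u))"
proof -
  let ?v = "SOME v. v \<in> free_nh n \<and> nh_class n v = nh_class n u"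
  have "?v \<in> free_nh n \<and> nh_class n ?v = nh_class n u"
    by (rule someI[of _ u]) (use assms in blast)
  then have "?v - u \<in> nh_ideal n" using nh_class_eq_iff[OF _ assms(1,2)] by blast
  then have "act n ?v = act n u" using act_ideal[OF assms(2), of "?v - u"] by (simp add: act_simps)
  then show ?thesis by (simp add: rep_def)
qed

lemma lift_op_act_right_End:
  assumes "u \<in> free_nh n" "n \<ge> 1"
  shows "lift_op n (app (act n u)) \<in> carrier (right_End (Pol n) (sym_pols n))"
  unfolding right_End_iff
proof (intro conjI ballI)
  interpret ring "Pol n" by (rule ring_Pol)
  show "lift_op n (app (act n u)) \<in> carrier (additive_End (Pol n))"
    by (rule lift_op_additive) (simp_all add: act_closed[OF assms] app_add)
  fix a l assume a: "a \<in> carrier (Pol n)" and "l \<in> sym_pols n"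
  then have l: "l \<in> carrier (Pol n)" "val n l \<in> sym_spol n" by (simp_all add: sym_pols_iff[OF assms(2)])
  note L = lift_op[of n "app (act n u)", OF act_closed(1)[OF assms]]
  show "lift_op n (app (act n u)) (a \<otimes>\<^bsub>Pol n\<^esub> l) = lift_op n (app (act n u)) a \<otimes>\<^bsub>Pol n\<^esub> l"
    using a l by (intro val_eqI[where n = n]) (simp_all add: L val_hom act_closed(2)[OF assms])
qed

lemma rep_hom:
  assumes "n \<ge> 1"
  shows "rep n \<in> ring_hom (NH n) (right_End (Pol n) (sym_pols n))"
proof (rule ring_hom_memI)
  interpret ring "Pol n" by (rule ring_Pol)
  note hom = nh_class_hom[OF assms]
  show "rep n U \<in> carrier (right_End (Pol n) (sym_pols n))" if U: "U \<in> carrier (NH n)" for U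
  proof -
    obtain u where u: "u \<in> free_nh n" "U = nh_class n u" using U unfolding carrier_NH by (elim imageE)
    show ?thesis unfolding u(2) rep_class[OF u(1) assms] by (rule lift_op_act_right_End[OF u(1) assms])
  qed
  fix U V assume U: "U \<in> carrier (NH n)" and V: "V \<in> carrier (NH n)"
  obtain u where u: "u \<in> free_nh n" "U = nh_class n u" using U unfolding carrier_NH by (elim imageE)
  obtain v where v: "v \<in> free_nh n" "V = nh_class n v" using V unfolding carrier_NH by (elim imageE)
  note L = lift_op[of n "app (act n u)", OF act_closed(1)[OF u(1) assms]]
    lift_op[of n "app (act n v)", OF act_closed(1)[OF v(1) assms]]
  have "U \<otimes>\<^bsub>NH n\<^esub> V = nh_class n (u * v)" "U \<oplus>\<^bsub>NH n\<^esub> V = nh_class n (u + v)"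
    using ring_hom_mult[OF hom, of u v] ring_hom_add[OF hom, of u v] u v by simp_all
  then have eq: "rep n (U \<otimes>\<^bsub>NH n\<^esub> V) = lift_op n (app (act n (u * v)))"
    "rep n (U \<oplus>\<^bsub>NH n\<^esub> V) = lift_op n (app (act n (u + v)))"
    using rep_class[OF free_nh_closed(3)[OF u(1) v(1)] assms]
      rep_class[OF free_nh_closed(1)[OF u(1) v(1)] assms] by simp_all
  have r: "rep n U = lift_op n (app (act n u))" "rep n V = lift_op n (app (act n v))"
    unfolding u(2) v(2) by (rule rep_class[OF u(1) assms], rule rep_class[OF v(1) assms])
  show "rep n (U \<otimes>\<^bsub>NH n\<^esub> V) = rep n U \<otimes>\<^bsub>right_End (Pol n) (sym_pols n)\<^esub> rep n V"
    unfolding eq r right_End_simps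
  proof (rule extensionalityI[where A = "carrier (Pol n)"])
    fix a assume a: "a \<in> carrier (Pol n)"
    have "val n (lift_op n (app (act n (u * v))) a) = app (act n (u * v)) (val n a)"
      by (rule lift_op(2)[OF act_closed(1)[OF free_nh_closed(3)[OF u(1) v(1)] assms] a])
    moreover have "lift_op n (app (act n (u * v))) a \<in> carrier (Pol n)"
      by (rule lift_op(1)[OF act_closed(1)[OF free_nh_closed(3)[OF u(1) v(1)] assms] a])
    ultimately show "lift_op n (app (act n (u * v))) a =
        compose (carrier (Pol n)) (lift_op n (app (act n u))) (lift_op n (app (act n v))) a"
      using a by (intro val_eqI[where n = n]) (simp_all add: compose_eq L act_simps)
  qed (simp_all add: lift_op_def compose_def)
  show "rep n (U \<oplus>\<^bsub>NH n\<^esub> V) = rep n U \<oplus>\<^bsub>right_End (Pol n) (sym_pols n)\<^esub> rep n V"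
    unfolding eq r right_End_simps
  proof (rule extensionalityI[where A = "carrier (Pol n)"])
    fix a assume a: "a \<in> carrier (Pol n)"
    have "val n (lift_op n (app (act n (u + v))) a) = app (act n (u + v)) (val n a)"
      by (rule lift_op(2)[OF act_closed(1)[OF free_nh_closed(1)[OF u(1) v(1)] assms] a])
    moreover have "lift_op n (app (act n (u + v))) a \<in> carrier (Pol n)"
      by (rule lift_op(1)[OF act_closed(1)[OF free_nh_closed(1)[OF u(1) v(1)] assms] a])
    ultimately show "lift_op n (app (act n (u + v))) a =
        (\<lambda>a\<in>carrier (Pol n). lift_op n (app (act n u)) a \<oplus>\<^bsub>Pol n\<^esub> lift_op n (app (act n v)) a) a"
      using a by (intro val_eqI[where n = n]) (simp_all add: L act_simps val_hom)
  qed (simp_all add: lift_op_def)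
next
  have "\<one>\<^bsub>NH n\<^esub> = nh_class n 1" using ring_hom_one[OF nh_class_hom[OF assms]] by simp
  then have "rep n \<one>\<^bsub>NH n\<^esub> = lift_op n (app (act n 1))"
    using rep_class[OF free_nh_closed(4) assms] by simp
  also have "\<dots> = (\<lambda>a \<in> carrier (Pol n). a)"
    unfolding lift_op_def by (rule restrict_ext) (simp add: act_simps)
  finally show "rep n \<one>\<^bsub>NH n\<^esub> = \<one>\<^bsub>right_End (Pol n) (sym_pols n)\<^esub>" by simp
qed

definition transported :: "nat \<Rightarrow> (pol \<Rightarrow> pol) \<Rightarrow> spol \<Rightarrow> spol" where
  "transported n \<Theta> p = val n (\<Theta> (pol_of n p))"

lemma transported:
  assumes "\<Theta> \<in> carrier (right_End (Pol n) (sym_pols n))" "n \<ge> 1"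
  shows "p \<in> spol_in {1..n} \<Longrightarrow> transported n \<Theta> p \<in> spol_in {1..n}"
    "p \<in> spol_in {1..n} \<Longrightarrow> q \<in> spol_in {1..n} \<Longrightarrow>
       transported n \<Theta> (p + q) = transported n \<Theta> p + transported n \<Theta> q"
    "p \<in> spol_in {1..n} \<Longrightarrow> l \<in> sym_spol n \<Longrightarrow> transported n \<Theta> (p * l) = transported n \<Theta> p * l"
    "a \<in> carrier (Pol n) \<Longrightarrow> val n (\<Theta> a) = transported n \<Theta> (val n a)"
proof -
  interpret ring "Pol n" by (rule ring_Pol)
  have A: "\<Theta> \<in> carrier (additive_End (Pol n))" using assms by (simp add: right_End_iff)
  note V = additive_End_val[OF A]
  show "transported n \<Theta> p \<in> spol_in {1..n}" if "p \<in> spol_in {1..n}"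
    using that by (simp add: transported_def val_in V pol_of_in)
  show "transported n \<Theta> (p + q) = transported n \<Theta> p + transported n \<Theta> q"
    if "p \<in> spol_in {1..n}" "q \<in> spol_in {1..n}"
  proof -
    have "pol_of n (p + q) = pol_of n p \<oplus>\<^bsub>Pol n\<^esub> pol_of n q"
      using that by (intro val_eqI[where n = n]) (simp_all add: pol_of_in spol_in_closed val_hom)
    then show ?thesis using that by (simp add: transported_def V pol_of_in)
  qed
  show "transported n \<Theta> (p * l) = transported n \<Theta> p * l" if "p \<in> spol_in {1..n}" "l \<in> sym_spol n"
  proof -
    have l: "l \<in> spol_in {1..n}" using that sym_spol_subset by blast
    have "pol_of n (p * l) = pol_of n p \<otimes>\<^bsub>Pol n\<^esub> pol_of n l"
      using that l by (intro val_eqI[where n = n]) (simp_all add: pol_of_in spol_in_closed val_hom)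
    moreover have "\<Theta> (pol_of n p \<otimes>\<^bsub>Pol n\<^esub> pol_of n l) = \<Theta> (pol_of n p) \<otimes>\<^bsub>Pol n\<^esub> pol_of n l"
      using assms that pol_of_sym_spol[OF assms(2)] pol_of_in by (simp add: right_End_iff)
    ultimately show ?thesis using that l by (simp add: transported_def V pol_of_in val_hom)
  qed
  show "val n (\<Theta> a) = transported n \<Theta> (val n a)" if "a \<in> carrier (Pol n)"
    using that by (simp add: transported_def)
qed

lemma transported_sum:
  assumes "\<Theta> \<in> carrier (right_End (Pol n) (sym_pols n))" "n \<ge> 1"
    "\<And>r. r \<in> A \<Longrightarrow> f r \<in> spol_in {1..n}" "\<And>r. r \<in> A \<Longrightarrow> c r \<in> sym_spol n"
  shows "transported n \<Theta> (\<Sum>r\<in>A. f r * c r) = (\<Sum>r\<in>A. transported n \<Theta> (f r) * c r)"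
proof -
  have zero: "transported n \<Theta> 0 = 0"
    using transported(2)[OF assms(1,2), of 0 0] by (simp add: spol_in_closed)
  have c: "c r \<in> spol_in {1..n}" if "r \<in> A" for r using assms(4)[OF that] sym_spol_subset by blast
  have "(\<Sum>r\<in>A. f r * c r) \<in> spol_in {1..n} \<and>
      transported n \<Theta> (\<Sum>r\<in>A. f r * c r) = (\<Sum>r\<in>A. transported n \<Theta> (f r) * c r)"
    using assms(3,4) c
  proof (induction A rule: infinite_finite_induct)
    case (insert r F)
    then show ?case
      using transported(2)[OF assms(1,2), of "f r * c r" "\<Sum>r\<in>F. f r * c r"]
      by (simp add: spol_in_closed transported(3)[OF assms(1,2)])
  qed (simp_all add: zero spol_in_closed)
  then show ?thesis by blast
qed

lemma transported_expand:
  assumes "\<Theta> \<in> carrier (right_End (Pol n) (sym_pols n))" "n \<ge> 1" "p \<in> spol_in {1..n}"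
  shows "transported n \<Theta> p = (\<Sum>r<order_B n. transported n \<Theta> (box_mono n 1 r) * coord n p r)"
proof -
  have "transported n \<Theta> p = transported n \<Theta> (\<Sum>r<order_B n. box_mono n 1 r * coord n p r)"
    using coord(2)[OF assms(3)] by simp
  also have "\<dots> = (\<Sum>r<order_B n. transported n \<Theta> (box_mono n 1 r) * coord n p r)"
    by (rule transported_sum[OF assms(1,2)]) (simp_all add: box_mono_1_spol_in coord(1)[OF assms(3)])
  finally show ?thesis .
qed

text \<open>An endomorphism is determined by its values on the box monomials, which generate.\<close>

lemma right_End_eqI:
  assumes "\<Theta> \<in> carrier (right_End (Pol n) (sym_pols n))" "\<Xi> \<in> carrier (right_End (Pol n) (sym_pols n))"
    "n \<ge> 1" "\<And>r. r < order_B n \<Longrightarrow> transported n \<Theta> (box_mono n 1 r) = transported n \<Xi> (box_mono n 1 r)"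
  shows "\<Theta> = \<Xi>"
proof (rule extensionalityI[where A = "carrier (Pol n)"])
  fix a assume a: "a \<in> carrier (Pol n)"
  have "val n (\<Theta> a) = val n (\<Xi> a)"
    unfolding transported(4)[OF assms(1,3) a] transported(4)[OF assms(2,3) a]
      transported_expand[OF assms(1,3) val_in[OF a]] transported_expand[OF assms(2,3) val_in[OF a]]
    by (rule sum.cong) (simp_all add: assms(4))
  then show "\<Theta> a = \<Xi> a"
    using assms a by (intro val_eqI[where n = n]) (simp_all add: right_End_iff additive_End_iff)
qed (use assms in \<open>simp_all add: right_End_iff additive_End_iff\<close>)

lemma transported_lift_op:
  "(\<And>p. p \<in> spol_in {1..n} \<Longrightarrow> D p \<in> spol_in {1..n}) \<Longrightarrow> p \<in> spol_in {1..n} \<Longrightarrow>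
    transported n (lift_op n D) p = D p"
  unfolding transported_def by (simp add: lift_op pol_of_in)

lemma right_End_degree_iff:
  assumes "\<Theta> \<in> carrier (right_End (Pol n) (sym_pols n))" "n \<ge> 1"
  shows "\<Theta> \<in> right_End_degree (Pol n) (sym_pols n) (Pol_degree n) d \<longleftrightarrow>
    (\<forall>k. \<forall>p \<in> spol_deg {1..n} k. transported n \<Theta> p \<in> spol_deg {1..n} (k + d))"
proof -
  have cl: "\<Theta> a \<in> carrier (Pol n)" if "a \<in> carrier (Pol n)" for a
    using assms that by (simp add: right_End_iff additive_End_iff)
  have "\<Theta> ` Pol_degree n k \<subseteq> Pol_degree n (k + d) \<longleftrightarrow>
    (\<forall>p \<in> spol_deg {1..n} k. transported n \<Theta> p \<in> spol_deg {1..n} (k + d))" for k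
  proof
    assume *: "\<Theta> ` Pol_degree n k \<subseteq> Pol_degree n (k + d)"
    show "\<forall>p \<in> spol_deg {1..n} k. transported n \<Theta> p \<in> spol_deg {1..n} (k + d)"
    proof
      fix p assume p: "p \<in> spol_deg {1..n} k"
      then have "p \<in> spol_in {1..n}" using spol_deg_subset by blast
      then have "pol_of n p \<in> Pol_degree n k" using p by (simp add: Pol_degree_iff pol_of_in)
      then have "\<Theta> (pol_of n p) \<in> Pol_degree n (k + d)" using * by blast
      then show "transported n \<Theta> p \<in> spol_deg {1..n} (k + d)"
        by (simp add: transported_def Pol_degree_iff)
    qed
  next
    assume *: "\<forall>p \<in> spol_deg {1..n} k. transported n \<Theta> p \<in> spol_deg {1..n} (k + d)"
    show "\<Theta> ` Pol_degree n k \<subseteq> Pol_degree n (k + d)"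
    proof (rule image_subsetI)
      fix a assume "a \<in> Pol_degree n k"
      then have "a \<in> carrier (Pol n)" "val n a \<in> spol_deg {1..n} k" by (simp_all add: Pol_degree_iff)
      then show "\<Theta> a \<in> Pol_degree n (k + d)"
        using * by (simp add: Pol_degree_iff cl transported(4)[OF assms])
    qed
  qed
  then show ?thesis using assms(1) by (simp add: right_End_degree_def)
qed

theorem rep_iso:
  assumes "n \<ge> 1"
  shows "rep n \<in> graded_ring_iso (NH n) (NH_degree n)
    (right_End (Pol n) (sym_pols n)) (right_End_degree (Pol n) (sym_pols n) (Pol_degree n))"
proof -
  let ?E = "right_End (Pol n) (sym_pols n)"
  have trans: "transported n (lift_op n (app (act n u))) p = app (act n u) p"
    if "u \<in> free_nh n" "p \<in> spol_in {1..n}" for u p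
    by (rule transported_lift_op[OF act_closed(1)[OF that(1) assms] that(2)])
  have inj: "inj_on (rep n) (carrier (NH n))"
  proof (rule inj_onI)
    fix U V assume U: "U \<in> carrier (NH n)" and V: "V \<in> carrier (NH n)" and eq: "rep n U = rep n V"
    obtain u where u: "u \<in> free_nh n" "U = nh_class n u" using U unfolding carrier_NH by (elim imageE)
    obtain v where v: "v \<in> free_nh n" "V = nh_class n v" using V unfolding carrier_NH by (elim imageE)
    have "lift_op n (app (act n u)) = lift_op n (app (act n v))"
      using eq unfolding u(2) v(2) rep_class[OF u(1) assms] rep_class[OF v(1) assms] .
    then have "app (act n u) p = app (act n v) p" if "p \<in> spol_in {1..n}" for p
      using trans[OF u(1) that] trans[OF v(1) that] by simp
    then have "u - v \<in> nh_ideal n"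
      by (intro act_faithful[OF free_nh_closed(2)[OF u(1) v(1)] assms]) (simp add: act_simps)
    then show "U = V" unfolding u(2) v(2) using nh_class_eq_iff[OF u(1) v(1) assms] by blast
  qed
  have cl: "rep n U \<in> carrier ?E" if "U \<in> carrier (NH n)" for U
    using ring_hom_closed[OF rep_hom[OF assms] that] .
  have agree: "rep n (nh_class n u) = \<Theta>"
    if "u \<in> free_nh n" "\<Theta> \<in> carrier ?E"
      "\<And>s. s < order_B n \<Longrightarrow> app (act n u) (box_mono n 1 s) = transported n \<Theta> (box_mono n 1 s)" for u \<Theta>
    unfolding rep_class[OF that(1) assms]
    by (rule right_End_eqI[OF lift_op_act_right_End[OF that(1) assms] that(2) assms])
      (simp add: trans[OF that(1) box_mono_1_spol_in] that(3))
  have surj: "rep n ` carrier (NH n) = carrier ?E"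
  proof
    show "carrier ?E \<subseteq> rep n ` carrier (NH n)"
    proof
      fix \<Theta> assume \<Theta>: "\<Theta> \<in> carrier ?E"
      obtain u where u: "u \<in> free_nh n"
        "\<forall>s<order_B n. app (act n u) (box_mono n 1 s) = transported n \<Theta> (box_mono n 1 s)"
        using act_dense[OF assms, of "\<lambda>s. transported n \<Theta> (box_mono n 1 s)"]
          transported(1)[OF \<Theta> assms box_mono_1_spol_in] by blast
      have "rep n (nh_class n u) = \<Theta>" using agree[OF u(1) \<Theta>] u(2) by blast
      then show "\<Theta> \<in> rep n ` carrier (NH n)" using u(1) unfolding carrier_NH by blast
    qed
  qed (use cl in blast)
  have deg: "rep n ` NH_degree n d = right_End_degree (Pol n) (sym_pols n) (Pol_degree n) d" for d
  proof -
    have D: "NH_degree n d = nh_class n ` {u. Poly_Mapping.keys u \<subseteq> nh_words n d}"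
    proof -
      have "{f \<in> carrier (free_algebra (nh_gens n)). \<forall>u\<in>Poly_Mapping.keys f. sum_list (map nh_gen_degree u) = d}
          = {u. Poly_Mapping.keys u \<subseteq> nh_words n d}" by auto
      then show ?thesis by (simp add: NH_degree_def presented_degree_def nh_class_def)
    qed
    show ?thesis
    proof
      show "rep n ` NH_degree n d \<subseteq> right_End_degree (Pol n) (sym_pols n) (Pol_degree n) d"
      proof (rule image_subsetI)
        fix U assume "U \<in> NH_degree n d"
        then obtain u where u: "Poly_Mapping.keys u \<subseteq> nh_words n d" "U = nh_class n u"
          unfolding D by blast
        then have uf: "u \<in> free_nh n" by blast
        have "transported n (lift_op n (app (act n u))) p \<in> spol_deg {1..n} (k + d)"
          if p: "p \<in> spol_deg {1..n} k" for k p
          unfolding trans[OF uf subsetD[OF spol_deg_subset p]] by (rule act_degree[OF u(1) assms p])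
        then show "rep n U \<in> right_End_degree (Pol n) (sym_pols n) (Pol_degree n) d"
          unfolding u(2) rep_class[OF uf assms]
            right_End_degree_iff[OF lift_op_act_right_End[OF uf assms] assms] by blast
      qed
      show "right_End_degree (Pol n) (sym_pols n) (Pol_degree n) d \<subseteq> rep n ` NH_degree n d"
      proof
        fix \<Theta> assume \<Theta>d: "\<Theta> \<in> right_End_degree (Pol n) (sym_pols n) (Pol_degree n) d"
        then have \<Theta>: "\<Theta> \<in> carrier ?E" by (simp add: right_End_degree_def)
        have "transported n \<Theta> (box_mono n 1 s) \<in> spol_deg {1..n} (d + 2 * int (digit_sum n s))" for s
          using \<Theta>d box_mono_1_deg[of n s] unfolding right_End_degree_iff[OF \<Theta> assms]
          by (metis add.commute)
        then obtain u where u: "Poly_Mapping.keys u \<subseteq> nh_words n d"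
          "\<forall>s<order_B n. app (act n u) (box_mono n 1 s) = transported n \<Theta> (box_mono n 1 s)"
          using act_dense_graded[OF assms, of "\<lambda>s. transported n \<Theta> (box_mono n 1 s)" d] by blast
        then have uf: "u \<in> free_nh n" by blast
        have "rep n (nh_class n u) = \<Theta>" using agree[OF uf \<Theta>] u(2) by blast
        then show "\<Theta> \<in> rep n ` NH_degree n d" using u(1) unfolding D by blast
      qed
    qed
  qed
  show ?thesis
    using rep_hom[OF assms] inj surj deg
    by (simp add: graded_ring_iso_def ring_iso_def bij_betw_def)
qed

lemma polynomial_rep_rep:
  assumes "n \<ge> 1"
  shows "polynomial_rep n (rep n)"
proof -
  have add: "rep n \<in> ring_hom (NH n) (additive_End (Pol n))"
    using rep_hom[OF assms] by (auto simp: ring_hom_def right_End_iff)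
  have X: "rep n (nh_class n (fx i)) = (\<lambda>f \<in> carrier (Pol n). pol_x n i \<otimes>\<^bsub>Pol n\<^esub> f)" if "i \<in> {1..n}" for i
  proof -
    interpret ring "Pol n" by (rule ring_Pol)
    have "rep n (nh_class n (fx i)) = lift_op n (\<lambda>p. sx i * p)"
      using rep_class[OF free_nh_closed(5) assms, of "GenX i"] that
      by (simp add: nh_gens_def act_simps lift_op_def)
    also have "\<dots> = (\<lambda>f \<in> carrier (Pol n). pol_x n i \<otimes>\<^bsub>Pol n\<^esub> f)"
      unfolding lift_op_def
    proof (rule restrict_ext)
      fix a assume a: "a \<in> carrier (Pol n)"
      have "sx i * val n a \<in> spol_in {1..n}" using a that by (intro spol_in_closed val_in)
      then show "pol_of n (sx i * val n a) = pol_x n i \<otimes>\<^bsub>Pol n\<^esub> a"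
        using a that by (intro val_eqI[where n = n]) (simp_all add: pol_of_in pol_x val_hom)
    qed
    finally show ?thesis .
  qed
  have D: "rep n (nh_class n (fd i)) = demazure n i" if "i \<in> {1..<n}" for i
    using rep_class[OF free_nh_closed(5) assms, of "GenD i"] that
    by (simp add: nh_gens_def act_simps demazure_eq)
  have B: "rep n (nh_class n fb) = demazureB n"
    using rep_class[OF free_nh_closed(5) assms, of GenB] assms
    by (simp add: nh_gens_def act_simps demazureB_eq)
  show ?thesis unfolding polynomial_rep_def using add X D B by blast
qed

section \<open>The graded rank\<close>

lemma fls_X_powi_nth: "fls_nth (fls_X powi d :: rat fls) k = (if k = d then 1 else 0)"
  by (cases "d \<ge> 0") (auto simp: power_int_def fls_inverse_X fls_X_inv_power_conv_shift_1)

text \<open>The coefficients of the series count the exponents, so the multiset of exponents is determined by the series.\<close>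

lemma sum_list_powi_nth:
  "fls_nth (\<Sum>d\<leftarrow>ds. fls_X powi d :: rat fls) k = of_nat (count (mset ds) k)"
  by (induction ds) (auto simp: fls_X_powi_nth)

lemma exponents_eq:
  assumes "sorted es" "(\<Sum>d\<leftarrow>es. fls_X powi d) = f"
  shows "exponents f = es"
  unfolding exponents_def
proof (rule the_equality)
  fix ds :: "int list" assume ds: "sorted ds \<and> (\<Sum>d\<leftarrow>ds. fls_X powi d) = f"
  have "of_nat (count (mset ds) k) = (of_nat (count (mset es) k) :: rat)" for k
    unfolding sum_list_powi_nth[symmetric] conjunct2[OF ds] assms(2) ..
  then have "mset ds = mset es" by (intro multiset_eqI) simp
  then show "ds = es" using ds assms properties_for_sort by metis
qed (intro conjI assms)

lemma sum_digits:
  fixes f :: "nat \<Rightarrow> 'a::semiring_0"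
  assumes "0 < b"
  shows "(\<Sum>r<b * N. f (r mod b) * g (r div b)) = (\<Sum>a<b. f a) * (\<Sum>r<N. g r)"
proof -
  have "(\<Sum>r<b * N. f (r mod b) * g (r div b)) =
      (\<Sum>m<N. \<Sum>r\<in>{m * b..<m * b + b}. f (r mod b) * g (r div b))"
    by (simp add: sum.nat_group mult.commute)
  also have "\<dots> = (\<Sum>m<N. \<Sum>a<b. f a * g m)"
  proof (rule sum.cong[OF HOL.refl])
    fix m
    have "(\<Sum>r\<in>{m * b..<m * b + b}. f (r mod b) * g (r div b)) =
        (\<Sum>a\<in>{0..<b}. f ((a + m * b) mod b) * g ((a + m * b) div b))"
      using sum.shift_bounds_nat_ivl[of "\<lambda>r. f (r mod b) * g (r div b)" 0 "m * b" b]
      by (simp add: add.commute)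
    also have "\<dots> = (\<Sum>a<b. f a * g m)"
      unfolding lessThan_atLeast0 by (rule sum.cong) (use assms in auto)
    finally show "(\<Sum>r\<in>{m * b..<m * b + b}. f (r mod b) * g (r div b)) = (\<Sum>a<b. f a * g m)" .
  qed
  also have "\<dots> = (\<Sum>a<b. f a) * (\<Sum>r<N. g r)"
    by (simp add: sum_distrib_left sum_distrib_right)
  finally show ?thesis .
qed

lemma fls_X_neq: "(fls_X - inverse fls_X :: rat fls) \<noteq> 0"
proof
  assume "(fls_X - inverse fls_X :: rat fls) = 0"
  then have "fls_nth (fls_X - inverse fls_X :: rat fls) 1 = 0" by simp
  then show False by (simp add: fls_inverse_X)
qed

lemma geometric_sum_symmetric:
  fixes q :: "'a::field"
  assumes "q \<noteq> 0"
  shows "(q - inverse q) * (\<Sum>a<k. q ^ (2 * a)) * q = q ^ k * (q powi int k - q powi - int k)"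
proof -
  have geo: "(q ^ 2 - 1) * (\<Sum>a<k. q ^ (2 * a)) = q ^ (2 * k) - 1"
    by (induction k) (simp_all add: algebra_simps power2_eq_square)
  have "(q - inverse q) * (\<Sum>a<k. q ^ (2 * a)) * q = (q ^ 2 - 1) * (\<Sum>a<k. q ^ (2 * a))"
    using assms by (simp add: power2_eq_square algebra_simps)
  also have "\<dots> = q ^ (2 * k) - 1" by (rule geo)
  also have "\<dots> = q ^ k * (q powi int k - q powi - int k)"
    using assms by (simp add: power_int_minus right_diff_distrib mult_2 power_add)
  finally show ?thesis .
qed

lemma qint_geometric:
  "(\<Sum>a<2 * Suc l. fls_X ^ (2 * a)) = fls_X ^ (2 * l + 1) * qint (2 * Suc l)"
proof -
  let ?X = "fls_X :: rat fls" and ?k = "2 * Suc l"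
  have X: "?X \<noteq> 0" by (rule fls_X_nonzero)
  have "?k = Suc (2 * l + 1)" by simp
  then have k: "?X ^ ?k = ?X ^ (2 * l + 1) * ?X" by (simp only: power_Suc2)
  have "(?X - inverse ?X) * (\<Sum>a<?k. ?X ^ (2 * a)) * ?X =
      (?X ^ (2 * l + 1) * (?X powi int ?k - ?X powi - int ?k)) * ?X"
    unfolding geometric_sum_symmetric[OF X] k by (simp only: mult_ac)
  then have "(?X - inverse ?X) * (\<Sum>a<?k. ?X ^ (2 * a)) =
      ?X ^ (2 * l + 1) * (?X powi int ?k - ?X powi - int ?k)"
    using X by (simp only: mult_cancel_right) blast
  then have "(\<Sum>a<?k. ?X ^ (2 * a)) =
      ?X ^ (2 * l + 1) * (?X powi int ?k - ?X powi - int ?k) / (?X - inverse ?X)"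
    using fls_X_neq by (metis nonzero_mult_div_cancel_left)
  then show ?thesis by (simp only: qint_def times_divide_eq_right)
qed

text \<open>The exponent of each variable runs through \<open>0, \<dots>, 2l - 1\<close>, which contributes a geometric sum \<open>q\<^bsup>2l-1\<^esup>[2l]\<close>; the powers of \<open>q\<close> add up to \<open>q\<^bsup>n\<^sup>2\<^esup>\<close> as a sum of odd numbers.\<close>

lemma graded_rank:
  "(\<Sum>r<order_B l. fls_X ^ (2 * digit_sum l r)) = fls_X ^ (l ^ 2) * even_qdfact l"
proof (induction l)
  case (Suc l)
  let ?X = "fls_X :: rat fls"
  have "(\<Sum>r<order_B (Suc l). ?X ^ (2 * digit_sum (Suc l) r)) =
      (\<Sum>r<2 * Suc l * order_B l. ?X ^ (2 * (r mod (2 * Suc l))) * ?X ^ (2 * digit_sum l (r div (2 * Suc l))))"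
    by (simp add: power_add distrib_left del: mult_Suc_right)
  also have "\<dots> = (\<Sum>a<2 * Suc l. ?X ^ (2 * a)) * (\<Sum>r<order_B l. ?X ^ (2 * digit_sum l r))"
    by (rule sum_digits) simp
  also have "\<dots> = (?X ^ (2 * l + 1) * ?X ^ (l ^ 2)) * (even_qdfact l * qint (2 * Suc l))"
    unfolding qint_geometric Suc by simp
  also have "even_qdfact l * qint (2 * Suc l) = even_qdfact (Suc l)"
    by (simp add: even_qdfact_def)
  also have "?X ^ (2 * l + 1) * ?X ^ (l ^ 2) = ?X ^ (Suc l ^ 2)"
  proof -
    have "2 * l + 1 + l ^ 2 = Suc l ^ 2" by (simp add: power2_eq_square)
    then show ?thesis by (simp only: flip: power_add)
  qed
  finally show ?case .
qed (simp add: even_qdfact_def)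

text \<open>The box monomials sorted by degree, because the exponents of the graded rank are listed in increasing order.\<close>

definition basis_order :: "nat \<Rightarrow> nat list" where
  "basis_order n = sort_key (digit_sum n) [0..<order_B n]"

lemma basis_order_bij: "bij_betw ((!) (basis_order n)) {..<order_B n} {..<order_B n}"
proof -
  have "distinct (basis_order n)" "set (basis_order n) = {..<order_B n}" "length (basis_order n) = order_B n"
    by (auto simp: basis_order_def)
  then show ?thesis by (intro bij_betw_nth) auto
qed

lemma exponents_rank:
  "exponents (fls_X ^ (n ^ 2) * even_qdfact n) = map (\<lambda>r. 2 * int (digit_sum n r)) (basis_order n)"
proof (rule exponents_eq)
  have "sorted (map (digit_sum n) (basis_order n))" by (simp add: basis_order_def)
  then show "sorted (map (\<lambda>r. 2 * int (digit_sum n r)) (basis_order n))"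
    by (simp add: sorted_map)
  have "(\<Sum>d\<leftarrow>map (\<lambda>r. 2 * int (digit_sum n r)) (basis_order n). fls_X powi d) =
      (\<Sum>r\<leftarrow>basis_order n. (fls_X :: rat fls) ^ (2 * digit_sum n r))"
  proof -
    have "2 * int (digit_sum n r) = int (2 * digit_sum n r)" for r by simp
    then show ?thesis by (simp only: map_map comp_def power_int_of_nat)
  qed
  also have "\<dots> = sum_mset (image_mset (\<lambda>r. fls_X ^ (2 * digit_sum n r)) (mset (basis_order n)))"
    by (simp flip: sum_mset_sum_list)
  also have "\<dots> = (\<Sum>r<order_B n. fls_X ^ (2 * digit_sum n r))"
    by (simp add: basis_order_def sum_unfold_sum_mset lessThan_atLeast0 mset_upt)
  also have "\<dots> = fls_X ^ (n ^ 2) * even_qdfact n" by (rule graded_rank)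
  finally show "(\<Sum>d\<leftarrow>map (\<lambda>r. 2 * int (digit_sum n r)) (basis_order n). fls_X powi d) =
    fls_X ^ (n ^ 2) * even_qdfact n" .
qed

section \<open>Endomorphisms as matrices\<close>

definition bas :: "nat \<Rightarrow> nat \<Rightarrow> spol" where
  "bas n i = box_mono n 1 (basis_order n ! i)"

definition crd :: "nat \<Rightarrow> spol \<Rightarrow> nat \<Rightarrow> spol" where
  "crd n p i = coord n p (basis_order n ! i)"

definition bas_deg :: "nat \<Rightarrow> nat \<Rightarrow> int" where
  "bas_deg n i = 2 * int (digit_sum n (basis_order n ! i))"

lemma basis_order_less: "i < order_B n \<Longrightarrow> basis_order n ! i < order_B n"
  using basis_order_bij[of n] bij_betwE by fastforce

lemma bas_deg: "bas n i \<in> spol_deg {1..n} (bas_deg n i)"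
  unfolding bas_def bas_deg_def by (rule box_mono_1_deg)

lemma bas_in: "bas n i \<in> spol_in {1..n}"
  unfolding bas_def by (rule box_mono_1_spol_in)

lemma crd_sym_spol: "p \<in> spol_in {1..n} \<Longrightarrow> crd n p i \<in> sym_spol n"
  unfolding crd_def by (rule coord)

lemma crd_deg:
  "p \<in> spol_deg {1..n} d \<Longrightarrow> i < order_B n \<Longrightarrow> crd n p i \<in> spol_deg {1..n} (d - bas_deg n i)"
  unfolding crd_def bas_deg_def by (intro coord_deg basis_order_less)

lemma bas_expand:
  assumes "p \<in> spol_in {1..n}"
  shows "p = (\<Sum>i<order_B n. bas n i * crd n p i)"
proof -
  have "(\<Sum>i<order_B n. bas n i * crd n p i) = (\<Sum>r<order_B n. box_mono n 1 r * coord n p r)"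
    unfolding bas_def crd_def
    by (rule sum.reindex_bij_betw[OF basis_order_bij, of "\<lambda>r. box_mono n 1 r * coord n p r"])
  then show ?thesis using coord(2)[OF assms] by simp
qed

lemma crd_unique:
  assumes "\<And>j. j < order_B n \<Longrightarrow> c j \<in> sym_spol n" "i < order_B n"
  shows "crd n (\<Sum>j<order_B n. bas n j * c j) i = c i"
proof -
  let ?f = "(!) (basis_order n)"
  define c' where "c' = c \<circ> inv_into {..<order_B n} ?f"
  have c': "c' (?f j) = c j" if "j < order_B n" for j
    using bij_betw_inv_into_left[OF basis_order_bij, of j n] that by (simp add: c'_def)
  have "(\<Sum>j<order_B n. bas n j * c j) = (\<Sum>j<order_B n. box_mono n 1 (?f j) * c' (?f j))"
    by (rule sum.cong) (simp_all add: bas_def c')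
  also have "\<dots> = (\<Sum>r<order_B n. box_mono n 1 r * c' r)"
    by (rule sum.reindex_bij_betw[OF basis_order_bij])
  finally have eq: "(\<Sum>j<order_B n. bas n j * c j) = (\<Sum>r<order_B n. box_mono n 1 r * c' r)" .
  have "c' r \<in> sym_spol n" if "r < order_B n" for r
  proof -
    have "inv_into {..<order_B n} ?f r \<in> {..<order_B n}"
      by (rule bij_betw_apply[OF bij_betw_inv_into[OF basis_order_bij[of n]]]) (simp add: that)
    then show ?thesis using assms(1) by (simp add: c'_def)
  qed
  then have "coord n (\<Sum>r<order_B n. box_mono n 1 r * c' r) (?f i) = c' (?f i)"
    by (intro coord_unique basis_order_less assms)
  then show ?thesis unfolding eq crd_def using c'[OF assms(2)] by simp
qed

lemma crd_bas: "i < order_B n \<Longrightarrow> j < order_B n \<Longrightarrow> crd n (bas n j) i = of_bool (i = j)"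
proof -
  assume ij: "i < order_B n" "j < order_B n"
  have "bas n j = (\<Sum>k<order_B n. bas n k * of_bool (k = j))"
    using ij by (simp add: of_bool_def if_distrib cong: if_cong)
  then show ?thesis using crd_unique[of n "\<lambda>k. of_bool (k = j)" i] ij
    by (simp add: of_bool_def sym_spol_closed)
qed

lemma crd_add:
  assumes "p \<in> spol_in {1..n}" "q \<in> spol_in {1..n}" "i < order_B n"
  shows "crd n (p + q) i = crd n p i + crd n q i"
proof -
  have "p + q = (\<Sum>j<order_B n. bas n j * (crd n p j + crd n q j))"
    using bas_expand[OF assms(1)] bas_expand[OF assms(2)] by (simp add: distrib_left sum.distrib)
  then show ?thesis
    using crd_unique[of n "\<lambda>j. crd n p j + crd n q j" i] assms by (simp add: crd_sym_spol sym_spol_closed)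
qed

lemma crd_mult:
  assumes "p \<in> spol_in {1..n}" "l \<in> sym_spol n" "i < order_B n"
  shows "crd n (p * l) i = crd n p i * l"
proof -
  have "p * l = (\<Sum>j<order_B n. bas n j * crd n p j) * l" using bas_expand[OF assms(1)] by simp
  also have "\<dots> = (\<Sum>j<order_B n. bas n j * (crd n p j * l))" by (simp add: sum_distrib_right mult.assoc)
  finally show ?thesis
    using crd_unique[of n "\<lambda>j. crd n p j * l" i] assms by (simp add: crd_sym_spol sym_spol_closed)
qed

text \<open>The coordinates of an image are obtained from the coordinates of the argument by matrix multiplication; applied to an image again, this is the multiplicativity of \<open>mat_of\<close>.\<close>

lemma crd_transported:
  assumes "\<Theta> \<in> carrier (right_End (Pol n) (sym_pols n))" "n \<ge> 1" "p \<in> spol_in {1..n}" "i < order_B n"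
  shows "crd n (transported n \<Theta> p) i = (\<Sum>k<order_B n. crd n (transported n \<Theta> (bas n k)) i * crd n p k)"
proof -
  let ?T = "transported n \<Theta>"
  note T = transported(1)[OF assms(1,2)]
  have "?T p = ?T (\<Sum>k<order_B n. bas n k * crd n p k)" using bas_expand[OF assms(3)] by simp
  also have "\<dots> = (\<Sum>k<order_B n. ?T (bas n k) * crd n p k)"
    by (rule transported_sum[OF assms(1,2)]) (simp_all add: bas_in crd_sym_spol[OF assms(3)])
  also have "\<dots> = (\<Sum>k<order_B n. (\<Sum>l<order_B n. bas n l * crd n (?T (bas n k)) l) * crd n p k)"
    using bas_expand[OF T[OF bas_in]] by (intro sum.cong) simp_all
  also have "\<dots> = (\<Sum>l<order_B n. bas n l * (\<Sum>k<order_B n. crd n (?T (bas n k)) l * crd n p k))"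
    unfolding sum_distrib_left sum_distrib_right mult.assoc by (rule sum.swap)
  finally show ?thesis
    using crd_unique[of n "\<lambda>l. \<Sum>k<order_B n. crd n (?T (bas n k)) l * crd n p k" i] assms T
    by (simp add: sym_spol_sum sym_spol_closed crd_sym_spol bas_in)
qed

lemma SymPol_simps [simp]:
  "carrier (SymPol n) = sym_pols n" "mult (SymPol n) = mult (Pol n)" "one (SymPol n) = one (Pol n)"
  "zero (SymPol n) = zero (Pol n)" "add (SymPol n) = add (Pol n)"
  by (simp_all add: SymPol_def)

lemma ring_SymPol:
  assumes "n \<ge> 1"
  shows "ring (SymPol n)"
  unfolding SymPol_def
proof (rule ring.subring_is_ring[OF ring_Pol])
  interpret ring "Pol n" by (rule ring_Pol)
  show "subring (sym_pols n) (Pol n)"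
    by (rule subringI) (auto simp: sym_pols_iff[OF assms] val_hom sym_spol_closed)
qed

lemma val_finsum:
  assumes "n \<ge> 1" "finite A" "\<And>a. a \<in> A \<Longrightarrow> f a \<in> sym_pols n"
  shows "finsum (SymPol n) f A \<in> sym_pols n" "val n (finsum (SymPol n) f A) = (\<Sum>a\<in>A. val n (f a))"
proof -
  interpret ring "SymPol n" by (rule ring_SymPol[OF assms(1)])
  have "finsum (SymPol n) f A \<in> sym_pols n \<and> val n (finsum (SymPol n) f A) = (\<Sum>a\<in>A. val n (f a))"
    using assms(2,3)
  proof (induction A rule: finite_induct)
    case empty
    then show ?case using zero_closed by (simp add: val_hom)
  next
    case (insert a F)
    then have "finsum (SymPol n) f (insert a F) = f a \<oplus>\<^bsub>SymPol n\<^esub> finsum (SymPol n) f F"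
      by (intro finsum_insert) auto
    moreover have fa: "f a \<in> sym_pols n" and s: "finsum (SymPol n) f F \<in> sym_pols n"
      "val n (finsum (SymPol n) f F) = (\<Sum>a\<in>F. val n (f a))"
      using insert by auto
    moreover have "f a \<oplus>\<^bsub>Pol n\<^esub> finsum (SymPol n) f F \<in> sym_pols n"
      using a_closed[of "f a" "finsum (SymPol n) f F"] fa s(1) by simp
    moreover have "val n (f a \<oplus>\<^bsub>Pol n\<^esub> finsum (SymPol n) f F) = val n (f a) + (\<Sum>a\<in>F. val n (f a))"
      using fa s by (simp add: sym_pols_iff[OF assms(1)] val_hom)
    ultimately show ?case using insert by simp
  qed
  then show "finsum (SymPol n) f A \<in> sym_pols n"
    "val n (finsum (SymPol n) f A) = (\<Sum>a\<in>A. val n (f a))" by blast+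
qed

definition mat_of :: "nat \<Rightarrow> (pol \<Rightarrow> pol) \<Rightarrow> nat \<Rightarrow> nat \<Rightarrow> pol" where
  "mat_of n \<Theta> = (\<lambda>i\<in>{..<order_B n}. \<lambda>j\<in>{..<order_B n}. pol_of n (crd n (transported n \<Theta> (bas n j)) i))"

lemma mat_of_entry:
  assumes "\<Theta> \<in> carrier (right_End (Pol n) (sym_pols n))" "n \<ge> 1" "i < order_B n" "j < order_B n"
  shows "mat_of n \<Theta> i j \<in> sym_pols n" "val n (mat_of n \<Theta> i j) = crd n (transported n \<Theta> (bas n j)) i"
proof -
  have "crd n (transported n \<Theta> (bas n j)) i \<in> sym_spol n"
    by (intro crd_sym_spol transported(1)[OF assms(1,2)] bas_in)
  moreover from this have "crd n (transported n \<Theta> (bas n j)) i \<in> spol_in {1..n}"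
    using sym_spol_subset by blast
  ultimately show "mat_of n \<Theta> i j \<in> sym_pols n"
    "val n (mat_of n \<Theta> i j) = crd n (transported n \<Theta> (bas n j)) i"
    using assms by (simp_all add: mat_of_def pol_of_sym_spol)
qed

lemma mat_ring_simps [simp]:
  "carrier (mat_ring N R) = {..<N} \<rightarrow>\<^sub>E {..<N} \<rightarrow>\<^sub>E carrier R"
  "mult (mat_ring N R) = (\<lambda>A B. \<lambda>i \<in> {..<N}. \<lambda>j \<in> {..<N}. \<Oplus>\<^bsub>R\<^esub>k \<in> {..<N}. A i k \<otimes>\<^bsub>R\<^esub> B k j)"
  "one (mat_ring N R) = (\<lambda>i \<in> {..<N}. \<lambda>j \<in> {..<N}. if i = j then \<one>\<^bsub>R\<^esub> else \<zero>\<^bsub>R\<^esub>)"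
  "add (mat_ring N R) = (\<lambda>A B. \<lambda>i \<in> {..<N}. \<lambda>j \<in> {..<N}. A i j \<oplus>\<^bsub>R\<^esub> B i j)"
  by (simp_all add: mat_ring_def)

lemma mat_of_eqI:
  assumes "\<Theta> \<in> carrier (right_End (Pol n) (sym_pols n))" "n \<ge> 1"
    "\<And>i j. i < order_B n \<Longrightarrow> j < order_B n \<Longrightarrow> M i j \<in> sym_pols n"
    "\<And>i j. i < order_B n \<Longrightarrow> j < order_B n \<Longrightarrow> val n (M i j) = crd n (transported n \<Theta> (bas n j)) i"
  shows "mat_of n \<Theta> = (\<lambda>i\<in>{..<order_B n}. \<lambda>j\<in>{..<order_B n}. M i j)"
proof -
  have "mat_of n \<Theta> i j = M i j" if "i < order_B n" "j < order_B n" for i j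
    using mat_of_entry[OF assms(1,2) that] assms(3,4)[OF that]
    by (intro val_eqI[where n = n]) (simp_all add: sym_pols_iff[OF assms(2)])
  then show ?thesis
    unfolding mat_of_def by (intro restrict_ext) simp
qed

lemma transported_bas_eq:
  assumes "\<Theta> \<in> carrier (right_End (Pol n) (sym_pols n))" "\<Xi> \<in> carrier (right_End (Pol n) (sym_pols n))"
    "n \<ge> 1" "\<And>j. j < order_B n \<Longrightarrow> transported n \<Theta> (bas n j) = transported n \<Xi> (bas n j)"
  shows "\<Theta> = \<Xi>"
proof (rule right_End_eqI[OF assms(1-3)])
  fix r assume "r < order_B n"
  then have "r \<in> (!) (basis_order n) ` {..<order_B n}" using basis_order_bij[of n] by (simp add: bij_betw_def)
  then obtain j where "j < order_B n" "r = basis_order n ! j" by auto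
  then show "transported n \<Theta> (box_mono n 1 r) = transported n \<Xi> (box_mono n 1 r)"
    using assms(4) by (simp add: bas_def)
qed

lemma mat_of_hom:
  assumes "n \<ge> 1"
  shows "mat_of n \<in> ring_hom (right_End (Pol n) (sym_pols n)) (mat_ring (order_B n) (SymPol n))"
proof (rule ring_hom_memI)
  interpret ring "Pol n" by (rule ring_Pol)
  interpret S: ring "SymPol n" by (rule ring_SymPol[OF assms])
  let ?E = "right_End (Pol n) (sym_pols n)"
  show "mat_of n \<Theta> \<in> carrier (mat_ring (order_B n) (SymPol n))" if "\<Theta> \<in> carrier ?E" for \<Theta>
    using mat_of_entry(1)[OF that assms] by (auto simp: mat_of_def)
  fix \<Theta> \<Xi> assume \<Theta>: "\<Theta> \<in> carrier ?E" and \<Xi>: "\<Xi> \<in> carrier ?E"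
  have cl: "\<Xi> a \<in> carrier (Pol n)" "\<Theta> a \<in> carrier (Pol n)" if "a \<in> carrier (Pol n)" for a
    using \<Theta> \<Xi> that by (simp_all add: right_End_iff additive_End_iff)
  have comp: "compose (carrier (Pol n)) \<Theta> \<Xi> \<in> carrier ?E"
    using \<Theta> \<Xi> cl by (auto simp: right_End_iff additive_End_iff compose_eq sym_pols_iff[OF assms])
  have plus: "(\<lambda>a\<in>carrier (Pol n). \<Theta> a \<oplus>\<^bsub>Pol n\<^esub> \<Xi> a) \<in> carrier ?E"
    using \<Theta> \<Xi> cl
    by (auto simp: right_End_iff additive_End_iff sym_pols_iff[OF assms] a_ac l_distr)
  have t_comp: "transported n (compose (carrier (Pol n)) \<Theta> \<Xi>) p = transported n \<Theta> (transported n \<Xi> p)"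
    if "p \<in> spol_in {1..n}" for p
    using that cl by (simp add: transported_def compose_eq pol_of_in)
  have t_plus: "transported n (\<lambda>a\<in>carrier (Pol n). \<Theta> a \<oplus>\<^bsub>Pol n\<^esub> \<Xi> a) p =
      transported n \<Theta> p + transported n \<Xi> p" if "p \<in> spol_in {1..n}" for p
    using that cl by (simp add: transported_def pol_of_in val_hom)
  have entry: "mat_of n \<Theta> i j \<in> sym_pols n" "mat_of n \<Xi> i j \<in> sym_pols n"
    "val n (mat_of n \<Theta> i j) = crd n (transported n \<Theta> (bas n j)) i"
    "val n (mat_of n \<Xi> i j) = crd n (transported n \<Xi> (bas n j)) i"
    if "i < order_B n" "j < order_B n" for i j
    using mat_of_entry[OF \<Theta> assms that] mat_of_entry[OF \<Xi> assms that] by simp_all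
  have prod: "mat_of n \<Theta> i k \<otimes>\<^bsub>Pol n\<^esub> mat_of n \<Xi> k j \<in> sym_pols n"
    "val n (mat_of n \<Theta> i k \<otimes>\<^bsub>Pol n\<^esub> mat_of n \<Xi> k j) =
      crd n (transported n \<Theta> (bas n k)) i * crd n (transported n \<Xi> (bas n j)) k"
    if "i < order_B n" "j < order_B n" "k < order_B n" for i j k
    using entry[of i k] entry[of k j] that by (simp_all add: sym_pols_iff[OF assms] val_hom sym_spol_closed)
  show "mat_of n (\<Theta> \<otimes>\<^bsub>?E\<^esub> \<Xi>) = mat_of n \<Theta> \<otimes>\<^bsub>mat_ring (order_B n) (SymPol n)\<^esub> mat_of n \<Xi>"
    unfolding right_End_simps mat_ring_simps SymPol_simps
  proof (rule mat_of_eqI[OF comp assms])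
    fix i j assume ij: "i < order_B n" "j < order_B n"
    show "(\<Oplus>\<^bsub>SymPol n\<^esub>k\<in>{..<order_B n}. mat_of n \<Theta> i k \<otimes>\<^bsub>Pol n\<^esub> mat_of n \<Xi> k j) \<in> sym_pols n"
      by (rule val_finsum(1)[OF assms]) (use prod(1) ij in auto)
    have "val n (\<Oplus>\<^bsub>SymPol n\<^esub>k\<in>{..<order_B n}. mat_of n \<Theta> i k \<otimes>\<^bsub>Pol n\<^esub> mat_of n \<Xi> k j) =
        (\<Sum>k<order_B n. val n (mat_of n \<Theta> i k \<otimes>\<^bsub>Pol n\<^esub> mat_of n \<Xi> k j))"
      by (rule val_finsum(2)[OF assms]) (use prod(1) ij in auto)
    also have "\<dots> = (\<Sum>k<order_B n. crd n (transported n \<Theta> (bas n k)) i * crd n (transported n \<Xi> (bas n j)) k)"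
      by (rule sum.cong) (use prod(2) ij in auto)
    also have "\<dots> = crd n (transported n \<Theta> (transported n \<Xi> (bas n j))) i"
      by (rule crd_transported[OF \<Theta> assms transported(1)[OF \<Xi> assms bas_in] ij(1), symmetric])
    finally show "val n (\<Oplus>\<^bsub>SymPol n\<^esub>k\<in>{..<order_B n}. mat_of n \<Theta> i k \<otimes>\<^bsub>Pol n\<^esub> mat_of n \<Xi> k j) =
        crd n (transported n (compose (carrier (Pol n)) \<Theta> \<Xi>) (bas n j)) i"
      by (simp add: t_comp[OF bas_in])
  qed
  show "mat_of n (\<Theta> \<oplus>\<^bsub>?E\<^esub> \<Xi>) = mat_of n \<Theta> \<oplus>\<^bsub>mat_ring (order_B n) (SymPol n)\<^esub> mat_of n \<Xi>"
    unfolding right_End_simps mat_ring_simps SymPol_simps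
  proof (rule mat_of_eqI[OF plus assms])
    fix i j assume ij: "i < order_B n" "j < order_B n"
    note e = entry[OF ij]
    show "mat_of n \<Theta> i j \<oplus>\<^bsub>Pol n\<^esub> mat_of n \<Xi> i j \<in> sym_pols n"
      using e(1,2) by (simp add: sym_pols_iff[OF assms] val_hom sym_spol_closed)
    show "val n (mat_of n \<Theta> i j \<oplus>\<^bsub>Pol n\<^esub> mat_of n \<Xi> i j) =
        crd n (transported n (\<lambda>a\<in>carrier (Pol n). \<Theta> a \<oplus>\<^bsub>Pol n\<^esub> \<Xi> a) (bas n j)) i"
      using e ij by (simp add: sym_pols_iff[OF assms] val_hom t_plus[OF bas_in] crd_add
          transported(1)[OF \<Theta> assms bas_in] transported(1)[OF \<Xi> assms bas_in])
  qed
next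
  interpret ring "Pol n" by (rule ring_Pol)
  let ?E = "right_End (Pol n) (sym_pols n)"
  have one: "(\<lambda>a\<in>carrier (Pol n). a) \<in> carrier ?E"
    by (auto simp: right_End_iff additive_End_iff sym_pols_iff[OF assms])
  have t_one: "transported n (\<lambda>a\<in>carrier (Pol n). a) p = p" if "p \<in> spol_in {1..n}" for p
    using that by (simp add: transported_def pol_of_in)
  show "mat_of n \<one>\<^bsub>?E\<^esub> = \<one>\<^bsub>mat_ring (order_B n) (SymPol n)\<^esub>"
    unfolding right_End_simps mat_ring_simps SymPol_simps
    by (rule mat_of_eqI[OF one assms])
      (auto simp: sym_pols_iff[OF assms] val_hom sym_spol_closed t_one[OF bas_in] crd_bas)
qed

lemma mat_of_bij:
  assumes "n \<ge> 1"
  shows "bij_betw (mat_of n) (carrier (right_End (Pol n) (sym_pols n))) (carrier (mat_ring (order_B n) (SymPol n)))"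
proof (rule bij_betw_imageI)
  let ?E = "right_End (Pol n) (sym_pols n)"
  interpret ring "Pol n" by (rule ring_Pol)
  show "inj_on (mat_of n) (carrier ?E)"
  proof (rule inj_onI)
    fix \<Theta> \<Xi> assume \<Theta>: "\<Theta> \<in> carrier ?E" and \<Xi>: "\<Xi> \<in> carrier ?E" and eq: "mat_of n \<Theta> = mat_of n \<Xi>"
    show "\<Theta> = \<Xi>"
    proof (rule transported_bas_eq[OF \<Theta> \<Xi> assms])
      fix j assume j: "j < order_B n"
      have "crd n (transported n \<Theta> (bas n j)) i = crd n (transported n \<Xi> (bas n j)) i" if "i < order_B n" for i
        using mat_of_entry(2)[OF \<Theta> assms that j] mat_of_entry(2)[OF \<Xi> assms that j] eq by simp
      then have "(\<Sum>i<order_B n. bas n i * crd n (transported n \<Theta> (bas n j)) i) =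
          (\<Sum>i<order_B n. bas n i * crd n (transported n \<Xi> (bas n j)) i)" by simp
      then show "transported n \<Theta> (bas n j) = transported n \<Xi> (bas n j)"
        using bas_expand[OF transported(1)[OF \<Theta> assms bas_in[of n j]]]
          bas_expand[OF transported(1)[OF \<Xi> assms bas_in[of n j]]] by simp
    qed
  qed
  show "mat_of n ` carrier ?E = carrier (mat_ring (order_B n) (SymPol n))"
  proof
    show "mat_of n ` carrier ?E \<subseteq> carrier (mat_ring (order_B n) (SymPol n))"
      using ring_hom_closed[OF mat_of_hom[OF assms]] by blast
    show "carrier (mat_ring (order_B n) (SymPol n)) \<subseteq> mat_of n ` carrier ?E"
    proof
      fix M assume M: "M \<in> carrier (mat_ring (order_B n) (SymPol n))"
      then have Mij: "M i j \<in> sym_pols n" if "i < order_B n" "j < order_B n" for i j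
        using that by (auto simp: PiE_iff)
      then have Mlam: "val n (M i j) \<in> sym_spol n" if "i < order_B n" "j < order_B n" for i j
        using that by (simp add: sym_pols_iff[OF assms])
      \<comment> \<open>The operator with matrix \<open>M\<close>.\<close>
      define D where "D = (\<lambda>p. \<Sum>i<order_B n. bas n i * (\<Sum>j<order_B n. val n (M i j) * crd n p j))"
      have row: "(\<Sum>j<order_B n. val n (M i j) * crd n p j) \<in> sym_spol n" if "p \<in> spol_in {1..n}" "i < order_B n" for p i
        using that by (intro sym_spol_sum sym_spol_closed Mlam crd_sym_spol) auto
      have D_in: "D p \<in> spol_in {1..n}" if "p \<in> spol_in {1..n}" for p
        unfolding D_def spol_in_def
      proof (rule word_span_sum)
        fix i assume "i \<in> {..<order_B n}"
        then have "(\<Sum>j<order_B n. val n (M i j) * crd n p j) \<in> spol_in {1..n}"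
          using row[OF that, of i] sym_spol_subset by blast
        then show "bas n i * (\<Sum>j<order_B n. val n (M i j) * crd n p j) \<in> word_span (lists {1..n})"
          unfolding spol_in_def[symmetric] by (intro spol_in_closed(6) bas_in)
      qed
      have D_add: "D (p + q) = D p + D q" if "p \<in> spol_in {1..n}" "q \<in> spol_in {1..n}" for p q
        using that by (simp add: D_def crd_add distrib_left sum.distrib)
      have D_mult: "D (p * l) = D p * l" if "p \<in> spol_in {1..n}" "l \<in> sym_spol n" for p l
        using that by (simp add: D_def crd_mult sum_distrib_right mult.assoc)
      note L = lift_op[of n D, OF D_in]
      have \<Theta>: "lift_op n D \<in> carrier ?E"
        unfolding right_End_iff
      proof (intro conjI ballI)
        show "lift_op n D \<in> carrier (additive_End (Pol n))"
          by (rule lift_op_additive) (simp_all add: D_in D_add)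
        fix a l assume a: "a \<in> carrier (Pol n)" and l: "l \<in> sym_pols n"
        then show "lift_op n D (a \<otimes>\<^bsub>Pol n\<^esub> l) = lift_op n D a \<otimes>\<^bsub>Pol n\<^esub> l"
          by (intro val_eqI[where n = n]) (simp_all add: L sym_pols_iff[OF assms] val_hom D_mult val_in)
      qed
      have "crd n (transported n (lift_op n D) (bas n j)) i = val n (M i j)" if ij: "i < order_B n" "j < order_B n" for i j
      proof -
        have "crd n (D (bas n j)) i = (\<Sum>k<order_B n. val n (M i k) * crd n (bas n j) k)"
          unfolding D_def
          by (rule crd_unique[where c = "\<lambda>i. \<Sum>k<order_B n. val n (M i k) * crd n (bas n j) k"])
            (use row[OF bas_in] ij(1) in auto)
        also have "\<dots> = val n (M i j)"
          using ij by (simp add: crd_bas of_bool_def if_distrib cong: if_cong)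
        finally show ?thesis using transported_lift_op[of n D, OF D_in bas_in] by simp
      qed
      then have "mat_of n (lift_op n D) = (\<lambda>i\<in>{..<order_B n}. \<lambda>j\<in>{..<order_B n}. M i j)"
        by (intro mat_of_eqI[OF \<Theta> assms] Mij) simp_all
      also have "\<dots> = M"
      proof (rule extensionalityI[where A = "{..<order_B n}"])
        fix i assume i: "i \<in> {..<order_B n}"
        then have "M i \<in> extensional {..<order_B n}" using M by (auto simp: PiE_iff)
        then show "(\<lambda>i\<in>{..<order_B n}. \<lambda>j\<in>{..<order_B n}. M i j) i = M i"
          using i by (simp add: extensional_restrict)
      qed (use M in \<open>auto simp: PiE_iff\<close>)
      finally show "M \<in> mat_of n ` carrier ?E" using \<Theta> by blast
    qed
  qed
qed

text \<open>The basis is homogeneous and the coordinates of homogeneous elements are homogeneous, so the degree of an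
  endomorphism can be read off from the entries of its matrix.\<close>

theorem mat_of_iso:
  assumes "n \<ge> 1"
  shows "mat_of n \<in> graded_ring_iso
    (right_End (Pol n) (sym_pols n)) (right_End_degree (Pol n) (sym_pols n) (Pol_degree n))
    (Mat (fls_X ^ (n ^ 2) * even_qdfact n) (SymPol n))
    (Mat_degree (fls_X ^ (n ^ 2) * even_qdfact n) (SymPol n) (SymPol_degree n))"
proof -
  let ?E = "right_End (Pol n) (sym_pols n)" and ?f = "fls_X ^ (n ^ 2) * even_qdfact n"
  have len: "length (exponents ?f) = order_B n"
    by (simp add: exponents_rank basis_order_def)
  have ex: "exponents ?f ! i = bas_deg n i" if "i < order_B n" for i
    using that by (simp add: exponents_rank bas_deg_def basis_order_def)
  have Mat: "Mat ?f (SymPol n) = mat_ring (order_B n) (SymPol n)" by (simp add: Mat_def len)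
  have entry_deg: "mat_of n \<Theta> i j \<in> SymPol_degree n e \<longleftrightarrow> crd n (transported n \<Theta> (bas n j)) i \<in> spol_deg {1..n} e"
    if "\<Theta> \<in> carrier ?E" "i < order_B n" "j < order_B n" for \<Theta> i j e
    using mat_of_entry[OF that(1) assms that(2,3)]
    by (simp add: SymPol_degree_def Pol_degree_iff sym_pols_iff[OF assms])
  have deg: "\<Theta> \<in> right_End_degree (Pol n) (sym_pols n) (Pol_degree n) d \<longleftrightarrow>
      mat_of n \<Theta> \<in> Mat_degree ?f (SymPol n) (SymPol_degree n) d" if \<Theta>: "\<Theta> \<in> carrier ?E" for \<Theta> d
  proof -
    let ?T = "transported n \<Theta>"
    have "mat_of n \<Theta> \<in> Mat_degree ?f (SymPol n) (SymPol_degree n) d \<longleftrightarrow>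
        (\<forall>i<order_B n. \<forall>j<order_B n. crd n (?T (bas n j)) i \<in> spol_deg {1..n} (d + bas_deg n j - bas_deg n i))"
      using ring_hom_closed[OF mat_of_hom[OF assms] \<Theta>]
      by (simp add: Mat_degree_def Mat len ex entry_deg[OF \<Theta>] del: mat_ring_simps)
    also have "\<dots> \<longleftrightarrow> (\<forall>k. \<forall>p \<in> spol_deg {1..n} k. ?T p \<in> spol_deg {1..n} (k + d))"
    proof (intro iffI allI impI ballI)
      fix i j assume *: "\<forall>k. \<forall>p \<in> spol_deg {1..n} k. ?T p \<in> spol_deg {1..n} (k + d)" and ij: "i < order_B n" "j < order_B n"
      have "?T (bas n j) \<in> spol_deg {1..n} (bas_deg n j + d)" using * bas_deg by blast
      from crd_deg[OF this ij(1)]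
      show "crd n (?T (bas n j)) i \<in> spol_deg {1..n} (d + bas_deg n j - bas_deg n i)"
        by (simp add: algebra_simps)
    next
      fix k p
      assume *: "\<forall>i<order_B n. \<forall>j<order_B n. crd n (?T (bas n j)) i \<in> spol_deg {1..n} (d + bas_deg n j - bas_deg n i)"
        and p: "p \<in> spol_deg {1..n} k"
      have pin: "p \<in> spol_in {1..n}" using p spol_deg_subset by blast
      have "bas n i * crd n (?T p) i \<in> spol_deg {1..n} (k + d)" if i: "i < order_B n" for i
      proof -
        have "crd n (?T (bas n j)) i * crd n p j \<in> spol_deg {1..n} (k + d - bas_deg n i)" if j: "j < order_B n" for j
        proof -
          have "crd n (?T (bas n j)) i * crd n p j \<in>
              spol_deg {1..n} ((d + bas_deg n j - bas_deg n i) + (k - bas_deg n j))"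
            by (rule spol_deg_closed(6)[OF *[rule_format, OF i j] crd_deg[OF p j]])
          then show ?thesis by (simp add: algebra_simps)
        qed
        then have "crd n (?T p) i \<in> spol_deg {1..n} (k + d - bas_deg n i)"
          unfolding crd_transported[OF \<Theta> assms pin i] spol_deg_def by (intro word_span_sum) auto
        from spol_deg_closed(6)[OF bas_deg[of n i] this] show ?thesis by simp
      qed
      then have "(\<Sum>i<order_B n. bas n i * crd n (?T p) i) \<in> spol_deg {1..n} (k + d)"
        unfolding spol_deg_def by (intro word_span_sum) auto
      then show "?T p \<in> spol_deg {1..n} (k + d)"
        using bas_expand[OF transported(1)[OF \<Theta> assms pin]] by simp
    qed
    finally show ?thesis using right_End_degree_iff[OF \<Theta> assms] by blast
  qed
  have "mat_of n ` right_End_degree (Pol n) (sym_pols n) (Pol_degree n) d =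
      Mat_degree ?f (SymPol n) (SymPol_degree n) d" for d
  proof
    show "mat_of n ` right_End_degree (Pol n) (sym_pols n) (Pol_degree n) d \<subseteq>
        Mat_degree ?f (SymPol n) (SymPol_degree n) d"
      using deg by (auto simp: right_End_degree_def)
    show "Mat_degree ?f (SymPol n) (SymPol_degree n) d \<subseteq>
        mat_of n ` right_End_degree (Pol n) (sym_pols n) (Pol_degree n) d"
    proof
      fix M assume M: "M \<in> Mat_degree ?f (SymPol n) (SymPol_degree n) d"
      then have "M \<in> carrier (mat_ring (order_B n) (SymPol n))" unfolding Mat_degree_def Mat by blast
      then obtain \<Theta> where "\<Theta> \<in> carrier ?E" "M = mat_of n \<Theta>"
        using mat_of_bij[OF assms] unfolding bij_betw_def by blast
      then show "M \<in> mat_of n ` right_End_degree (Pol n) (sym_pols n) (Pol_degree n) d"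
        using deg M by blast
    qed
  qed
  then show ?thesis
    using mat_of_hom[OF assms] mat_of_bij[OF assms]
    by (simp add: graded_ring_iso_def ring_iso_def Mat del: mat_ring_simps)
qed

theorem theorem5p5:
  fixes n :: nat
  assumes "n \<ge> 1"
  shows "\<exists>\<phi> \<psi>.
    polynomial_rep n \<phi> \<and>
    \<phi> \<in> graded_ring_iso (NH n) (NH_degree n)
          (right_End (Pol n) (sym_pols n)) (right_End_degree (Pol n) (sym_pols n) (Pol_degree n)) \<and>
    \<psi> \<in> graded_ring_iso
          (right_End (Pol n) (sym_pols n)) (right_End_degree (Pol n) (sym_pols n) (Pol_degree n))
          (Mat (fls_X ^ (n ^ 2) * even_qdfact n) (SymPol n))
          (Mat_degree (fls_X ^ (n ^ 2) * even_qdfact n) (SymPol n) (SymPol_degree n))"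
  using polynomial_rep_rep[OF assms] rep_iso[OF assms] mat_of_iso[OF assms] by blast

end
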